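(* Let $p,q>1$ be integers with $\frac{\log p}{\log q}$ irrational. The following are equivalent: (a) (Furstenberg's conjecture for $p,q$) every ergodic $\times p,\times q$-invariant Borel probability measure on $\mathbb{T}$ is either finitely supported or the Lebesgue measure; (b) there is a unique (up to unitary equivalence) irreducible unitary representation $U:\mathbb{Z}[\frac1{pq}]\rtimes\mathbb{Z}^2\to B(H)$ such that $H_{\mathbb{Z}^2}\neq0$ and $U(z^k)x\neq x$ for every nonzero integer $k$ and every nonzero $x\in H_{\mathbb{Z}^2}$.
   Context: $\mathbb{T}$ is the unit circle; $T_p(z)=z^p$, $T_q(z)=z^q$ on $\mathbb{T}$. A Borel probability measure $\mu$ on $\mathbb{T}$ is $\times p,\times q$-invariant if $\mu(T_p^{-1}E)=\mu(T_q^{-1}E)=\mu(E)$ for all Borel $E$; it is ergodic if every Borel $E$ with $T_p^{-1}E=E=T_q^{-1}E$ has $\mu(E)\in\{0,1\}$. The Lebesgue measure on $\mathbb{T}$ is normalized to be a probability measure. $\mathbb{Z}[\frac1{pq}]$ is a discrete additive group whose element $k$ is written multiplicatively as $z^k$; $\mathbb{Z}^2$ acts on it by automorphisms, $(m,n)\cdot z^k=z^{kp^mq^n}$, and $\mathbb{Z}[\frac1{pq}]\rtimes\mathbb{Z}^2$ is the corresponding semidirect product. For a unitary representation $U$ of it on a Hilbert space $H$, $H_{\mathbb{Z}^2}=\{x\in H:U(g)x=x\text{ for all }g\in\mathbb{Z}^2\}$. *)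

theory Defs
  imports "HOL-Probability.Probability" "HOL-Algebra.Module" "HOL-Algebra.Group_Action"
    "HOL-Algebra.Elementary_Groups" "HOL-Library.Equipollence"
begin

section \<open>Invariant measures on the circle\<close>

definition circle_borel :: "complex measure" where
  "circle_borel = restrict_space borel (sphere 0 1)"

definition circle_lebesgue :: "complex measure" where
  "circle_lebesgue = distr (uniform_measure lborel {0..<1}) circle_borel (\<lambda>t. cis (2 * pi * t))"

definition circle_preimage :: "nat \<Rightarrow> complex set \<Rightarrow> complex set" where
  "circle_preimage p E = {z \<in> sphere 0 1. z ^ p \<in> E}"

definition invariant_prob :: "nat \<Rightarrow> nat \<Rightarrow> complex measure \<Rightarrow> bool" where
  "invariant_prob p q \<mu> \<longleftrightarrow> prob_space \<mu> \<and> sets \<mu> = sets circle_borel \<and>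
     (\<forall>E\<in>sets circle_borel. measure \<mu> (circle_preimage p E) = measure \<mu> E \<and>
                            measure \<mu> (circle_preimage q E) = measure \<mu> E)"

definition ergodic_prob :: "nat \<Rightarrow> nat \<Rightarrow> complex measure \<Rightarrow> bool" where
  "ergodic_prob p q \<mu> \<longleftrightarrow> invariant_prob p q \<mu> \<and>
     (\<forall>E\<in>sets circle_borel. circle_preimage p E = E \<and> circle_preimage q E = E \<longrightarrow>
        measure \<mu> E \<in> {0, 1})"

definition finitely_supported :: "complex measure \<Rightarrow> bool" where
  "finitely_supported \<mu> \<longleftrightarrow>
     (\<exists>F. finite F \<and> F \<subseteq> sphere 0 1 \<and> measure \<mu> (sphere 0 1 - F) = 0)"


section \<open>Complex Hilbert spaces\<close>

text \<open>Hilbert spaces are carrier-based, so that one type can serve as a universe containing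
  Hilbert spaces of different dimensions and one can quantify over them inside a formula.
  The underlying vector space is a module of HOL-Algebra over the field of complex numbers
  (whose record inherits the multiplicative components of a ring; they play no role here).

  The universe \<open>'h\<close> has to contain at least continuum many elements: then it has room for a copy of
  every separable Hilbert space, in particular of the space of any irreducible representation of a
  countable group (such a representation is cyclic). Over a smaller type, existence could fail
  merely for lack of elements. A statement for all such \<open>'h\<close> covers Hilbert spaces of any size.\<close>

definition complex_ring :: "complex ring" where
  "complex_ring = \<lparr>carrier = UNIV, mult = (*), one = 1, zero = 0, add = (+)\<rparr>"

record 'h inner_space = "(complex, 'h) module" +
  cinner :: "'h \<Rightarrow> 'h \<Rightarrow> complex"

definition hnorm :: "('h, 'x) inner_space_scheme \<Rightarrow> 'h \<Rightarrow> real" where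
  "hnorm V x = sqrt (Re (cinner V x x))"

text \<open>The value outside the carrier is irrelevant, but the locale \<open>Metric_space\<close> wants a
  distance that is nonnegative and symmetric on the whole type.\<close>

definition hdist :: "('h, 'x) inner_space_scheme \<Rightarrow> 'h \<Rightarrow> 'h \<Rightarrow> real" where
  "hdist V x y = (if x \<in> carrier V \<and> y \<in> carrier V then hnorm V (x \<ominus>\<^bsub>V\<^esub> y) else 0)"

locale pre_hilbert_space = Module.module complex_ring V
  for V :: "('h, 'x) inner_space_scheme" (structure) +
  assumes cinner_add_left: "\<lbrakk>x \<in> carrier V; y \<in> carrier V; z \<in> carrier V\<rbrakk> \<Longrightarrow>
      cinner V (x \<oplus> y) z = cinner V x z + cinner V y z"
    and cinner_smult_left: "\<lbrakk>x \<in> carrier V; y \<in> carrier V\<rbrakk> \<Longrightarrow>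
      cinner V (c \<odot> x) y = c * cinner V x y"
    and cinner_commute: "\<lbrakk>x \<in> carrier V; y \<in> carrier V\<rbrakk> \<Longrightarrow>
      cinner V y x = cnj (cinner V x y)"
    and cinner_pos: "\<lbrakk>x \<in> carrier V; x \<noteq> \<zero>\<rbrakk> \<Longrightarrow> 0 < Re (cinner V x x)"

locale hilbert_space = pre_hilbert_space V
  for V :: "('h, 'x) inner_space_scheme" (structure) +
  assumes complete: "Metric_space.mcomplete (carrier V) (hdist V)"

definition closed_subspace :: "('h, 'x) inner_space_scheme \<Rightarrow> 'h set \<Rightarrow> bool" where
  "closed_subspace V W \<longleftrightarrow> submodule W complex_ring V \<and>
     closedin (Metric_space.mtopology (carrier V) (hdist V)) W"

definition unitary_map ::
  "('h, 'x) inner_space_scheme \<Rightarrow> ('k, 'y) inner_space_scheme \<Rightarrow> ('h \<Rightarrow> 'k) \<Rightarrow> bool" where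
  "unitary_map V W f \<longleftrightarrow> bij_betw f (carrier V) (carrier W) \<and>
     (\<forall>x\<in>carrier V. \<forall>y\<in>carrier V. f (x \<oplus>\<^bsub>V\<^esub> y) = f x \<oplus>\<^bsub>W\<^esub> f y) \<and>
     (\<forall>c. \<forall>x\<in>carrier V. f (c \<odot>\<^bsub>V\<^esub> x) = c \<odot>\<^bsub>W\<^esub> f x) \<and>
     (\<forall>x\<in>carrier V. \<forall>y\<in>carrier V. cinner W (f x) (f y) = cinner V x y)"


section \<open>Unitary representations\<close>

text \<open>Operators are functions on the type \<open>'h\<close> of which only the restriction to the carrier
  matters; \<open>group_action\<close> makes them \<open>undefined\<close> outside of it.\<close>

definition unitary_rep ::
  "('g, 'a) monoid_scheme \<Rightarrow> ('h, 'x) inner_space_scheme \<Rightarrow> ('g \<Rightarrow> 'h \<Rightarrow> 'h) \<Rightarrow> bool" where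
  "unitary_rep G V U \<longleftrightarrow> hilbert_space V \<and> group_action G (carrier V) U \<and>
     (\<forall>g\<in>carrier G. unitary_map V V (U g))"

definition irreducible_rep ::
  "('g, 'a) monoid_scheme \<Rightarrow> ('h, 'x) inner_space_scheme \<Rightarrow> ('g \<Rightarrow> 'h \<Rightarrow> 'h) \<Rightarrow> bool" where
  "irreducible_rep G V U \<longleftrightarrow> unitary_rep G V U \<and> carrier V \<noteq> {\<zero>\<^bsub>V\<^esub>} \<and>
     (\<forall>W. closed_subspace V W \<and> (\<forall>g\<in>carrier G. U g ` W \<subseteq> W) \<longrightarrow>
        W = {\<zero>\<^bsub>V\<^esub>} \<or> W = carrier V)"

definition unitarily_equivalent ::
  "('g, 'a) monoid_scheme \<Rightarrow> ('h, 'x) inner_space_scheme \<Rightarrow> ('g \<Rightarrow> 'h \<Rightarrow> 'h) \<Rightarrow>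
   ('k, 'y) inner_space_scheme \<Rightarrow> ('g \<Rightarrow> 'k \<Rightarrow> 'k) \<Rightarrow> bool" where
  "unitarily_equivalent G V U V' U' \<longleftrightarrow>
     (\<exists>f. unitary_map V V' f \<and> (\<forall>g\<in>carrier G. \<forall>x\<in>carrier V. f (U g x) = U' g (f x)))"


section \<open>The group\<close>

definition Z_inv :: "nat \<Rightarrow> rat monoid" where
  "Z_inv d = \<lparr>carrier = {of_int a / of_nat d ^ n |a n. True}, mult = (+), one = 0\<rparr>"

definition semidirect_product ::
  "('a, 'x) monoid_scheme \<Rightarrow> ('b, 'y) monoid_scheme \<Rightarrow> ('b \<Rightarrow> 'a \<Rightarrow> 'a) \<Rightarrow> ('a \<times> 'b) monoid" where
  "semidirect_product N H \<phi> =
     \<lparr>carrier = carrier N \<times> carrier H,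
      mult = (\<lambda>(a, g) (b, h). (a \<otimes>\<^bsub>N\<^esub> \<phi> g b, g \<otimes>\<^bsub>H\<^esub> h)),
      one = (\<one>\<^bsub>N\<^esub>, \<one>\<^bsub>H\<^esub>)\<rparr>"

definition Z2_action :: "nat \<Rightarrow> nat \<Rightarrow> int \<times> int \<Rightarrow> rat \<Rightarrow> rat" where
  "Z2_action p q = (\<lambda>(m, n) k. k * of_nat p powi m * of_nat q powi n)"

definition furstenberg_group :: "nat \<Rightarrow> nat \<Rightarrow> (rat \<times> int \<times> int) monoid" where
  "furstenberg_group p q =
     semidirect_product (Z_inv (p * q)) (integer_group \<times>\<times> integer_group) (Z2_action p q)"

text \<open>The elements \<open>z\<^sup>k\<close> of the normal factor.\<close>

definition zpow :: "rat \<Rightarrow> rat \<times> int \<times> int" where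
  "zpow k = (k, (0, 0))"

definition Z2_fixed :: "('h, 'x) inner_space_scheme \<Rightarrow> (rat \<times> int \<times> int \<Rightarrow> 'h \<Rightarrow> 'h) \<Rightarrow> 'h set" where
  "Z2_fixed V U = {x \<in> carrier V. \<forall>m n. U (0, (m, n)) x = x}"

definition furstenberg_rep ::
  "nat \<Rightarrow> nat \<Rightarrow> ('h, 'x) inner_space_scheme \<Rightarrow> (rat \<times> int \<times> int \<Rightarrow> 'h \<Rightarrow> 'h) \<Rightarrow> bool" where
  "furstenberg_rep p q V U \<longleftrightarrow> irreducible_rep (furstenberg_group p q) V U \<and>
     Z2_fixed V U \<noteq> {\<zero>\<^bsub>V\<^esub>} \<and>
     (\<forall>k::int. \<forall>x\<in>Z2_fixed V U. k \<noteq> 0 \<and> x \<noteq> \<zero>\<^bsub>V\<^esub> \<longrightarrow> U (zpow (of_int k)) x \<noteq> x)"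


section \<open>The constructions are well defined\<close>

lemma prob_space_circle_lebesgue: "prob_space circle_lebesgue"
proof -
  have "(\<lambda>t::real. cis (2 * pi * t)) \<in> borel_measurable borel"
    by (intro borel_measurable_continuous_onI) (auto intro!: continuous_intros)
  then have "(\<lambda>t::real. cis (2 * pi * t)) \<in> uniform_measure lborel {0..<1} \<rightarrow>\<^sub>M circle_borel"
    unfolding circle_borel_def by (intro measurable_restrict_space2) auto
  moreover have "prob_space (uniform_measure lborel {0..<1::real})"
    by (intro prob_space_uniform_measure) auto
  ultimately show ?thesis
    unfolding circle_lebesgue_def by (rule prob_space.prob_space_distr[rotated])
qed

lemma cring_complex_ring: "cring complex_ring"
proof -
  have "\<exists>y. y + x = 0" for x :: complex
    by (rule exI[of _ "- x"]) simp
  then show ?thesis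
    unfolding complex_ring_def
    by (intro cringI abelian_groupI comm_monoidI) (simp_all add: algebra_simps)
qed

context pre_hilbert_space
begin

lemma V_minus_add:
  assumes "x \<in> carrier V" "y \<in> carrier V" "z \<in> carrier V"
  shows "x \<ominus> z = (x \<ominus> y) \<oplus> (y \<ominus> z)"
  using assms by (simp add: minus_eq M.a_ac M.r_neg1 M.r_neg2)

lemma cinner_add_right: "\<lbrakk>x \<in> carrier V; y \<in> carrier V; z \<in> carrier V\<rbrakk> \<Longrightarrow>
      cinner V z (x \<oplus> y) = cinner V z x + cinner V z y"
  using cinner_commute[of "x \<oplus> y" z] cinner_commute[of x z] cinner_commute[of y z]
  by (simp add: cinner_add_left)

lemma smult_in: "x \<in> carrier V \<Longrightarrow> c \<odot> x \<in> carrier V"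
  by (rule smult_closed) (simp_all add: complex_ring_def)

lemma cinner_smult_right: "\<lbrakk>x \<in> carrier V; y \<in> carrier V\<rbrakk> \<Longrightarrow>
      cinner V y (c \<odot> x) = cnj c * cinner V y x"
  using cinner_commute[of "c \<odot> x" y] cinner_commute[of x y]
  by (simp add: cinner_smult_left smult_in)

lemma cinner_zero_left: "y \<in> carrier V \<Longrightarrow> cinner V \<zero> y = 0"
  using cinner_add_left[of \<zero> \<zero> y] by simp

lemma cinner_nonneg: "x \<in> carrier V \<Longrightarrow> 0 \<le> Re (cinner V x x)"
  using cinner_pos[of x] cinner_zero_left[of x] by (cases "x = \<zero>") force+

lemma cinner_self: "x \<in> carrier V \<Longrightarrow> cinner V x x = of_real (Re (cinner V x x))"
  using cinner_commute[of x x] by (simp add: complex_eq_iff)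

lemma uminus_smult: "x \<in> carrier V \<Longrightarrow> \<ominus> x = (-1) \<odot> x"
proof -
  assume x: "x \<in> carrier V"
  have i: "(1::complex) \<odot> x = x" using smult_one[OF x] by (simp add: complex_ring_def)
  have z: "(0::complex) \<odot> x = \<zero>" using smult_l_null[OF x] by (simp add: complex_ring_def)
  have "((-1) + 1::complex) \<odot> x = ((-1) \<odot> x) \<oplus> (1 \<odot> x)"
    using smult_l_distr[of "-1" 1 x] x by (simp add: complex_ring_def)
  then have "((-1) \<odot> x) \<oplus> x = \<zero>" using i z by simp
  then show ?thesis using x by (metis M.minus_equality smult_in)
qed

lemma hnorm_triangle:
  assumes x: "x \<in> carrier V" and y: "y \<in> carrier V"
  shows "hnorm V (x \<oplus> y) \<le> hnorm V x + hnorm V y"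
proof -
  define a where "a = Re (cinner V x x)"
  define b where "b = Re (cinner V y y)"
  define r where "r = Re (cinner V x y)"
  have ex: "Re (cinner V (of_real s \<odot> x \<oplus> of_real t \<odot> y) (of_real s \<odot> x \<oplus> of_real t \<odot> y))
      = s\<^sup>2 * a + 2 * s * t * r + t\<^sup>2 * b" for s t
  proof -
    have "Re (cinner V y x) = r" using cinner_commute[OF x y] by (simp add: r_def)
    then show ?thesis using x y
      by (simp add: cinner_add_left cinner_add_right cinner_smult_left cinner_smult_right smult_in
          a_def b_def r_def power2_eq_square algebra_simps)
  qed
  have nn: "0 \<le> s\<^sup>2 * a + 2 * s * t * r + t\<^sup>2 * b" for s t
    unfolding ex[symmetric] using x y by (intro cinner_nonneg M.a_closed smult_in)
  have ab: "0 \<le> a" "0 \<le> b" using cinner_nonneg x y by (auto simp: a_def b_def)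
  have "0 \<le> b * (a * b - r\<^sup>2)"
    using nn[of b "-r"] by (simp add: power2_eq_square algebra_simps)
  moreover have "r = 0" if "b = 0"
  proof (rule ccontr)
    assume "r \<noteq> 0"
    then show False using nn[of 1 "- (a + 1) / (2 * r)"] that by (simp add: field_simps)
  qed
  ultimately have "r\<^sup>2 \<le> a * b"
    using ab by (cases "b = 0") (auto simp: zero_le_mult_iff)
  then have "r \<le> sqrt a * sqrt b"
    by (metis real_le_rsqrt real_sqrt_mult)
  then have "a + 2 * r + b \<le> (sqrt a + sqrt b)\<^sup>2"
    using ab by (simp add: power2_sum)
  moreover have "Re (cinner V (x \<oplus> y) (x \<oplus> y)) = a + 2 * r + b"
  proof -
    have "Re (cinner V y x) = r" using cinner_commute[OF x y] by (simp add: r_def)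
    then show ?thesis using x y
      by (simp add: cinner_add_left cinner_add_right a_def b_def r_def)
  qed
  ultimately show ?thesis
    using ab by (auto simp: hnorm_def a_def[symmetric] b_def[symmetric] intro!: real_le_lsqrt)
qed

lemma Metric_space_hdist: "Metric_space (carrier V) (hdist V)"
proof
  fix x y
  show "0 \<le> hdist V x y"
    by (auto simp: hdist_def hnorm_def intro: cinner_nonneg)
  have "hnorm V (x \<ominus> y) = hnorm V (y \<ominus> x)" if "x \<in> carrier V" "y \<in> carrier V"
  proof -
    have "y \<ominus> x = \<ominus> (x \<ominus> y)" using that by (simp add: minus_eq M.minus_add M.a_comm)
    then have "y \<ominus> x = (-1) \<odot> (x \<ominus> y)" using that by (simp add: uminus_smult)
    then show ?thesis using that
      by (simp add: hnorm_def cinner_smult_left cinner_smult_right smult_in)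
  qed
  then show "hdist V x y = hdist V y x" by (auto simp: hdist_def)
next
  fix x y assume xy: "x \<in> carrier V" "y \<in> carrier V"
  have "hnorm V (x \<ominus> y) = 0 \<longleftrightarrow> x \<ominus> y = \<zero>"
    using xy cinner_pos[of "x \<ominus> y"] cinner_zero_left[of \<zero>] by (force simp: hnorm_def)
  moreover have "x \<ominus> y = \<zero> \<longleftrightarrow> x = y"
    using xy by (metis M.minus_equality M.minus_minus M.a_inv_closed M.r_neg minus_eq)
  ultimately show "hdist V x y = 0 \<longleftrightarrow> x = y" using xy by (simp add: hdist_def)

next
  fix x y z assume "x \<in> carrier V" "y \<in> carrier V" "z \<in> carrier V"
  then show "hdist V x z \<le> hdist V x y + hdist V y z"
    using V_minus_add[of x y z] hnorm_triangle[of "x \<ominus> y" "y \<ominus> z"] by (simp add: hdist_def)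
qed

end

lemma Z_invI: "x = of_int a / of_nat d ^ n \<Longrightarrow> x \<in> carrier (Z_inv d)"
  unfolding Z_inv_def by auto

lemma Z_inv_uminus: "x \<in> carrier (Z_inv d) \<Longrightarrow> - x \<in> carrier (Z_inv d)"
proof -
  assume "x \<in> carrier (Z_inv d)"
  then obtain i n where "x = of_int i / of_nat d ^ n" by (auto simp: Z_inv_def)
  then show ?thesis by (intro Z_invI[of _ "- i" _ n]) simp
qed

lemma Z_inv_closed:
  assumes "a \<in> carrier (Z_inv d)" "b \<in> carrier (Z_inv d)" "d > 0"
  shows "a + b \<in> carrier (Z_inv d)" "a * b \<in> carrier (Z_inv d)"
proof -
  obtain i m j n where *: "a = of_int i / of_nat d ^ m" "b = of_int j / of_nat d ^ n"
    using assms by (auto simp: Z_inv_def)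
  have "a + b = of_int (i * int d ^ n + j * int d ^ m) / of_nat d ^ (m + n)"
    using * \<open>d > 0\<close> by (simp add: add_divide_distrib power_add)
  then show "a + b \<in> carrier (Z_inv d)" by (rule Z_invI)
  have "a * b = of_int (i * j) / of_nat d ^ (m + n)"
    using * by (simp add: power_add)
  then show "a * b \<in> carrier (Z_inv d)" by (rule Z_invI)
qed

lemma Z_inv_powi:
  assumes "p > 0" "q > 0"
  shows "of_nat p powi m \<in> carrier (Z_inv (p * q))" (is "?x \<in> _")
proof (cases "m \<ge> 0")
  case True
  then have "?x = of_int (int p ^ nat m) / of_nat (p * q) ^ 0" by (simp add: power_int_def)
  then show ?thesis by (rule Z_invI)
next
  case False
  then have "?x = of_int (int q ^ nat (- m)) / of_nat (p * q) ^ nat (- m)"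
    using assms by (simp add: power_int_def field_simps power_mult_distrib)
  then show ?thesis by (rule Z_invI)
qed

lemma Z2_action_closed:
  assumes "p > 0" "q > 0" "k \<in> carrier (Z_inv (p * q))"
  shows "Z2_action p q g k \<in> carrier (Z_inv (p * q))"
  using assms Z_inv_powi[of p q] Z_inv_powi[of q p] Z_inv_closed[of _ "p * q"]
  by (simp add: Z2_action_def mult.commute split: prod.splits)

lemma Z2_action_add:
  assumes "p > 0" "q > 0"
  shows "Z2_action p q (m + m', n + n') k = Z2_action p q (m, n) (Z2_action p q (m', n') k)"
  using assms by (simp add: Z2_action_def power_int_add)

lemma Z2_action_distrib: "Z2_action p q g (k + l) = Z2_action p q g k + Z2_action p q g l"
  by (simp add: Z2_action_def distrib_right split: prod.splits)

lemma furstenberg_group_simps: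
  "carrier (furstenberg_group p q) = carrier (Z_inv (p * q)) \<times> UNIV"
  "(k, (m, n)) \<otimes>\<^bsub>furstenberg_group p q\<^esub> (k', (m', n')) =
     (k + Z2_action p q (m, n) k', (m + m', n + n'))"
  "\<one>\<^bsub>furstenberg_group p q\<^esub> = (0, (0, 0))"
  by (simp_all add: furstenberg_group_def semidirect_product_def DirProd_def Z_inv_def)

lemma group_furstenberg_group:
  assumes "p > 0" "q > 0"
  shows "group (furstenberg_group p q)"
proof (rule groupI, goal_cases)
  case (1 x y)
  then show ?case
    using Z_inv_closed(1)[of _ "p * q"] Z2_action_closed[OF assms] assms
    by (cases x; cases y) (auto simp: furstenberg_group_simps)
next
  case 2
  show ?case
    by (auto simp: furstenberg_group_simps intro: Z_invI[of _ 0 _ 0])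
next
  case (3 x y z)
  show ?case
    by (cases x; cases y; cases z)
      (simp add: furstenberg_group_simps Z2_action_add[OF assms] Z2_action_distrib add.assoc)
next
  case (4 x)
  show ?case by (cases x) (simp add: furstenberg_group_simps Z2_action_def)
next
  case (5 x)
  obtain k m n where x: "x = (k, (m, n))" by (metis surj_pair)
  have "- k \<in> carrier (Z_inv (p * q))"
    using 5 x by (simp add: furstenberg_group_simps Z_inv_uminus)
  then have "Z2_action p q (- m, - n) (- k) \<in> carrier (Z_inv (p * q))"
    by (rule Z2_action_closed[OF assms])
  moreover have "Z2_action p q (- m, - n) (- k) + Z2_action p q (- m, - n) k = 0"
    by (simp add: Z2_action_def)
  ultimately show ?case unfolding x
    by (intro bexI[of _ "(Z2_action p q (- m, - n) (- k), (- m, - n))"])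
      (simp_all add: furstenberg_group_simps)
qed

end

theory Submission
  imports Defs
begin

text \<open>
  A \<open>\<int>\<^sup>2\<close>-fixed unit vector \<open>x\<close> yields the positive definite function \<open>k \<mapsto> \<langle>U(z\<^sup>k) x, x\<rangle>\<close> on \<open>\<int>[1/(pq)]\<close>. It is
  invariant under multiplication by \<open>p\<close> and \<open>q\<close>, hence determined by its restriction to \<open>\<int>\<close>, which by
  Herglotz's theorem consists of the Fourier coefficients of an invariant measure \<open>\<mu>\<close> on the circle.
  A cyclic representation is determined by its positive definite function.

  Irreducibility corresponds to ergodicity. If \<open>E\<close> is an invariant set, then approximating \<open>1\<^sub>E\<close> in
  \<open>L\<^sup>2(\<mu>)\<close> by trigonometric polynomials gives a fixed vector \<open>y = 1\<^sub>E x\<close>, and \<open>x - y\<close> is orthogonal to the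
  cyclic subspace of \<open>y\<close>. Conversely, the projection of \<open>x\<close> to an invariant closed subspace splits \<open>\<mu>\<close>
  into a sum of two invariant measures, and an invariant measure dominated by an ergodic one is a
  multiple of it. The condition \<open>U(z\<^sup>k) x \<noteq> x\<close> excludes exactly the measures on roots of unity,
  that is, the finitely supported ones.

  Lebesgue measure always gives a representation as in (b), whose fixed vectors form a line because
  the orbits of the nonzero \<open>k\<close> under multiplication by powers of \<open>p\<close> are infinite. So (b) says that
  every other ergodic invariant measure is finitely supported.
\<close>

section \<open>Hilbert spaces\<close>

text \<open>On \<open>L^2\<close> of an invariant measure, composition with z^p is an isometry but
  need not be invertible, whereas a representation of the group needs unitary maps. The invertible
  extension would live on the solenoid dual to \<open>\<int>[1/(pq)]\<close>. The proof stays on the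
  circle instead: the element (N, N) of \<open>\<int>^2\<close> multiplies exponents by (pq)^N, so
  every matrix coefficient between fixed vectors equals one at an integer. Accordingly the
  representation space is not an \<open>L^2\<close> space but the completion of a kernel on the
  index set, made of functions on that set; such functions embed into every type with at least
  continuum many elements. All unitary maps, the action of the group as well as the equivalences,
  come from one principle: two total families with the same Gram matrix are matched by a unitary
  map. A vector like \<open>1\<^sub>E x\<close> exists only as a limit of trigonometric polynomials
  applied to \<open>x\<close>, so its properties are all read off from inner products.\<close>

lemma complex_ring_simps [simp]:
  "carrier complex_ring = UNIV" "mult complex_ring = (*)" "one complex_ring = 1"
  "zero complex_ring = 0" "add complex_ring = (+)"
  by (simp_all add: complex_ring_def)

context pre_hilbert_space
begin

lemma smult_one_left [simp]: "x \<in> carrier V \<Longrightarrow> 1 \<odot> x = x"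
  using smult_one by simp

lemma smult_zero_left [simp]: "x \<in> carrier V \<Longrightarrow> 0 \<odot> x = \<zero>"
  using smult_l_null by simp

lemma smult_zero_right [simp]: "c \<odot> \<zero> = \<zero>"
  using smult_r_null by simp

lemma smult_smult: "x \<in> carrier V \<Longrightarrow> c \<odot> (d \<odot> x) = (c * d) \<odot> x"
  using smult_assoc1 by simp

lemma smult_add: "\<lbrakk>x \<in> carrier V; y \<in> carrier V\<rbrakk> \<Longrightarrow> c \<odot> (x \<oplus> y) = c \<odot> x \<oplus> c \<odot> y"
  using smult_r_distr by simp

declare smult_in [simp, intro]

lemma diff_in [simp, intro]: "\<lbrakk>x \<in> carrier V; y \<in> carrier V\<rbrakk> \<Longrightarrow> x \<ominus> y \<in> carrier V"
  by (simp add: minus_eq)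

lemma diff_smult: "\<lbrakk>x \<in> carrier V; y \<in> carrier V\<rbrakk> \<Longrightarrow> x \<ominus> y = x \<oplus> (-1) \<odot> y"
  by (simp add: minus_eq uminus_smult)

lemma cinner_zero_right: "x \<in> carrier V \<Longrightarrow> cinner V x \<zero> = 0"
  using cinner_commute[of "\<zero>" x] cinner_zero_left[of x] by simp

lemma cinner_diff_left: "\<lbrakk>x \<in> carrier V; y \<in> carrier V; z \<in> carrier V\<rbrakk> \<Longrightarrow>
    cinner V (x \<ominus> y) z = cinner V x z - cinner V y z"
  by (simp add: diff_smult cinner_add_left cinner_smult_left)

lemma cinner_diff_right: "\<lbrakk>x \<in> carrier V; y \<in> carrier V; z \<in> carrier V\<rbrakk> \<Longrightarrow>
    cinner V z (x \<ominus> y) = cinner V z x - cinner V z y"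
  by (simp add: diff_smult cinner_add_right cinner_smult_right)

lemmas cinner_linear = cinner_add_left cinner_add_right cinner_diff_left cinner_diff_right
  cinner_smult_left cinner_smult_right cinner_zero_left cinner_zero_right

lemma diff_eq_zero_iff: "\<lbrakk>x \<in> carrier V; y \<in> carrier V\<rbrakk> \<Longrightarrow> x \<ominus> y = \<zero> \<longleftrightarrow> x = y"
  by (metis M.minus_equality M.minus_minus M.a_inv_closed M.r_neg minus_eq)

lemma diff_self [simp]: "x \<in> carrier V \<Longrightarrow> x \<ominus> x = \<zero>"
  by (simp add: diff_eq_zero_iff)

lemma cinner_self_eq_zero: "x \<in> carrier V \<Longrightarrow> cinner V x x = 0 \<longleftrightarrow> x = \<zero>"
  using cinner_pos[of x] cinner_zero_left[of x] by force

lemma hnorm_nonneg [simp]: "x \<in> carrier V \<Longrightarrow> 0 \<le> hnorm V x"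
  by (simp add: hnorm_def cinner_nonneg)

lemma hnorm_sq: "x \<in> carrier V \<Longrightarrow> (hnorm V x)\<^sup>2 = Re (cinner V x x)"
  by (simp add: hnorm_def cinner_nonneg)

lemma cinner_self_hnorm: "x \<in> carrier V \<Longrightarrow> cinner V x x = of_real ((hnorm V x)\<^sup>2)"
  using cinner_self by (simp add: hnorm_sq)

lemma hnorm_eq_zero: "x \<in> carrier V \<Longrightarrow> hnorm V x = 0 \<longleftrightarrow> x = \<zero>"
  using cinner_self_eq_zero cinner_self_hnorm by (metis of_real_eq_0_iff power_eq_0_iff zero_neq_numeral zero_less_numeral)

lemma hnorm_zero [simp]: "hnorm V \<zero> = 0"
  by (simp add: hnorm_eq_zero)

lemma hnorm_smult: "x \<in> carrier V \<Longrightarrow> hnorm V (c \<odot> x) = cmod c * hnorm V x"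
proof -
  assume x: "x \<in> carrier V"
  have "cinner V (c \<odot> x) (c \<odot> x) = (c * cnj c) * cinner V x x"
    using x by (simp add: cinner_linear)
  also have "\<dots> = of_real ((cmod c * hnorm V x)\<^sup>2)"
    unfolding cinner_self_hnorm[OF x] complex_norm_square[symmetric] by (simp add: power_mult_distrib)
  finally have "(hnorm V (c \<odot> x))\<^sup>2 = (cmod c * hnorm V x)\<^sup>2"
    using x by (simp add: hnorm_sq)
  then show ?thesis using x by (simp add: power2_eq_iff_nonneg)
qed

lemma hnorm_diff_commute: "\<lbrakk>x \<in> carrier V; y \<in> carrier V\<rbrakk> \<Longrightarrow> hnorm V (x \<ominus> y) = hnorm V (y \<ominus> x)"
  by (simp add: hnorm_def cinner_linear)

lemma hnorm_diff_triangle: "\<lbrakk>x \<in> carrier V; y \<in> carrier V; z \<in> carrier V\<rbrakk> \<Longrightarrow>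
    hnorm V (x \<ominus> z) \<le> hnorm V (x \<ominus> y) + hnorm V (y \<ominus> z)"
  using V_minus_add[of x y z] hnorm_triangle[of "x \<ominus> y" "y \<ominus> z"] by simp

lemma Cauchy_Schwarz:
  assumes x: "x \<in> carrier V" and y: "y \<in> carrier V"
  shows "cmod (cinner V x y) \<le> hnorm V x * hnorm V y"
proof (cases "y = \<zero>")
  case True
  then show ?thesis using x by (simp add: cinner_zero_right)
next
  case False
  define c where "c = cinner V x y"
  define b where "b = (hnorm V y)\<^sup>2"
  have b: "b > 0" using False y hnorm_eq_zero by (simp add: b_def)
  have cc: "cinner V y x = cnj c" using cinner_commute[OF x y] by (simp add: c_def)
  \<comment> \<open>With this coefficient \<open>d \<odot> y\<close> is the orthogonal projection of
    \<open>x\<close> to the line of \<open>y\<close>.\<close>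
  define d where "d = c / of_real b"
  have nn: "0 \<le> Re (cinner V (x \<ominus> d \<odot> y) (x \<ominus> d \<odot> y))"
    using x y by (intro cinner_nonneg) auto
  have "cinner V (x \<ominus> d \<odot> y) (x \<ominus> d \<odot> y) =
     cinner V x x - cnj d * c - d * cnj c + d * cnj d * of_real b"
    using x y cc by (simp add: cinner_linear c_def[symmetric] cinner_self_hnorm[OF y] b_def[symmetric] algebra_simps)
  also have "\<dots> = cinner V x x - c * cnj c / of_real b"
    using b by (simp add: d_def)
  also have "\<dots> = of_real ((hnorm V x)\<^sup>2 - (cmod c)\<^sup>2 / b)"
    unfolding cinner_self_hnorm[OF x] complex_norm_square[symmetric] by simp
  finally have "0 \<le> (hnorm V x)\<^sup>2 - (cmod c)\<^sup>2 / b"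
    using nn by simp
  then have "(cmod c)\<^sup>2 \<le> (hnorm V x * hnorm V y)\<^sup>2"
    using b by (simp add: field_simps b_def)
  then show ?thesis using x y by (simp add: c_def power2_le_iff_abs_le abs_le_square_iff)
qed

section \<open>Convergent and Cauchy sequences, closed subspaces\<close>

definition hconv :: "(nat \<Rightarrow> 'h) \<Rightarrow> 'h \<Rightarrow> bool" where
  "hconv s x \<longleftrightarrow> (\<forall>n. s n \<in> carrier V) \<and> x \<in> carrier V \<and> (\<lambda>n. hnorm V (s n \<ominus> x)) \<longlonglongrightarrow> 0"

definition hcauchy :: "(nat \<Rightarrow> 'h) \<Rightarrow> bool" where
  "hcauchy s \<longleftrightarrow> (\<forall>n. s n \<in> carrier V) \<and>
     (\<forall>e>0. \<exists>N. \<forall>m\<ge>N. \<forall>n\<ge>N. hnorm V (s m \<ominus> s n) < e)"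

lemma hconv_in: "hconv s x \<Longrightarrow> s n \<in> carrier V" "hconv s x \<Longrightarrow> x \<in> carrier V"
  by (auto simp: hconv_def)

lemma hconv_const: "x \<in> carrier V \<Longrightarrow> hconv (\<lambda>_. x) x"
  by (simp add: hconv_def)

text \<open>Expanding around the limits \<open>x\<close> and \<open>y\<close> leaves only products
  with a factor that tends to zero and norms that do not vary with the sequence, so continuity of
  the inner product needs no bound on the sequences.\<close>

lemma cinner_diff_bound:
  assumes "x \<in> carrier V" "y \<in> carrier V" "x' \<in> carrier V" "y' \<in> carrier V"
  shows "cmod (cinner V x' y' - cinner V x y) \<le>
    hnorm V (x' \<ominus> x) * hnorm V (y' \<ominus> y) + hnorm V (x' \<ominus> x) * hnorm V y + hnorm V x * hnorm V (y' \<ominus> y)"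
proof -
  have eq: "cinner V x' y' - cinner V x y = cinner V (x' \<ominus> x) (y' \<ominus> y) + cinner V (x' \<ominus> x) y + cinner V x (y' \<ominus> y)"
    using assms by (simp add: cinner_linear)
  have "cmod (cinner V x' y' - cinner V x y) \<le>
    cmod (cinner V (x' \<ominus> x) (y' \<ominus> y)) + cmod (cinner V (x' \<ominus> x) y) + cmod (cinner V x (y' \<ominus> y))"
    unfolding eq by (meson add_right_mono norm_triangle_ineq order_trans)
  also have "\<dots> \<le> hnorm V (x' \<ominus> x) * hnorm V (y' \<ominus> y) + hnorm V (x' \<ominus> x) * hnorm V y + hnorm V x * hnorm V (y' \<ominus> y)"
    using assms by (intro add_mono Cauchy_Schwarz) auto
  finally show ?thesis .
qed

lemma hconv_cinner:
  assumes "hconv s x" "hconv t y"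
  shows "(\<lambda>n. cinner V (s n) (t n)) \<longlonglongrightarrow> cinner V x y"
proof -
  note c = hconv_in[OF assms(1)] hconv_in[OF assms(2)]
  have "(\<lambda>n. hnorm V (s n \<ominus> x) * hnorm V (t n \<ominus> y) + hnorm V (s n \<ominus> x) * hnorm V y + hnorm V x * hnorm V (t n \<ominus> y)) \<longlonglongrightarrow> 0 * 0 + 0 * hnorm V y + hnorm V x * 0"
    using assms by (intro tendsto_intros) (auto simp: hconv_def)
  then have lim: "(\<lambda>n. hnorm V (s n \<ominus> x) * hnorm V (t n \<ominus> y) + hnorm V (s n \<ominus> x) * hnorm V y + hnorm V x * hnorm V (t n \<ominus> y)) \<longlonglongrightarrow> 0"
    by simp
  have "(\<lambda>n. cinner V (s n) (t n) - cinner V x y) \<longlonglongrightarrow> 0"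
    by (rule Lim_null_comparison[OF always_eventually lim]) (intro allI cinner_diff_bound c)
  then show ?thesis by (simp add: LIM_zero_iff)
qed

text \<open>Links norm convergence to the metric topology in which closedness and completeness are
  defined. \<open>limitin\<close> puts the terms into the carrier only eventually, hence the
  separate range condition.\<close>

lemma hconv_iff_hdist:
  "hconv s x \<longleftrightarrow> range s \<subseteq> carrier V \<and> limitin (Metric_space.mtopology (carrier V) (hdist V)) s x sequentially"
proof -
  interpret Metric_space "carrier V" "hdist V" by (rule Metric_space_hdist)
  have eq: "(\<lambda>n. hdist V (s n) x) = (\<lambda>n. hnorm V (s n \<ominus> x))" if "\<forall>n. s n \<in> carrier V" "x \<in> carrier V"
    by (rule ext) (use that in \<open>simp add: hdist_def\<close>)
  show ?thesis
  proof
    assume h: "hconv s x"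
    then have "(\<lambda>n. hdist V (s n) x) \<longlonglongrightarrow> 0"
      by (subst eq) (simp_all add: hconv_def)
    then show "range s \<subseteq> carrier V \<and> limitin mtopology s x sequentially"
      using h unfolding limitin_metric_dist_null hconv_def by (simp add: image_subset_iff)
  next
    assume R: "range s \<subseteq> carrier V \<and> limitin mtopology s x sequentially"
    then have c: "\<forall>n. s n \<in> carrier V" "x \<in> carrier V"
      unfolding limitin_metric_dist_null by (simp_all add: image_subset_iff)
    moreover have "(\<lambda>n. hdist V (s n) x) \<longlonglongrightarrow> 0"
      using R unfolding limitin_metric_dist_null by blast
    ultimately show "hconv s x" unfolding hconv_def eq[OF c] by blast
  qed
qed

lemma closed_subspace_iff:
  "closed_subspace V W \<longleftrightarrow> W \<subseteq> carrier V \<and> \<zero> \<in> W \<and> (\<forall>x\<in>W. \<forall>y\<in>W. x \<oplus> y \<in> W) \<and>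
     (\<forall>c. \<forall>x\<in>W. c \<odot> x \<in> W) \<and> (\<forall>s x. (\<forall>n. s n \<in> W) \<and> hconv s x \<longrightarrow> x \<in> W)"
  (is "_ \<longleftrightarrow> ?A \<and> ?R")
proof -
  interpret Metric_space "carrier V" "hdist V" by (rule Metric_space_hdist)
  have 1: "closedin mtopology W \<longleftrightarrow> W \<subseteq> carrier V \<and> (\<forall>s x. (\<forall>n. s n \<in> W) \<and> hconv s x \<longrightarrow> x \<in> W)"
  proof
    assume L: "closedin mtopology W"
    then have "W \<subseteq> carrier V" by (simp add: metric_closedin_iff_sequentially_closed)
    moreover have "x \<in> W" if "\<forall>n. s n \<in> W" "hconv s x" for s x
      using L that unfolding metric_closedin_iff_sequentially_closed hconv_iff_hdist by blast
    ultimately show "W \<subseteq> carrier V \<and> (\<forall>s x. (\<forall>n. s n \<in> W) \<and> hconv s x \<longrightarrow> x \<in> W)" by blast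
  next
    assume R: "W \<subseteq> carrier V \<and> (\<forall>s x. (\<forall>n. s n \<in> W) \<and> hconv s x \<longrightarrow> x \<in> W)"
    have "x \<in> W" if "range s \<subseteq> W" "limitin mtopology s x sequentially" for s x
    proof -
      have "hconv s x" using R that unfolding hconv_iff_hdist by blast
      then show ?thesis using R that by blast
    qed
    then show "closedin mtopology W"
      using R unfolding metric_closedin_iff_sequentially_closed by blast
  qed
  have 2: "submodule W complex_ring V \<longleftrightarrow> W \<subseteq> carrier V \<and> \<zero> \<in> W \<and> (\<forall>x\<in>W. \<forall>y\<in>W. x \<oplus> y \<in> W) \<and>
     (\<forall>c. \<forall>x\<in>W. c \<odot> x \<in> W)"
  proof (intro iffI conjI)
    assume s: "submodule W complex_ring V"
    then interpret submodule W complex_ring V .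
    show "W \<subseteq> carrier V" "\<zero> \<in> W" "\<forall>x\<in>W. \<forall>y\<in>W. x \<oplus> y \<in> W" "\<forall>c. \<forall>x\<in>W. c \<odot> x \<in> W"
      using subset m_closed one_closed smult_closed by simp_all
  next
    assume "W \<subseteq> carrier V \<and> \<zero> \<in> W \<and> (\<forall>x\<in>W. \<forall>y\<in>W. x \<oplus> y \<in> W) \<and> (\<forall>c. \<forall>x\<in>W. c \<odot> x \<in> W)"
    then have *: "W \<subseteq> carrier V" "\<zero> \<in> W" "\<And>x y. x \<in> W \<Longrightarrow> y \<in> W \<Longrightarrow> x \<oplus> y \<in> W" "\<And>c x. x \<in> W \<Longrightarrow> c \<odot> x \<in> W"
      by blast+
    show "submodule W complex_ring V"
    proof (rule submoduleI)
      show "\<ominus> a \<in> W" if "a \<in> W" for a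
        using *(4)[OF that, of "-1"] *(1) that by (simp add: uminus_smult subsetD)
    qed (use * in blast)+
  qed
  show ?thesis unfolding closed_subspace_def 1 2
    by (rule iffI; elim conjE; intro conjI; assumption)
qed


text \<open>Stated as a trivial orthogonal complement instead of a dense span, so that it can be
  checked with inner products alone. In a Hilbert space \<open>total_dense\<close> recovers
  density.\<close>

definition total :: "('i \<Rightarrow> 'h) \<Rightarrow> bool" where
  "total u \<longleftrightarrow> (\<forall>i. u i \<in> carrier V) \<and> (\<forall>v\<in>carrier V. (\<forall>i. cinner V v (u i) = 0) \<longrightarrow> v = \<zero>)"

definition lincomb :: "('i \<Rightarrow> 'h) \<Rightarrow> (complex \<times> 'i) list \<Rightarrow> 'h" where
  "lincomb u xs = foldr (\<lambda>(c, i) v. c \<odot> u i \<oplus> v) xs \<zero>"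

end

text \<open>Finite linear combinations are lists of pairs of a coefficient and an index, so that addition is
  concatenation and no support has to be tracked.\<close>

definition lscale :: "complex \<Rightarrow> (complex \<times> 'i) list \<Rightarrow> (complex \<times> 'i) list" where
  "lscale c xs = map (\<lambda>(d, i). (c * d, i)) xs"

definition ldiff :: "(complex \<times> 'i) list \<Rightarrow> (complex \<times> 'i) list \<Rightarrow> (complex \<times> 'i) list" where
  "ldiff xs ys = xs @ lscale (-1) ys"

text \<open>The sesquilinear form with matrix \<open>K\<close>. It serves for inner products of
  linear combinations, for the form of a kernel, and for integrals of products of trigonometric
  polynomials.\<close>

definition gram :: "('i \<Rightarrow> 'j \<Rightarrow> complex) \<Rightarrow> (complex \<times> 'i) list \<Rightarrow> (complex \<times> 'j) list \<Rightarrow> complex" where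
  "gram K xs ys = (\<Sum>(c, i)\<leftarrow>xs. \<Sum>(d, j)\<leftarrow>ys. c * cnj d * K i j)"

lemma lscale_simps [simp]: "lscale c [] = []" "lscale c ((d, i) # xs) = (c * d, i) # lscale c xs"
  by (simp_all add: lscale_def)

context pre_hilbert_space
begin

lemma lincomb_simps [simp]: "lincomb u [] = \<zero>" "lincomb u ((c, i) # xs) = c \<odot> u i \<oplus> lincomb u xs"
  by (simp_all add: lincomb_def)

lemma lincomb_in [simp, intro]: "(\<And>i. u i \<in> carrier V) \<Longrightarrow> lincomb u xs \<in> carrier V"
  by (induction xs) auto

lemma lincomb_append: "(\<And>i. u i \<in> carrier V) \<Longrightarrow> lincomb u (xs @ ys) = lincomb u xs \<oplus> lincomb u ys"
  by (induction xs) (auto simp: M.a_assoc)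

lemma lincomb_lscale: "(\<And>i. u i \<in> carrier V) \<Longrightarrow> lincomb u (lscale c xs) = c \<odot> lincomb u xs"
  by (induction xs) (auto simp: smult_add smult_smult)

lemma lincomb_ldiff: "(\<And>i. u i \<in> carrier V) \<Longrightarrow> lincomb u (ldiff xs ys) = lincomb u xs \<ominus> lincomb u ys"
  by (simp add: ldiff_def lincomb_append lincomb_lscale diff_smult)

lemma cinner_lincomb_left:
  assumes "\<And>i. u i \<in> carrier V" "v \<in> carrier V"
  shows "cinner V (lincomb u xs) v = (\<Sum>(c, i)\<leftarrow>xs. c * cinner V (u i) v)"
  using assms by (induction xs) (auto simp: cinner_linear)

lemma cinner_lincomb_right:
  assumes "\<And>i. u i \<in> carrier V" "v \<in> carrier V"
  shows "cinner V v (lincomb u xs) = (\<Sum>(c, i)\<leftarrow>xs. cnj c * cinner V v (u i))"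
  using assms by (induction xs) (auto simp: cinner_linear)

lemma cinner_lincomb:
  assumes "\<And>i. u i \<in> carrier V" "\<And>j. w j \<in> carrier V"
  shows "cinner V (lincomb u xs) (lincomb w ys) = gram (\<lambda>i j. cinner V (u i) (w j)) xs ys"
proof -
  have "cinner V (lincomb u xs) (lincomb w ys) = (\<Sum>(c, i)\<leftarrow>xs. c * (\<Sum>(d, j)\<leftarrow>ys. cnj d * cinner V (u i) (w j)))"
    using assms by (subst cinner_lincomb_left) (auto simp: cinner_lincomb_right)
  then show ?thesis
    by (simp add: gram_def split_def mult.assoc flip: sum_list_const_mult)
qed

end

section \<open>Orthogonal projection and density of total families\<close>

context hilbert_space
begin

lemma hcauchy_convergent:
  assumes "hcauchy s"
  obtains x where "hconv s x"
proof -
  interpret Metric_space "carrier V" "hdist V" by (rule Metric_space_hdist)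
  have "MCauchy s"
    using assms unfolding MCauchy_def hcauchy_def by (force simp: hdist_def)
  then obtain x where "limitin mtopology s x sequentially"
    using complete unfolding mcomplete_def by blast
  with \<open>MCauchy s\<close> have "hconv s x" unfolding hconv_iff_hdist by (auto simp: MCauchy_def)
  then show ?thesis by (rule that)
qed

text \<open>A sequence in \<open>W\<close> that minimizes the distance to \<open>x\<close> is Cauchy
  by the parallelogram law, and minimality of its limit under small moves along \<open>w\<close>
  forces orthogonality.\<close>

lemma projection_exists:
  assumes W: "closed_subspace V W" and x: "x \<in> carrier V"
  obtains y where "y \<in> W" "\<And>w. w \<in> W \<Longrightarrow> cinner V (x \<ominus> y) w = 0"
proof -
  have WV: "\<And>w. w \<in> W \<Longrightarrow> w \<in> carrier V" and W0: "\<zero> \<in> W"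
    and Wadd: "\<And>v w. v \<in> W \<Longrightarrow> w \<in> W \<Longrightarrow> v \<oplus> w \<in> W"
    and Wsm: "\<And>c w. w \<in> W \<Longrightarrow> c \<odot> w \<in> W"
    and Wlim: "\<And>s x. (\<And>n. s n \<in> W) \<Longrightarrow> hconv s x \<Longrightarrow> x \<in> W"
    using W unfolding closed_subspace_iff by blast+
  define q where "q w = (hnorm V (x \<ominus> w))\<^sup>2" for w
  define d where "d = Inf (q ` W)"
  have bdd: "bdd_below (q ` W)" by (auto simp: q_def intro!: bdd_belowI[of _ 0])
  have d_le: "d \<le> q w" if "w \<in> W" for w
    unfolding d_def using bdd that by (intro cInf_lower) auto
  have "\<exists>w\<in>W. q w < d + e" if "e > 0" for e
    using cInf_lessD[of "q ` W" "d + e"] W0 that by (auto simp: d_def)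
  then have "\<forall>n. \<exists>w\<in>W. q w < d + inverse (real (Suc n))" by simp
  then obtain s where s: "\<And>n. s n \<in> W" "\<And>n. q (s n) < d + inverse (real (Suc n))" by metis
  \<comment> \<open>Parallelogram law for the differences of \<open>x\<close> with \<open>v\<close>
    and with \<open>w\<close>; half their sum is the difference with the midpoint. The midpoint of
    two points of \<open>W\<close> lies in \<open>W\<close>, so its \<open>q\<close> is at least
    \<open>d\<close>.\<close>
  have par: "(hnorm V (v \<ominus> w))\<^sup>2 = 2 * q v + 2 * q w - 4 * q ((1/2) \<odot> (v \<oplus> w))"
    if "v \<in> carrier V" "w \<in> carrier V" for v w
  proof -
    have re: "Re (cinner V v x) = Re (cinner V x v)" "Re (cinner V w x) = Re (cinner V x w)"
      "Re (cinner V w v) = Re (cinner V v w)"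
      using cinner_commute[OF x that(1)] cinner_commute[OF x that(2)] cinner_commute[OF that] by simp_all
    show ?thesis using that x
      by (simp add: q_def hnorm_sq cinner_linear re algebra_simps)
  qed
  have "hcauchy s"
    unfolding hcauchy_def
  proof (intro conjI allI impI)
    show "s n \<in> carrier V" for n using s WV by blast
    fix e :: real assume "e > 0"
    \<comment> \<open>In the parallelogram identity two values of \<open>q\<close> enter with factor
      2 each, which turns the error into four times this bound.\<close>
    then obtain N where N: "inverse (real (Suc N)) < e\<^sup>2 / 4"
      using reals_Archimedean[of "e\<^sup>2 / 4"] by auto
    show "\<exists>N. \<forall>m\<ge>N. \<forall>n\<ge>N. hnorm V (s m \<ominus> s n) < e"
    proof (intro exI allI impI)
      fix m n assume mn: "N \<le> m" "N \<le> n"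
      have sm: "inverse (real (Suc m)) \<le> inverse (real (Suc N))" "inverse (real (Suc n)) \<le> inverse (real (Suc N))"
        using mn by (auto intro!: le_imp_inverse_le)
      have "(hnorm V (s m \<ominus> s n))\<^sup>2 = 2 * q (s m) + 2 * q (s n) - 4 * q ((1/2) \<odot> (s m \<oplus> s n))"
        by (intro par WV s(1))
      also have "\<dots> \<le> 2 * q (s m) + 2 * q (s n) - 4 * d"
        using d_le[OF Wsm[OF Wadd[OF s(1)[of m] s(1)[of n]], of "1/2"]] by linarith
      also have "\<dots> < e\<^sup>2"
        using s(2)[of m] s(2)[of n] sm N by linarith
      finally show "hnorm V (s m \<ominus> s n) < e"
        using \<open>e > 0\<close> by (rule_tac power2_less_imp_less) auto
    qed
  qed
  then obtain y where y: "hconv s y" by (rule hcauchy_convergent)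
  have yW: "y \<in> W" using Wlim[OF s(1) y] .
  have yV: "y \<in> carrier V" using yW WV by blast
  have "hconv (\<lambda>n. x \<ominus> s n) (x \<ominus> y)"
  proof -
    have "hnorm V ((x \<ominus> s n) \<ominus> (x \<ominus> y)) = hnorm V (s n \<ominus> y)" for n
      using x yV WV[OF s(1)] by (simp add: hnorm_def cinner_linear algebra_simps)
    then show ?thesis using y x yV WV[OF s(1)] by (simp add: hconv_def)
  qed
  from hconv_cinner[OF this this]
  have "(\<lambda>n. q (s n)) \<longlonglongrightarrow> q y"
    unfolding q_def using x yV WV[OF s(1)] by (simp only: hnorm_sq diff_in tendsto_Re)
  moreover have "(\<lambda>n. d + inverse (real (Suc n))) \<longlonglongrightarrow> d + 0"
    by (intro tendsto_intros LIMSEQ_inverse_real_of_nat)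
  ultimately have "q y \<le> d + 0"
    by (rule LIMSEQ_le) (intro exI[of _ 0] allI impI less_imp_le s(2))
  then have qy: "q y \<le> d" by simp
  show ?thesis
  proof (rule that[OF yW])
    fix w assume w: "w \<in> W"
    have wV: "w \<in> carrier V" using w WV by blast
    define z where "z = x \<ominus> y"
    have zV: "z \<in> carrier V" using x yV by (simp add: z_def)
    define a where "a = cinner V z w"
    define b where "b = (hnorm V w)\<^sup>2"
    \<comment> \<open>The best step along \<open>w\<close> would be 1 / b. The added 1 covers
      \<open>w = \<zero>\<close> and still makes 2 t - t^2 b positive.\<close>
    define t where "t = 1 / (b + 1)"
    have b0: "b \<ge> 0" by (simp add: b_def)
    define c where "c = of_real t * a"
    have "y \<oplus> c \<odot> w \<in> W" using yW w by (intro Wadd Wsm)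
    from order_trans[OF qy d_le[OF this]] have "q y \<le> q (y \<oplus> c \<odot> w)" .
    also have "\<dots> = Re (cinner V (z \<ominus> c \<odot> w) (z \<ominus> c \<odot> w))"
    proof -
      have "x \<ominus> (y \<oplus> c \<odot> w) = z \<ominus> c \<odot> w"
        using x yV wV by (simp add: z_def diff_smult smult_add M.a_assoc)
      then show ?thesis using zV wV by (simp add: q_def hnorm_sq)
    qed
    also have "cinner V (z \<ominus> c \<odot> w) (z \<ominus> c \<odot> w) = cinner V z z - cnj c * a - c * cnj a + c * cnj c * of_real b"
      using zV wV cinner_commute[OF zV wV]
        cinner_self_hnorm[OF wV]
      by (simp add: cinner_linear a_def b_def algebra_simps)
    also have "\<dots> = cinner V z z - of_real (2 * t - t\<^sup>2 * b) * (a * cnj a)"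
      by (simp add: c_def algebra_simps power2_eq_square)
    also have "\<dots> = of_real (q y - (2 * t - t\<^sup>2 * b) * (cmod a)\<^sup>2)"
      unfolding cinner_self_hnorm[OF zV] complex_norm_square[symmetric] by (simp add: q_def z_def)
    finally have "(2 * t - t\<^sup>2 * b) * (cmod a)\<^sup>2 \<le> 0" by simp
    moreover have "2 * t - t\<^sup>2 * b > 0"
    proof -
      have "t > 0" "t * b < 1" using b0 by (auto simp: t_def field_simps)
      then have "t * (t * b) < t * 2" by (intro mult_strict_left_mono) auto
      then show ?thesis by (simp add: power2_eq_square algebra_simps)
    qed
    ultimately have "(cmod a)\<^sup>2 \<le> 0" by (simp add: mult_le_0_iff)
    then show "cinner V (x \<ominus> y) w = 0" by (simp add: a_def z_def)
  qed
qed

text \<open>The vectors approximable by linear combinations form a closed subspace. What remains of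
  \<open>v\<close> after projection to it is orthogonal to every \<open>u i\<close>, hence
  zero.\<close>

lemma total_dense:
  assumes u: "total u" and v: "v \<in> carrier V"
  obtains xs where "hconv (\<lambda>n::nat. lincomb u (xs n)) v"
proof -
  have uV: "\<And>i. u i \<in> carrier V" using u by (auto simp: total_def)
  define W where "W = {v \<in> carrier V. \<forall>e>0. \<exists>xs. hnorm V (v \<ominus> lincomb u xs) < e}"
  have lcW: "lincomb u xs \<in> W" for xs
    using uV by (auto simp: W_def intro!: exI[of _ xs])
  have "closed_subspace V W"
    unfolding closed_subspace_iff
  proof (intro conjI allI ballI impI)
    show "W \<subseteq> carrier V" by (auto simp: W_def)
    show "\<zero> \<in> W" using lcW[of "[]"] by simp
  next
    fix x y assume x: "x \<in> W" and y: "y \<in> W"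
    have xy: "x \<in> carrier V" "y \<in> carrier V" using x y by (auto simp: W_def)
    have "\<exists>xs. hnorm V ((x \<oplus> y) \<ominus> lincomb u xs) < e" if "e > 0" for e
    proof -
      from that x obtain xs where xs: "hnorm V (x \<ominus> lincomb u xs) < e / 2"
        by (auto simp: W_def dest!: spec[of _ "e/2"])
      from that y obtain ys where ys: "hnorm V (y \<ominus> lincomb u ys) < e / 2"
        by (auto simp: W_def dest!: spec[of _ "e/2"])
      have "hnorm V ((x \<oplus> y) \<ominus> lincomb u (xs @ ys)) = hnorm V ((x \<ominus> lincomb u xs) \<oplus> (y \<ominus> lincomb u ys))"
        using xy lincomb_in[of u] uV by (simp add: lincomb_append hnorm_def cinner_linear algebra_simps)
      also have "\<dots> \<le> hnorm V (x \<ominus> lincomb u xs) + hnorm V (y \<ominus> lincomb u ys)"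
        using xy lincomb_in[of u] uV by (intro hnorm_triangle) auto
      also have "\<dots> < e" using xs ys by simp
      finally show ?thesis by blast
    qed
    then show "x \<oplus> y \<in> W" using xy by (auto simp: W_def)
  next
    fix c x assume x: "x \<in> W"
    have xV: "x \<in> carrier V" using x by (auto simp: W_def)
    have "\<exists>xs. hnorm V (c \<odot> x \<ominus> lincomb u xs) < e" if "e > 0" for e
    proof -
      have "e / (cmod c + 1) > 0" using that by (auto intro!: divide_pos_pos add_nonneg_pos)
      with x obtain xs where xs: "hnorm V (x \<ominus> lincomb u xs) < e / (cmod c + 1)"
        by (auto simp: W_def)
      have "c \<odot> x \<ominus> lincomb u (lscale c xs) = c \<odot> (x \<ominus> lincomb u xs)"
        using xV lincomb_in[of u] uV by (simp add: lincomb_lscale diff_smult smult_add smult_smult)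
      then have "hnorm V (c \<odot> x \<ominus> lincomb u (lscale c xs)) = cmod c * hnorm V (x \<ominus> lincomb u xs)"
        using xV lincomb_in[of u] uV by (simp add: hnorm_smult)
      also have "\<dots> \<le> (cmod c + 1) * hnorm V (x \<ominus> lincomb u xs)"
        using xV lincomb_in[of u] uV by (intro mult_right_mono) auto
      also have "\<dots> < e"
        using xs by (simp add: pos_less_divide_eq add_nonneg_pos mult.commute)
      finally show ?thesis by blast
    qed
    then show "c \<odot> x \<in> W" using xV by (auto simp: W_def)
  next
    fix s x assume s: "(\<forall>n. s n \<in> W) \<and> hconv s x"
    then have xV: "x \<in> carrier V" and sV: "\<And>n. s n \<in> carrier V" by (auto simp: hconv_def)
    have "\<exists>xs. hnorm V (x \<ominus> lincomb u xs) < e" if "e > 0" for e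
    proof -
      have "(\<lambda>n. hnorm V (s n \<ominus> x)) \<longlonglongrightarrow> 0" using s by (simp add: hconv_def)
      then have "eventually (\<lambda>n. hnorm V (s n \<ominus> x) < e / 2) sequentially"
        using that by (intro order_tendstoD) auto
      then obtain n where n: "hnorm V (x \<ominus> s n) < e / 2"
        using xV sV by (auto simp: eventually_sequentially hnorm_diff_commute)
      have "s n \<in> W" using s by blast
      moreover have "e / 2 > 0" using that by simp
      ultimately obtain xs where xs: "hnorm V (s n \<ominus> lincomb u xs) < e / 2"
        unfolding W_def by blast
      have "hnorm V (x \<ominus> lincomb u xs) \<le> hnorm V (x \<ominus> s n) + hnorm V (s n \<ominus> lincomb u xs)"
        using xV sV lincomb_in[of u] uV by (intro hnorm_diff_triangle) auto
      then show ?thesis using n xs by (intro exI[of _ xs]) linarith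
    qed
    then show "x \<in> W" using xV by (auto simp: W_def)
  qed
  from projection_exists[OF this v] obtain y where y: "y \<in> W" "\<And>w. w \<in> W \<Longrightarrow> cinner V (v \<ominus> y) w = 0"
    by blast
  have "u i \<in> W" for i using lcW[of "[(1, i)]"] uV by simp
  then have "v \<ominus> y = \<zero>" using u v y by (auto simp: total_def W_def)
  then have "v = y" using y v by (auto simp: diff_eq_zero_iff W_def)
  then have "\<forall>n. \<exists>xs. hnorm V (v \<ominus> lincomb u xs) < inverse (real (Suc n))" using y by (simp add: W_def)
  then obtain xs where xs: "\<And>n. hnorm V (v \<ominus> lincomb u (xs n)) < inverse (real (Suc n))" by metis
  have lV: "lincomb u (xs n) \<in> carrier V" for n by (rule lincomb_in[OF uV])
  have "hconv (\<lambda>n. lincomb u (xs n)) v"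
    unfolding hconv_def
  proof (intro conjI allI lV v)
    show "(\<lambda>n. hnorm V (lincomb u (xs n) \<ominus> v)) \<longlonglongrightarrow> 0"
    proof (rule tendsto_sandwich[OF always_eventually always_eventually tendsto_const LIMSEQ_inverse_real_of_nat])
      show "\<forall>n. 0 \<le> hnorm V (lincomb u (xs n) \<ominus> v)"
        using lV v by (intro allI hnorm_nonneg diff_in)
      show "\<forall>n. hnorm V (lincomb u (xs n) \<ominus> v) \<le> inverse (real (Suc n))"
        using xs hnorm_diff_commute[OF lV v] by (metis less_imp_le)
    qed
  qed
  then show ?thesis by (rule that)
qed

end

section \<open>Unitary maps from equal Gram matrices\<close>

text \<open>The families may live in different spaces, for equivalence of representations, or in the
  same space, where a permutation of the indices that preserves the Gram matrix gives one operator
  of the action.\<close>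

locale two_hilbert = V: hilbert_space V + V': hilbert_space V'
  for V :: "('h, 'x) inner_space_scheme" and V' :: "('k, 'y) inner_space_scheme" +
  fixes u :: "'i \<Rightarrow> 'h" and u' :: "'i \<Rightarrow> 'k"
  assumes tot: "V.total u" and tot': "V'.total u'"
    and same_gram: "\<And>i j. cinner V (u i) (u j) = cinner V' (u' i) (u' j)"
begin

lemma uV [simp]: "u i \<in> carrier V" and uV' [simp]: "u' i \<in> carrier V'"
  using tot tot' by (auto simp: V.total_def V'.total_def)

lemma cinner_lincomb_same: "cinner V' (V'.lincomb u' xs) (V'.lincomb u' ys) = cinner V (V.lincomb u xs) (V.lincomb u ys)"
  by (simp add: V.cinner_lincomb V'.cinner_lincomb same_gram)

text \<open>Specifies the image of \<open>v\<close> by its inner products with the total family.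
  Linearity of the map then follows without limits; only existence and preservation of inner
  products use approximation.\<close>

definition match :: "'h \<Rightarrow> 'k \<Rightarrow> bool" where
  "match v v' \<longleftrightarrow> v \<in> carrier V \<and> v' \<in> carrier V' \<and> (\<forall>i. cinner V' v' (u' i) = cinner V v (u i))"

lemma match_unique: "match v v' \<Longrightarrow> match v v'' \<Longrightarrow> v' = v''"
proof -
  assume m: "match v v'" "match v v''"
  then have c: "v' \<in> carrier V'" "v'' \<in> carrier V'" by (auto simp: match_def)
  have "cinner V' (v' \<ominus>\<^bsub>V'\<^esub> v'') (u' i) = 0" for i
    using m by (simp add: match_def V'.cinner_diff_left)
  then have "v' \<ominus>\<^bsub>V'\<^esub> v'' = \<zero>\<^bsub>V'\<^esub>" using tot' c V'.diff_in unfolding V'.total_def by blast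
  then show ?thesis using c by (simp add: V'.diff_eq_zero_iff)
qed

text \<open>Equal Gram matrices make the combinations of \<open>u'\<close> with the coefficients
  \<open>xs n\<close> as Cauchy as those of \<open>u\<close>, and their limit matches. The
  coefficients stay in the conclusion because \<open>match_cinner\<close> needs both limits along
  the same lists.\<close>

lemma match_approx:
  assumes v: "v \<in> carrier V"
  obtains v' xs where "match v v'" "V.hconv (\<lambda>n. V.lincomb u (xs n)) v" "V'.hconv (\<lambda>n. V'.lincomb u' (xs n)) v'"
proof -
  obtain xs where xs: "V.hconv (\<lambda>n. V.lincomb u (xs n)) v" using V.total_dense[OF tot v] by blast
  have norm_eq: "hnorm V' (V'.lincomb u' (xs m) \<ominus>\<^bsub>V'\<^esub> V'.lincomb u' (xs n)) = hnorm V (V.lincomb u (xs m) \<ominus>\<^bsub>V\<^esub> V.lincomb u (xs n))" for m n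
    by (simp add: hnorm_def cinner_lincomb_same flip: V.lincomb_ldiff V'.lincomb_ldiff)
  have "V'.hcauchy (\<lambda>n. V'.lincomb u' (xs n))"
    unfolding V'.hcauchy_def
  proof (intro conjI allI impI)
    show "V'.lincomb u' (xs n) \<in> carrier V'" for n by (simp add: V'.lincomb_in)
    fix e :: real assume "e > 0"
    have "(\<lambda>n. hnorm V (V.lincomb u (xs n) \<ominus>\<^bsub>V\<^esub> v)) \<longlonglongrightarrow> 0" using xs by (simp add: V.hconv_def)
    then have "eventually (\<lambda>n. hnorm V (V.lincomb u (xs n) \<ominus>\<^bsub>V\<^esub> v) < e / 2) sequentially"
      using \<open>e > 0\<close> by (intro order_tendstoD) auto
    then obtain N where N: "\<And>n. n \<ge> N \<Longrightarrow> hnorm V (V.lincomb u (xs n) \<ominus>\<^bsub>V\<^esub> v) < e / 2"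
      by (auto simp: eventually_sequentially)
    show "\<exists>N. \<forall>m\<ge>N. \<forall>n\<ge>N. hnorm V' (V'.lincomb u' (xs m) \<ominus>\<^bsub>V'\<^esub> V'.lincomb u' (xs n)) < e"
    proof (intro exI allI impI)
      fix m n assume mn: "m \<ge> N" "n \<ge> N"
      have c: "V.lincomb u (xs m) \<in> carrier V" "V.lincomb u (xs n) \<in> carrier V" by (simp_all add: V.lincomb_in)
      have "hnorm V (V.lincomb u (xs m) \<ominus>\<^bsub>V\<^esub> V.lincomb u (xs n)) \<le>
        hnorm V (V.lincomb u (xs m) \<ominus>\<^bsub>V\<^esub> v) + hnorm V (v \<ominus>\<^bsub>V\<^esub> V.lincomb u (xs n))"
        using c v by (intro V.hnorm_diff_triangle)
      also have "hnorm V (v \<ominus>\<^bsub>V\<^esub> V.lincomb u (xs n)) = hnorm V (V.lincomb u (xs n) \<ominus>\<^bsub>V\<^esub> v)"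
        using c v by (intro V.hnorm_diff_commute)
      finally show "hnorm V' (V'.lincomb u' (xs m) \<ominus>\<^bsub>V'\<^esub> V'.lincomb u' (xs n)) < e"
        unfolding norm_eq using N[OF mn(1)] N[OF mn(2)] by linarith
    qed
  qed
  then obtain v' where v': "V'.hconv (\<lambda>n. V'.lincomb u' (xs n)) v'" by (rule V'.hcauchy_convergent)
  have "cinner V' v' (u' i) = cinner V v (u i)" for i
  proof (rule LIMSEQ_unique)
    show "(\<lambda>n. cinner V' (V'.lincomb u' (xs n)) (u' i)) \<longlonglongrightarrow> cinner V' v' (u' i)"
      by (intro V'.hconv_cinner[OF v'] V'.hconv_const uV')
    have "cinner V' (V'.lincomb u' (xs n)) (u' i) = cinner V (V.lincomb u (xs n)) (u i)" for n
      by (simp add: V.cinner_lincomb_left V'.cinner_lincomb_left same_gram)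
    then show "(\<lambda>n. cinner V' (V'.lincomb u' (xs n)) (u' i)) \<longlonglongrightarrow> cinner V v (u i)"
      using V.hconv_cinner[OF xs V.hconv_const[OF uV]] by simp
  qed
  then have "match v v'" using v V'.hconv_in(2)[OF v'] by (simp add: match_def)
  then show ?thesis using that xs v' by blast
qed

lemma match_cinner:
  assumes "match v v'" "match w w'"
  shows "cinner V' v' w' = cinner V v w"
proof -
  have c: "v \<in> carrier V" "w \<in> carrier V" using assms by (auto simp: match_def)
  obtain v'' xs where xs: "match v v''" "V.hconv (\<lambda>n. V.lincomb u (xs n)) v" "V'.hconv (\<lambda>n. V'.lincomb u' (xs n)) v''"
    using match_approx[OF c(1)] by blast
  obtain w'' ys where ys: "match w w''" "V.hconv (\<lambda>n. V.lincomb u (ys n)) w" "V'.hconv (\<lambda>n. V'.lincomb u' (ys n)) w''"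
    using match_approx[OF c(2)] by blast
  have "v'' = v'" "w'' = w'" using match_unique xs(1) ys(1) assms by blast+
  moreover have "cinner V' v'' w'' = cinner V v w"
    using V.hconv_cinner[OF xs(2) ys(2)] V'.hconv_cinner[OF xs(3) ys(3)]
    by (intro LIMSEQ_unique[of _ "cinner V' v'' w''"]) (simp_all add: cinner_lincomb_same)
  ultimately show ?thesis by simp
qed

end

lemma two_hilbert_sym: "two_hilbert V V' u u' \<Longrightarrow> two_hilbert V' V u' u"
  by (simp add: two_hilbert_def two_hilbert_axioms_def)

lemma (in two_hilbert) unitary_exists:
  obtains f where "unitary_map V V' f" "\<And>i. f (u i) = u' i"
    "\<And>v i. v \<in> carrier V \<Longrightarrow> cinner V' (f v) (u' i) = cinner V v (u i)"
proof -
  \<comment> \<open>Exchanging the two families reverses the matching relation: its uniqueness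
    becomes injectivity and its existence becomes surjectivity of \<open>f\<close>.\<close>
  interpret S: two_hilbert V' V u' u by (rule two_hilbert_sym) unfold_locales
  have S_match: "S.match v' v \<longleftrightarrow> match v v'" for v v'
    by (auto simp: match_def S.match_def)
  have "\<forall>v. \<exists>v'. v \<in> carrier V \<longrightarrow> match v v'" using match_approx by metis
  then obtain f where f: "\<And>v. v \<in> carrier V \<Longrightarrow> match v (f v)" by metis
  have fV: "f v \<in> carrier V'" if "v \<in> carrier V" for v using f[OF that] by (simp add: match_def)
  have f_eq: "f v = v'" if "match v v'" for v v'
    using match_unique f that by (meson match_def)
  have "bij_betw f (carrier V) (carrier V')"
  proof (rule bij_betwI')
    fix x y assume xy: "x \<in> carrier V" "y \<in> carrier V"
    show "(f x = f y) = (x = y)"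
      using S.match_unique[of "f x" x y] f[OF xy(1)] f[OF xy(2)] by (auto simp: S_match)
  next
    fix y assume "y \<in> carrier V'"
    then obtain x where "match x y" using S.match_approx[of y] by (auto simp: S_match)
    then show "\<exists>x\<in>carrier V. y = f x" using f_eq by (auto simp: match_def)
  qed (rule fV)
  moreover have "f (x \<oplus>\<^bsub>V\<^esub> y) = f x \<oplus>\<^bsub>V'\<^esub> f y" if "x \<in> carrier V" "y \<in> carrier V" for x y
    using f[OF that(1)] f[OF that(2)] that
    by (intro f_eq) (simp add: match_def V.cinner_add_left V'.cinner_add_left)
  moreover have "f (c \<odot>\<^bsub>V\<^esub> x) = c \<odot>\<^bsub>V'\<^esub> f x" if "x \<in> carrier V" for c x
    using f[OF that] that
    by (intro f_eq) (simp add: match_def V.cinner_smult_left V'.cinner_smult_left)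
  moreover have "cinner V' (f x) (f y) = cinner V x y" if "x \<in> carrier V" "y \<in> carrier V" for x y
    using match_cinner f that by blast
  ultimately have "unitary_map V V' f" by (simp add: unitary_map_def)
  moreover have "f (u i) = u' i" for i
    by (intro f_eq) (simp add: match_def same_gram)
  moreover have "cinner V' (f v) (u' i) = cinner V v (u i)" if "v \<in> carrier V" for v i
    using f[OF that] by (simp add: match_def)
  ultimately show ?thesis using that by blast
qed

section \<open>The Hilbert space of a positive semidefinite kernel\<close>

lemma gram_Nil [simp]: "gram K [] ys = 0" "gram K xs [] = 0"
  by (simp_all add: gram_def split_def)

lemma gram_append_left: "gram K (xs @ ys) zs = gram K xs zs + gram K ys zs"
  by (simp add: gram_def)

lemma gram_append_right: "gram K zs (xs @ ys) = gram K zs xs + gram K zs ys"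
  by (simp add: gram_def split_def sum_list_addf)

lemma gram_lscale_left: "gram K (lscale c xs) zs = c * gram K xs zs"
  by (simp add: gram_def lscale_def split_def o_def mult.assoc sum_list_const_mult)

lemma gram_lscale_right: "gram K zs (lscale c xs) = cnj c * gram K zs xs"
  by (simp add: gram_def lscale_def split_def o_def mult.assoc mult.left_commute sum_list_const_mult)

lemma gram_ldiff_left: "gram K (ldiff xs ys) zs = gram K xs zs - gram K ys zs"
  by (simp add: ldiff_def gram_append_left gram_lscale_left)

lemma gram_ldiff_right: "gram K zs (ldiff xs ys) = gram K zs xs - gram K zs ys"
  by (simp add: ldiff_def gram_append_right gram_lscale_right)

lemmas gram_linear = gram_append_left gram_append_right gram_lscale_left gram_lscale_right
  gram_ldiff_left gram_ldiff_right

lemma gram_hermitian: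
  assumes "\<And>i j. K j i = cnj (K i j)"
  shows "gram K ys xs = cnj (gram K xs ys)"
proof (induction xs)
  case (Cons x xs)
  have "gram K ys (x # xs) = gram K ys [x] + gram K ys xs"
    using gram_append_right[of K ys "[x]" xs] by simp
  moreover have "gram K (x # xs) ys = gram K [x] ys + gram K xs ys"
    using gram_append_left[of K "[x]" xs ys] by simp
  moreover have "gram K ys [x] = cnj (gram K [x] ys)"
  proof -
    have "cnj (K (snd x) j) = K j (snd x)" for j using assms[of "snd x" j] by simp
    then show ?thesis
      by (induction ys) (auto simp: gram_def split_def mult_ac)
  qed
  ultimately show ?case using Cons by simp
qed simp

lemma gram_Cons_right: "gram K xs ((d, j) # ys) = cnj d * gram K xs [(1, j)] + gram K xs ys"
  using gram_append_right[of K xs "[(d, j)]" ys] gram_lscale_right[of K xs d "[(1, j)]"] by simp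

text \<open>Hermitian symmetry makes \<open>gram K xs xs\<close> real, so that positivity has to be
  required of the real part only.\<close>

locale psd_kernel =
  fixes K :: "'i \<Rightarrow> 'i \<Rightarrow> complex"
  assumes hermitian: "\<And>i j. K j i = cnj (K i j)"
    and psd: "\<And>xs. 0 \<le> Re (gram K xs xs)"
begin

section \<open>The seminorm of a positive semidefinite kernel\<close>

abbreviation B where "B \<equiv> gram K"

definition N :: "(complex \<times> 'i) list \<Rightarrow> real" where "N xs = sqrt (Re (B xs xs))"

text \<open>The function that represents \<open>xs\<close> in the reproducing kernel space of
  \<open>K\<close>: its value at \<open>j\<close> is the inner product with the basis vector of
  index \<open>j\<close>.\<close>

definition ev :: "(complex \<times> 'i) list \<Rightarrow> 'i \<Rightarrow> complex" where "ev xs j = B xs [(1, j)]"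

lemma B_commute: "B ys xs = cnj (B xs ys)"
  by (rule gram_hermitian) (rule hermitian)

lemma N_nonneg [simp]: "0 \<le> N xs" by (simp add: N_def psd)

lemma N_sq: "(N xs)\<^sup>2 = Re (B xs xs)" by (simp add: N_def psd)

lemma B_self: "B xs xs = of_real ((N xs)\<^sup>2)"
  using B_commute[of xs xs] unfolding N_sq by (simp add: complex_eq_iff)

text \<open>\<open>N\<close> is only a seminorm, so \<open>N ys = 0\<close> does not make
  \<open>ys\<close> trivial and needs its own argument: the quadratic inequality in the real
  parameter \<open>s\<close> degenerates to a linear one.\<close>

lemma B_Cauchy_Schwarz: "cmod (B xs ys) \<le> N xs * N ys"
proof -
  define a where "a = (N xs)\<^sup>2"
  define d where "d = (N ys)\<^sup>2"
  define b where "b = B xs ys"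
  define r where "r = (cmod b)\<^sup>2"
  \<comment> \<open>Positivity of the form at \<open>xs\<close> minus the multiple
    \<open>s * b\<close> of \<open>ys\<close>; the factor \<open>b\<close> turns the cross term into
    its squared modulus.\<close>
  have *: "0 \<le> a - 2 * s * r + s\<^sup>2 * r * d" for s
  proof -
    define c where "c = of_real s * b"
    have "0 \<le> Re (B (ldiff xs (lscale c ys)) (ldiff xs (lscale c ys)))" by (rule psd)
    also have "B (ldiff xs (lscale c ys)) (ldiff xs (lscale c ys)) =
       of_real a - cnj c * b - c * cnj b + c * cnj c * of_real d"
      using B_commute[of ys xs] by (simp add: gram_linear a_def b_def d_def B_self[symmetric] algebra_simps del: of_real_power)
    also have "\<dots> = of_real a - of_real (2 * s) * (b * cnj b) + of_real (s\<^sup>2 * d) * (b * cnj b)"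
      by (simp add: c_def algebra_simps power2_eq_square)
    also have "\<dots> = of_real (a - 2 * s * r + s\<^sup>2 * r * d)"
      unfolding complex_norm_square[symmetric] by (simp add: r_def)
    finally show ?thesis by simp
  qed
  have "r \<le> a * d"
  proof (cases "d = 0")
    case True
    have "r = 0"
    proof (rule ccontr)
      assume "r \<noteq> 0"
      \<comment> \<open>For \<open>d = 0\<close> this value of \<open>s\<close> makes the right-hand
        side equal to -1.\<close>
      then show False using *[of "(a + 1) / (2 * r)"] True by (simp add: field_simps)
    qed
    then show ?thesis using True by simp
  next
    case False
    then have "d > 0" by (simp add: d_def)
    then show ?thesis using *[of "1 / d"] by (simp add: field_simps power2_eq_square)
  qed
  then have "(cmod b)\<^sup>2 \<le> (N xs * N ys)\<^sup>2" by (simp add: a_def d_def r_def power_mult_distrib)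
  then have "cmod b \<le> N xs * N ys" by (rule power2_le_imp_le) simp
  then show ?thesis by (simp add: b_def)
qed

lemma N_diff_triangle: "N (ldiff xs zs) \<le> N (ldiff xs ys) + N (ldiff ys zs)"
proof -
  define a where "a = ldiff xs ys"
  define b where "b = ldiff ys zs"
  have "(N (ldiff xs zs))\<^sup>2 = Re (B a a + B a b + B b a + B b b)"
    unfolding N_sq by (simp add: a_def b_def gram_linear)
  also have "\<dots> = (N a)\<^sup>2 + 2 * Re (B a b) + (N b)\<^sup>2"
    using B_commute[of b a] by (simp add: N_sq)
  also have "\<dots> \<le> (N a)\<^sup>2 + 2 * (N a * N b) + (N b)\<^sup>2"
    using order_trans[OF complex_Re_le_cmod B_Cauchy_Schwarz] by simp
  also have "\<dots> = (N a + N b)\<^sup>2" by (simp add: power2_sum)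
  finally show ?thesis unfolding a_def b_def by (rule power2_le_imp_le) simp
qed

lemma N_ldiff_append: "N (ldiff (xs @ xs') (ys @ ys')) \<le> N (ldiff xs ys) + N (ldiff xs' ys')"
proof -
  have "N (ldiff (xs @ xs') (ys @ ys')) \<le> N (ldiff (xs @ xs') (ys @ xs')) + N (ldiff (ys @ xs') (ys @ ys'))"
    by (rule N_diff_triangle)
  then show ?thesis by (simp add: N_def gram_linear)
qed

lemma N_lscale: "N (lscale c xs) = cmod c * N xs"
proof -
  have "B (lscale c xs) (lscale c xs) = (c * cnj c) * B xs xs" by (simp add: gram_linear)
  also have "\<dots> = of_real ((cmod c * N xs)\<^sup>2)"
    unfolding B_self complex_norm_square[symmetric] by (simp add: power_mult_distrib)
  finally have "(N (lscale c xs))\<^sup>2 = (cmod c * N xs)\<^sup>2" unfolding N_sq by (metis Re_complex_of_real)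
  then show ?thesis by (simp add: power2_eq_iff_nonneg)
qed


section \<open>Cauchy sequences of linear combinations and the functions they represent\<close>

definition cau :: "(nat \<Rightarrow> (complex \<times> 'i) list) \<Rightarrow> bool" where
  "cau s \<longleftrightarrow> (\<forall>e>0. \<exists>M. \<forall>m\<ge>M. \<forall>n\<ge>M. N (ldiff (s m) (s n)) < e)"

definition rep :: "(nat \<Rightarrow> (complex \<times> 'i) list) \<Rightarrow> ('i \<Rightarrow> complex) \<Rightarrow> bool" where
  "rep s F \<longleftrightarrow> cau s \<and> (\<forall>j. (\<lambda>n. ev (s n) j) \<longlonglongrightarrow> F j)"

lemma cau_const: "cau (\<lambda>_. xs)" by (simp add: cau_def N_def gram_linear)

lemma cau_append:
  assumes "cau s" "cau t" shows "cau (\<lambda>n. s n @ t n)"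
  unfolding cau_def
proof (intro allI impI)
  fix e :: real assume "e > 0"
  then have e: "e / 2 > 0" by simp
  obtain M1 where M1: "\<forall>m\<ge>M1. \<forall>n\<ge>M1. N (ldiff (s m) (s n)) < e / 2" using assms(1) e unfolding cau_def by blast
  obtain M2 where M2: "\<forall>m\<ge>M2. \<forall>n\<ge>M2. N (ldiff (t m) (t n)) < e / 2" using assms(2) e unfolding cau_def by blast
  show "\<exists>M. \<forall>m\<ge>M. \<forall>n\<ge>M. N (ldiff (s m @ t m) (s n @ t n)) < e"
  proof (intro exI allI impI)
    fix m n assume "max M1 M2 \<le> m" "max M1 M2 \<le> n"
    then have "N (ldiff (s m) (s n)) < e / 2" "N (ldiff (t m) (t n)) < e / 2" using M1 M2 by auto
    then show "N (ldiff (s m @ t m) (s n @ t n)) < e"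
      using N_ldiff_append[of "s m" "t m" "s n" "t n"] by linarith
  qed
qed

lemma cau_lscale:
  assumes "cau s" shows "cau (\<lambda>n. lscale c (s n))"
  unfolding cau_def
proof (intro allI impI)
  fix e :: real assume "e > 0"
  have pos: "cmod c + 1 > 0" by (simp add: add_nonneg_pos)
  then have "e / (cmod c + 1) > 0" using \<open>e > 0\<close> by simp
  then obtain M where M: "\<forall>m\<ge>M. \<forall>n\<ge>M. N (ldiff (s m) (s n)) < e / (cmod c + 1)"
    using assms unfolding cau_def by blast
  show "\<exists>M. \<forall>m\<ge>M. \<forall>n\<ge>M. N (ldiff (lscale c (s m)) (lscale c (s n))) < e"
  proof (intro exI allI impI)
    fix m n assume mn: "M \<le> m" "M \<le> n"
    have "N (ldiff (lscale c (s m)) (lscale c (s n))) = N (lscale c (ldiff (s m) (s n)))"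
      by (simp add: N_def gram_linear algebra_simps)
    also have "\<dots> \<le> (cmod c + 1) * N (ldiff (s m) (s n))"
      unfolding N_lscale by (intro mult_right_mono) auto
    also have "\<dots> < e" using M mn pos by (simp add: pos_less_divide_eq mult.commute)
    finally show "N (ldiff (lscale c (s m)) (lscale c (s n))) < e" .
  qed
qed

lemma cau_bounded:
  assumes "cau s"
  obtains C M where "C > 0" "\<And>n. n \<ge> M \<Longrightarrow> N (s n) \<le> C"
proof -
  have "(1::real) > 0" by simp
  then obtain M where M: "\<forall>m\<ge>M. \<forall>n\<ge>M. N (ldiff (s m) (s n)) < 1" using assms unfolding cau_def by blast
  have "N (s n) \<le> 1 + N (s M)" if "n \<ge> M" for n
  proof -
    have "N (ldiff (s n) []) \<le> N (ldiff (s n) (s M)) + N (ldiff (s M) [])" by (rule N_diff_triangle)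
    moreover have "N (ldiff xs []) = N xs" for xs by (simp add: ldiff_def)
    ultimately show ?thesis using M that by fastforce
  qed
  moreover have "1 + N (s M) > 0" by (simp add: add_pos_nonneg)
  ultimately show ?thesis using that by blast
qed

lemma B_diff_bound: "cmod (B x y - B x' y') \<le> N x * N (ldiff y y') + N (ldiff x x') * N y'"
proof -
  have eq: "B x y - B x' y' = B x (ldiff y y') + B (ldiff x x') y'" by (simp add: gram_linear)
  show ?thesis
    unfolding eq using norm_triangle_ineq[of "B x (ldiff y y')" "B (ldiff x x') y'"]
      B_Cauchy_Schwarz[of x "ldiff y y'"] B_Cauchy_Schwarz[of "ldiff x x'" y'] by linarith
qed

lemma B_convergent:
  assumes "cau s" "cau t"
  shows "convergent (\<lambda>n. B (s n) (t n))"
proof (rule Cauchy_convergent, rule metric_CauchyI)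
  fix e :: real assume e: "e > 0"
  obtain C M where C: "C > 0" "\<And>n. n \<ge> M \<Longrightarrow> N (s n) \<le> C" using cau_bounded[OF assms(1)] by blast
  obtain D L where D: "D > 0" "\<And>n. n \<ge> L \<Longrightarrow> N (t n) \<le> D" using cau_bounded[OF assms(2)] by blast
  have "e / (2 * D) > 0" "e / (2 * C) > 0" using e C D by auto
  then obtain M1 M2 where M1: "\<forall>m\<ge>M1. \<forall>n\<ge>M1. N (ldiff (s m) (s n)) < e / (2 * D)"
    and M2: "\<forall>m\<ge>M2. \<forall>n\<ge>M2. N (ldiff (t m) (t n)) < e / (2 * C)" using assms unfolding cau_def by meson
  show "\<exists>P. \<forall>m\<ge>P. \<forall>n\<ge>P. dist (B (s m) (t m)) (B (s n) (t n)) < e"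
  proof (intro exI allI impI)
    fix m n assume mn: "M + L + M1 + M2 \<le> m" "M + L + M1 + M2 \<le> n"
    have s: "N (ldiff (s m) (s n)) < e / (2 * D)" using M1 mn by auto
    have t: "N (ldiff (t m) (t n)) < e / (2 * C)" using M2 mn by auto
    have "N (s m) * N (ldiff (t m) (t n)) \<le> C * N (ldiff (t m) (t n))"
      using C(2)[of m] mn by (intro mult_right_mono) auto
    also have "\<dots> < C * (e / (2 * C))" using t C(1) by (intro mult_strict_left_mono)
    also have "\<dots> = e / 2" using C(1) by simp
    finally have 1: "N (s m) * N (ldiff (t m) (t n)) < e / 2" .
    have "N (ldiff (s m) (s n)) * N (t n) \<le> N (ldiff (s m) (s n)) * D"
      using D(2)[of n] mn by (intro mult_left_mono) auto
    also have "\<dots> < e / (2 * D) * D" using s D(1) by (intro mult_strict_right_mono)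
    also have "\<dots> = e / 2" using D(1) by simp
    finally have "N (ldiff (s m) (s n)) * N (t n) < e / 2" .
    with 1 show "dist (B (s m) (t m)) (B (s n) (t n)) < e"
      using B_diff_bound[of "s m" "t m" "s n" "t n"] by (simp add: dist_norm)
  qed
qed

lemma B_tendsto_zero:
  assumes F: "\<forall>j. (\<lambda>n. ev (s n) j) \<longlonglongrightarrow> 0"
  shows "(\<lambda>n. B (s n) ys) \<longlonglongrightarrow> 0"
proof (induction ys)
  case (Cons y ys)
  obtain d j where y: "y = (d, j)" by (cases y)
  have "(\<lambda>n. cnj d * ev (s n) j + B (s n) ys) \<longlonglongrightarrow> cnj d * 0 + 0"
    using F Cons by (intro tendsto_intros) auto
  then show ?case unfolding y gram_Cons_right[of K _ d j ys] ev_def by simp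
qed simp

text \<open>This is what makes a quotient unnecessary. Split \<open>B (s n) (s n)\<close> at a fixed
  late term \<open>s M1\<close>: the part with \<open>s M1\<close> tends to zero because
  \<open>s M1\<close> is a finite combination of basis vectors, and the rest is small by the Cauchy
  condition and boundedness. Each part gets half of e^2.\<close>

lemma rep_zero_null:
  assumes "rep s (\<lambda>_. 0)"
  shows "(\<lambda>n. N (s n)) \<longlonglongrightarrow> 0"
proof (rule LIMSEQ_I)
  fix e :: real assume e: "e > 0"
  have s: "cau s" and F: "\<forall>j. (\<lambda>n. ev (s n) j) \<longlonglongrightarrow> 0" using assms by (auto simp: rep_def)
  obtain C M where C: "C > 0" "\<And>n. n \<ge> M \<Longrightarrow> N (s n) \<le> C" using cau_bounded[OF s] by blast
  have e2: "e\<^sup>2 / (2 * C) > 0" using e C by simp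
  then obtain M1 where M1: "\<forall>m\<ge>M1. \<forall>n\<ge>M1. N (ldiff (s m) (s n)) < e\<^sup>2 / (2 * C)" using s unfolding cau_def by blast
  have "(\<lambda>n. B (s n) (s M1)) \<longlonglongrightarrow> 0" by (rule B_tendsto_zero[OF F])
  then obtain M2 where M2: "\<And>n. n \<ge> M2 \<Longrightarrow> cmod (B (s n) (s M1)) < e\<^sup>2 / 2"
    using e LIMSEQ_D[of "\<lambda>n. B (s n) (s M1)" 0 "e\<^sup>2 / 2"] by auto
  show "\<exists>no. \<forall>n\<ge>no. norm (N (s n) - 0) < e"
  proof (intro exI allI impI)
    fix n assume n: "M + M1 + M2 \<le> n"
    have "(N (s n))\<^sup>2 = cmod (B (s n) (s n))" by (simp add: B_self norm_power)
    also have "B (s n) (s n) = B (s n) (s M1) + B (s n) (ldiff (s n) (s M1))" by (simp add: gram_linear)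
    also have "cmod \<dots> \<le> cmod (B (s n) (s M1)) + N (s n) * N (ldiff (s n) (s M1))"
      using norm_triangle_ineq B_Cauchy_Schwarz by (smt (verit))
    also have "\<dots> \<le> cmod (B (s n) (s M1)) + C * N (ldiff (s n) (s M1))"
      using C(2)[of n] n by (intro add_left_mono mult_right_mono) auto
    also have "\<dots> < e\<^sup>2 / 2 + C * (e\<^sup>2 / (2 * C))"
      using M2[of n] M1 n C(1) by (intro add_strict_mono mult_strict_left_mono) auto
    also have "\<dots> = e\<^sup>2" using C(1) by simp
    finally have "N (s n) < e" using e by (auto intro: power2_less_imp_less)
    then show "norm (N (s n) - 0) < e" by simp
  qed
qed

lemma rep_const: "rep (\<lambda>_. xs) (ev xs)"
  by (simp add: rep_def cau_const)

lemma ev_append: "ev (xs @ ys) j = ev xs j + ev ys j" by (simp add: ev_def gram_linear)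
lemma ev_lscale: "ev (lscale c xs) j = c * ev xs j" by (simp add: ev_def gram_linear)

lemma rep_append: "rep s F \<Longrightarrow> rep t G \<Longrightarrow> rep (\<lambda>n. s n @ t n) (\<lambda>j. F j + G j)"
  by (auto simp: rep_def ev_append intro!: cau_append tendsto_intros)

lemma rep_lscale: "rep s F \<Longrightarrow> rep (\<lambda>n. lscale c (s n)) (\<lambda>j. c * F j)"
  by (auto simp: rep_def ev_lscale intro!: cau_lscale tendsto_intros)

lemma rep_Nil: "rep (\<lambda>n. []) (\<lambda>j. 0)"
  using rep_const[of "[]"] by (simp add: ev_def[abs_def])

lemma rep_ldiff: "rep s F \<Longrightarrow> rep t G \<Longrightarrow> rep (\<lambda>n. ldiff (s n) (t n)) (\<lambda>j. F j - G j)"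
  using rep_append[OF _ rep_lscale[of t G "-1"], of s F] by (simp add: ldiff_def)

lemma cau_rep:
  assumes "cau s" obtains F where "rep s F"
proof -
  have "\<forall>j. \<exists>l. (\<lambda>n. ev (s n) j) \<longlonglongrightarrow> l"
    using B_convergent[OF assms cau_const] by (auto simp: ev_def convergent_def)
  then obtain F where "\<And>j. (\<lambda>n. ev (s n) j) \<longlonglongrightarrow> F j" by metis
  then show ?thesis using assms that by (auto simp: rep_def)
qed

text \<open>Two sequences that represent the same function differ by a null sequence; hence
  \<open>ip\<close> will not depend on the representatives.\<close>

lemma B_limit_unique:
  assumes "rep s F" "rep s' F" "rep t G" "rep t' G" "(\<lambda>n. B (s n) (t n)) \<longlonglongrightarrow> l"
  shows "(\<lambda>n. B (s' n) (t' n)) \<longlonglongrightarrow> l"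
proof -
  have 1: "(\<lambda>n. N (ldiff (s n) (s' n))) \<longlonglongrightarrow> 0"
    using rep_ldiff[OF assms(1,2)] by (intro rep_zero_null) simp
  have 2: "(\<lambda>n. N (ldiff (t n) (t' n))) \<longlonglongrightarrow> 0"
    using rep_ldiff[OF assms(3,4)] by (intro rep_zero_null) simp
  obtain C M where C: "C > 0" "\<And>n. n \<ge> M \<Longrightarrow> N (s n) \<le> C" using cau_bounded[of s] assms by (auto simp: rep_def)
  obtain D L where D: "D > 0" "\<And>n. n \<ge> L \<Longrightarrow> N (t' n) \<le> D" using cau_bounded[of t'] assms by (auto simp: rep_def)
  have "(\<lambda>n. C * N (ldiff (t n) (t' n)) + N (ldiff (s n) (s' n)) * D) \<longlonglongrightarrow> C * 0 + 0 * D"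
    using 1 2 by (intro tendsto_intros)
  then have 3: "(\<lambda>n. C * N (ldiff (t n) (t' n)) + N (ldiff (s n) (s' n)) * D) \<longlonglongrightarrow> 0" by simp
  have "eventually (\<lambda>n. norm (B (s n) (t n) - B (s' n) (t' n)) \<le>
      C * N (ldiff (t n) (t' n)) + N (ldiff (s n) (s' n)) * D) sequentially"
    unfolding eventually_sequentially
  proof (intro exI allI impI)
    fix n assume n: "M + L \<le> n"
    have "N (s n) * N (ldiff (t n) (t' n)) \<le> C * N (ldiff (t n) (t' n))"
      using C(2)[of n] n by (intro mult_right_mono) auto
    moreover have "N (ldiff (s n) (s' n)) * N (t' n) \<le> N (ldiff (s n) (s' n)) * D"
      using D(2)[of n] n by (intro mult_left_mono) auto
    ultimately show "norm (B (s n) (t n) - B (s' n) (t' n)) \<le>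
      C * N (ldiff (t n) (t' n)) + N (ldiff (s n) (s' n)) * D"
      using B_diff_bound[of "s n" "t n" "s' n" "t' n"] by linarith
  qed
  then have "(\<lambda>n. B (s n) (t n) - B (s' n) (t' n)) \<longlonglongrightarrow> 0"
    by (rule Lim_null_comparison[OF _ 3])
  from tendsto_diff[OF assms(5) this] show ?thesis by simp
qed

text \<open>A Cauchy sequence of linear combinations represents the function of its limiting inner products
  with the basis vectors. This function determines the sequence up to null sequences, so the
  completion can be taken to consist of functions and no quotient is needed.\<close>

definition H :: "('i \<Rightarrow> complex) set" where "H = {F. \<exists>s. rep s F}"

definition ip :: "('i \<Rightarrow> complex) \<Rightarrow> ('i \<Rightarrow> complex) \<Rightarrow> complex" where
  "ip F G = lim (\<lambda>n. B ((SOME s. rep s F) n) ((SOME s. rep s G) n))"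

text \<open>Frees \<open>ip\<close> from its chosen representatives, so that later proofs may use
  whichever sequences are at hand.\<close>

lemma ip_rep:
  assumes "rep s F" "rep t G"
  shows "(\<lambda>n. B (s n) (t n)) \<longlonglongrightarrow> ip F G"
proof -
  have F: "rep (SOME s. rep s F) F" by (rule someI[of "\<lambda>s. rep s F", OF assms(1)])
  have G: "rep (SOME s. rep s G) G" by (rule someI[of "\<lambda>s. rep s G", OF assms(2)])
  have "convergent (\<lambda>n. B ((SOME s. rep s F) n) ((SOME s. rep s G) n))"
    using F G by (intro B_convergent) (auto simp: rep_def)
  then have "(\<lambda>n. B ((SOME s. rep s F) n) ((SOME s. rep s G) n)) \<longlonglongrightarrow> ip F G"
    unfolding ip_def by (rule convergent_LIMSEQ_iff[THEN iffD1])
  then show ?thesis by (rule B_limit_unique[OF F assms(1) G assms(2)])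
qed

lemma ip_eqI: "rep s F \<Longrightarrow> rep t G \<Longrightarrow> (\<lambda>n. B (s n) (t n)) \<longlonglongrightarrow> l \<Longrightarrow> ip F G = l"
  using ip_rep LIMSEQ_unique by blast

lemma H_ev [simp]: "ev xs \<in> H" using rep_const by (auto simp: H_def)
lemma H_zero [simp]: "(\<lambda>_. 0) \<in> H" using rep_Nil by (auto simp: H_def)
lemma H_add [simp]: "F \<in> H \<Longrightarrow> G \<in> H \<Longrightarrow> (\<lambda>j. F j + G j) \<in> H" unfolding H_def mem_Collect_eq by (elim exE, rule exI, erule (1) rep_append)
lemma H_smult [simp]: "F \<in> H \<Longrightarrow> (\<lambda>j. c * F j) \<in> H" unfolding H_def mem_Collect_eq by (elim exE, rule exI, erule rep_lscale)

lemma ip_add_left: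
  assumes "F \<in> H" "G \<in> H" "L \<in> H"
  shows "ip (\<lambda>j. F j + G j) L = ip F L + ip G L"
proof -
  obtain r s t where "rep r F" "rep s G" "rep t L" using assms by (auto simp: H_def)
  then show ?thesis
    by (intro ip_eqI[OF rep_append]) (auto simp: gram_linear intro!: tendsto_intros ip_rep)
qed

lemma ip_smult_left:
  assumes "F \<in> H" "L \<in> H"
  shows "ip (\<lambda>j. c * F j) L = c * ip F L"
proof -
  obtain r t where "rep r F" "rep t L" using assms by (auto simp: H_def)
  then show ?thesis
    by (intro ip_eqI[OF rep_lscale]) (auto simp: gram_linear intro!: tendsto_intros ip_rep)
qed

lemma ip_commute:
  assumes "F \<in> H" "L \<in> H"
  shows "ip L F = cnj (ip F L)"
proof -
  obtain r t where rt: "rep r F" "rep t L" using assms by (auto simp: H_def)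
  have "(\<lambda>n. cnj (B (r n) (t n))) \<longlonglongrightarrow> cnj (ip F L)" using ip_rep[OF rt] by (intro tendsto_intros)
  then show ?thesis
    by (intro ip_eqI[OF rt(2,1)]) (simp add: B_commute[of "t _" "r _"])
qed

text \<open>The reproducing property of the kernel space. It makes the basis total, since a function
  orthogonal to the basis has only zero values.\<close>

lemma ip_ev_right:
  assumes "F \<in> H" shows "ip F (ev [(1, j)]) = F j"
proof -
  obtain r where r: "rep r F" using assms by (auto simp: H_def)
  then show ?thesis by (intro ip_eqI[OF r rep_const]) (auto simp: rep_def ev_def)
qed

text \<open>Cauchy-Schwarz against the basis vector of index \<open>j\<close> bounds the squared
  modulus of \<open>F j\<close> by a multiple of \<open>ip F F\<close>; a nonzero value therefore
  forces positivity.\<close>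

lemma ip_pos:
  assumes "F \<in> H" "F \<noteq> (\<lambda>_. 0)"
  shows "0 < Re (ip F F)"
proof -
  obtain r where r: "rep r F" using assms by (auto simp: H_def)
  have lim: "(\<lambda>n. (N (r n))\<^sup>2) \<longlonglongrightarrow> Re (ip F F)"
    using tendsto_Re[OF ip_rep[OF r r]] by (simp add: N_sq)
  then have ge: "0 \<le> Re (ip F F)" by (rule LIMSEQ_le_const) auto
  obtain j where j: "F j \<noteq> 0" using assms(2) by auto
  have "(cmod (F j))\<^sup>2 \<le> Re (ip F F) * (N [(1, j)])\<^sup>2"
  proof (rule LIMSEQ_le)
    show "(\<lambda>n. (cmod (ev (r n) j))\<^sup>2) \<longlonglongrightarrow> (cmod (F j))\<^sup>2"
      using r by (intro tendsto_intros) (auto simp: rep_def)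
    show "(\<lambda>n. (N (r n))\<^sup>2 * (N [(1, j)])\<^sup>2) \<longlonglongrightarrow> Re (ip F F) * (N [(1, j)])\<^sup>2"
      by (intro tendsto_intros lim)
    show "\<exists>M. \<forall>n\<ge>M. (cmod (ev (r n) j))\<^sup>2 \<le> (N (r n))\<^sup>2 * (N [(1, j)])\<^sup>2"
      unfolding power_mult_distrib[symmetric] ev_def
      by (intro exI allI impI power_mono B_Cauchy_Schwarz) simp
  qed
  moreover have "(cmod (F j))\<^sup>2 > 0" using j by simp
  ultimately have "Re (ip F F) * (N [(1, j)])\<^sup>2 > 0" by linarith
  then show ?thesis using ge by (auto simp: zero_less_mult_iff)
qed

text \<open>The space has to lie in the given type \<open>'h\<close>, so functions are coded by an
  injection and decoded before each operation.\<close>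

definition completion :: "(('i \<Rightarrow> complex) \<Rightarrow> 'h) \<Rightarrow> 'h inner_space" where
  "completion \<iota> = \<lparr>carrier = \<iota> ` H, mult = \<lambda>x y. x, one = \<iota> (\<lambda>_. 0), zero = \<iota> (\<lambda>_. 0),
     add = \<lambda>x y. \<iota> (\<lambda>j. inv_into UNIV \<iota> x j + inv_into UNIV \<iota> y j), smult = \<lambda>c x. \<iota> (\<lambda>j. c * inv_into UNIV \<iota> x j),
     cinner = \<lambda>x y. ip (inv_into UNIV \<iota> x) (inv_into UNIV \<iota> y)\<rparr>"

context
  fixes \<iota> :: "('i \<Rightarrow> complex) \<Rightarrow> 'h"
  assumes inj: "inj \<iota>"
begin

lemma completion_simps [simp]:
  "carrier (completion \<iota>) = \<iota> ` H" "\<zero>\<^bsub>completion \<iota>\<^esub> = \<iota> (\<lambda>_. 0)"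
  "\<iota> F \<oplus>\<^bsub>completion \<iota>\<^esub> \<iota> G = \<iota> (\<lambda>j. F j + G j)" "c \<odot>\<^bsub>completion \<iota>\<^esub> \<iota> F = \<iota> (\<lambda>j. c * F j)"
  "cinner (completion \<iota>) (\<iota> F) (\<iota> G) = ip F G"
  using inj by (simp_all add: completion_def)

lemma pre_hilbert_space_completion: "pre_hilbert_space (completion \<iota>)"
proof -
  have "abelian_group (completion \<iota>)"
  proof (rule abelian_groupI)
    fix x assume "x \<in> carrier (completion \<iota>)"
    then obtain F where F: "F \<in> H" "x = \<iota> F" by auto
    have "(\<lambda>j. - 1 * F j) \<in> H" using F(1) by (rule H_smult)
    then show "\<exists>y\<in>carrier (completion \<iota>). y \<oplus>\<^bsub>completion \<iota>\<^esub> x = \<zero>\<^bsub>completion \<iota>\<^esub>"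
      using F by (intro bexI[of _ "\<iota> (\<lambda>j. - 1 * F j)"]) auto
  qed (auto simp: add_ac)
  then have "Module.module complex_ring (completion \<iota>)"
    by (intro moduleI cring_complex_ring) (auto simp: algebra_simps)
  then show ?thesis
  proof (intro pre_hilbert_space.intro pre_hilbert_space_axioms.intro)
    fix x assume "x \<in> carrier (completion \<iota>)" "x \<noteq> \<zero>\<^bsub>completion \<iota>\<^esub>"
    then obtain F where "F \<in> H" "x = \<iota> F" "F \<noteq> (\<lambda>_. 0)" by auto
    then show "0 < Re (cinner (completion \<iota>) x x)" using ip_pos by simp
  qed (auto simp: ip_add_left ip_smult_left intro: ip_commute)
qed

interpretation S: pre_hilbert_space "completion \<iota>" by (rule pre_hilbert_space_completion)

definition basis :: "'i \<Rightarrow> 'h" where "basis j = \<iota> (ev [(1, j)])"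

lemma basis_in [simp]: "basis j \<in> carrier (completion \<iota>)" by (simp add: basis_def)

lemma lincomb_basis: "S.lincomb basis xs = \<iota> (ev xs)"
proof (induction xs)
  case Nil
  then show ?case by (simp add: ev_def[abs_def])
next
  case (Cons x xs)
  obtain c i where x: "x = (c, i)" by (cases x)
  have "ev ((c, i) # xs) j = c * ev [(1, i)] j + ev xs j" for j
    using ev_append[of "lscale c [(1, i)]" xs j] ev_lscale[of c "[(1, i)]" j] by simp
  then show ?case using Cons by (simp add: x basis_def fun_eq_iff[symmetric] del: completion_simps(1))
qed

lemma hnorm_lincomb_basis: "hnorm (completion \<iota>) (S.lincomb basis xs) = N xs"
proof -
  have "ip (ev xs) (ev xs) = B xs xs" by (rule ip_eqI[OF rep_const rep_const]) simp
  then show ?thesis by (simp add: hnorm_def N_def lincomb_basis)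
qed

text \<open>The distance from the combination \<open>s m\<close> to the represented function is the
  limit over n of \<open>N (ldiff (s m) (s n))\<close>, which the Cauchy condition makes
  small.\<close>

lemma rep_hconv:
  assumes "rep s F" shows "S.hconv (\<lambda>n. S.lincomb basis (s n)) (\<iota> F)"
  unfolding S.hconv_def
proof (intro conjI allI)
  show "S.lincomb basis (s n) \<in> carrier (completion \<iota>)" for n by (rule S.lincomb_in) (rule basis_in)
  show F: "\<iota> F \<in> carrier (completion \<iota>)" using assms by (auto simp: H_def)
  have bound: "hnorm (completion \<iota>) (S.lincomb basis (s m) \<ominus>\<^bsub>completion \<iota>\<^esub> \<iota> F) \<le> e"
    if e: "\<And>n. n \<ge> M \<Longrightarrow> N (ldiff (s m) (s n)) \<le> e" for m M e
  proof -
    have e0: "e \<ge> 0" using order_trans[OF N_nonneg e[OF order_refl]] .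
    have r: "rep (\<lambda>n. ldiff (s m) (s n)) (\<lambda>j. ev (s m) j - F j)"
      by (rule rep_ldiff[OF rep_const assms])
    have "S.lincomb basis (s m) \<ominus>\<^bsub>completion \<iota>\<^esub> \<iota> F = \<iota> (\<lambda>j. ev (s m) j - F j)"
      using F by (simp add: S.diff_smult lincomb_basis)
    then have "(hnorm (completion \<iota>) (S.lincomb basis (s m) \<ominus>\<^bsub>completion \<iota>\<^esub> \<iota> F))\<^sup>2 = Re (ip (\<lambda>j. ev (s m) j - F j) (\<lambda>j. ev (s m) j - F j))"
      using r by (subst S.hnorm_sq) (auto simp: H_def)
    also have "\<dots> \<le> e\<^sup>2"
    proof (rule LIMSEQ_le_const2)
      show "(\<lambda>n. (N (ldiff (s m) (s n)))\<^sup>2) \<longlonglongrightarrow> Re (ip (\<lambda>j. ev (s m) j - F j) (\<lambda>j. ev (s m) j - F j))"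
        using tendsto_Re[OF ip_rep[OF r r]] by (simp add: N_sq)
      show "\<exists>M. \<forall>n\<ge>M. (N (ldiff (s m) (s n)))\<^sup>2 \<le> e\<^sup>2"
        using e by (intro exI[of _ M] allI impI power_mono) auto
    qed
    finally show ?thesis using e0 by (rule power2_le_imp_le)
  qed
  show "(\<lambda>n. hnorm (completion \<iota>) (S.lincomb basis (s n) \<ominus>\<^bsub>completion \<iota>\<^esub> \<iota> F)) \<longlonglongrightarrow> 0"
  proof (rule LIMSEQ_I)
    fix e :: real assume "e > 0"
    then have "e / 2 > 0" by simp
    then obtain M where M: "\<forall>m\<ge>M. \<forall>n\<ge>M. N (ldiff (s m) (s n)) < e / 2"
      using assms unfolding rep_def cau_def by blast
    have "hnorm (completion \<iota>) (S.lincomb basis (s m) \<ominus>\<^bsub>completion \<iota>\<^esub> \<iota> F) \<le> e / 2" if "m \<ge> M" for m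
      by (rule bound[of M]) (use M that in \<open>auto intro: less_imp_le\<close>)
    moreover have "0 \<le> hnorm (completion \<iota>) (S.lincomb basis (s m) \<ominus>\<^bsub>completion \<iota>\<^esub> \<iota> F)" for m
      by (intro S.hnorm_nonneg S.diff_in F S.lincomb_in basis_in)
    ultimately show "\<exists>no. \<forall>n\<ge>no. norm (hnorm (completion \<iota>) (S.lincomb basis (s n) \<ominus>\<^bsub>completion \<iota>\<^esub> \<iota> F) - 0) < e"
      using \<open>e > 0\<close> by (intro exI[of _ M] allI impI) (smt (verit) field_sum_of_halves real_norm_def)
  qed
qed

text \<open>Replace the n-th term of a Cauchy sequence by a finite combination at distance less than
  1 / (n + 1). These combinations are again Cauchy, and the function they represent is the limit of
  both sequences.\<close>

lemma hilbert_space_completion: "hilbert_space (completion \<iota>)"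
proof (intro hilbert_space.intro hilbert_space_axioms.intro pre_hilbert_space_completion)
  interpret Metric_space "carrier (completion \<iota>)" "hdist (completion \<iota>)" by (rule S.Metric_space_hdist)
  show mcomplete
    unfolding mcomplete_def
  proof (intro allI impI)
    fix x assume "MCauchy x"
    then have x: "\<And>n. x n \<in> carrier (completion \<iota>)" and
      cx: "\<And>e. e > 0 \<Longrightarrow> \<exists>M. \<forall>n n'. M \<le> n \<longrightarrow> M \<le> n' \<longrightarrow> hdist (completion \<iota>) (x n) (x n') < e"
      unfolding MCauchy_def by blast+
    have "\<exists>xs. hnorm (completion \<iota>) (S.lincomb basis xs \<ominus>\<^bsub>completion \<iota>\<^esub> x n) < inverse (real (Suc n))" for n
    proof -
      obtain F s where F: "x n = \<iota> F" "rep s F" using x[of n] by (auto simp: H_def)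
      have "(\<lambda>m. hnorm (completion \<iota>) (S.lincomb basis (s m) \<ominus>\<^bsub>completion \<iota>\<^esub> x n)) \<longlonglongrightarrow> 0"
        using rep_hconv[OF F(2)] unfolding S.hconv_def F(1) by blast
      from order_tendstoD(2)[OF this, of "inverse (real (Suc n))"]
      have "eventually (\<lambda>m. hnorm (completion \<iota>) (S.lincomb basis (s m) \<ominus>\<^bsub>completion \<iota>\<^esub> x n) < inverse (real (Suc n))) sequentially"
        by simp
      then show ?thesis unfolding eventually_sequentially by blast
    qed
    then obtain d where d: "\<And>n. hnorm (completion \<iota>) (S.lincomb basis (d n) \<ominus>\<^bsub>completion \<iota>\<^esub> x n) < inverse (real (Suc n))"
      by metis
    have lV: "S.lincomb basis xs \<in> carrier (completion \<iota>)" for xs by (rule S.lincomb_in) (rule basis_in)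
    have "cau d"
      unfolding cau_def
    proof (intro allI impI)
      fix e :: real assume e: "e > 0"
      then obtain M1 where M1: "\<forall>n n'. M1 \<le> n \<longrightarrow> M1 \<le> n' \<longrightarrow> hdist (completion \<iota>) (x n) (x n') < e / 3"
        using cx[of "e / 3"] by auto
      obtain M2 where M2: "inverse (real (Suc M2)) < e / 3" using reals_Archimedean[of "e / 3"] e by auto
      show "\<exists>M. \<forall>m\<ge>M. \<forall>n\<ge>M. N (ldiff (d m) (d n)) < e"
      proof (intro exI allI impI)
        fix m n assume mn: "M1 + M2 \<le> m" "M1 + M2 \<le> n"
        have small: "inverse (real (Suc k)) < e / 3" if "M1 + M2 \<le> k" for k
        proof -
          have "inverse (real (Suc k)) \<le> inverse (real (Suc M2))" using that by (intro le_imp_inverse_le) auto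
          then show ?thesis using M2 by linarith
        qed
        have "N (ldiff (d m) (d n)) = hnorm (completion \<iota>) (S.lincomb basis (d m) \<ominus>\<^bsub>completion \<iota>\<^esub> S.lincomb basis (d n))"
          unfolding hnorm_lincomb_basis[symmetric] using S.lincomb_ldiff[of basis] basis_in by metis
        moreover have "hnorm (completion \<iota>) (S.lincomb basis (d m) \<ominus>\<^bsub>completion \<iota>\<^esub> S.lincomb basis (d n)) \<le>
            hnorm (completion \<iota>) (S.lincomb basis (d m) \<ominus>\<^bsub>completion \<iota>\<^esub> x m) + hnorm (completion \<iota>) (x m \<ominus>\<^bsub>completion \<iota>\<^esub> S.lincomb basis (d n))"
          by (intro S.hnorm_diff_triangle lV x)
        moreover have "hnorm (completion \<iota>) (x m \<ominus>\<^bsub>completion \<iota>\<^esub> S.lincomb basis (d n)) \<le>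
            hnorm (completion \<iota>) (x m \<ominus>\<^bsub>completion \<iota>\<^esub> x n) + hnorm (completion \<iota>) (x n \<ominus>\<^bsub>completion \<iota>\<^esub> S.lincomb basis (d n))"
          by (intro S.hnorm_diff_triangle lV x)
        moreover have "hnorm (completion \<iota>) (x n \<ominus>\<^bsub>completion \<iota>\<^esub> S.lincomb basis (d n)) = hnorm (completion \<iota>) (S.lincomb basis (d n) \<ominus>\<^bsub>completion \<iota>\<^esub> x n)"
          by (intro S.hnorm_diff_commute lV x)
        moreover have "hnorm (completion \<iota>) (x m \<ominus>\<^bsub>completion \<iota>\<^esub> x n) = hdist (completion \<iota>) (x m) (x n)"
          using x unfolding hdist_def by simp
        moreover have "hdist (completion \<iota>) (x m) (x n) < e / 3" using M1 mn by simp
        ultimately show "N (ldiff (d m) (d n)) < e"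
          using d[of m] d[of n] small[OF mn(1)] small[OF mn(2)] by linarith
      qed
    qed
    then obtain F where F: "rep d F" by (rule cau_rep)
    have FV: "\<iota> F \<in> carrier (completion \<iota>)" using F by (auto simp: H_def)
    have "S.hconv x (\<iota> F)"
      unfolding S.hconv_def
    proof (intro conjI allI x FV)
      have "(\<lambda>n. inverse (real (Suc n)) + hnorm (completion \<iota>) (S.lincomb basis (d n) \<ominus>\<^bsub>completion \<iota>\<^esub> \<iota> F)) \<longlonglongrightarrow> 0 + 0"
        using rep_hconv[OF F] unfolding S.hconv_def by (intro tendsto_intros LIMSEQ_inverse_real_of_nat) blast
      then have lim: "(\<lambda>n. inverse (real (Suc n)) + hnorm (completion \<iota>) (S.lincomb basis (d n) \<ominus>\<^bsub>completion \<iota>\<^esub> \<iota> F)) \<longlonglongrightarrow> 0" by simp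
      show "(\<lambda>n. hnorm (completion \<iota>) (x n \<ominus>\<^bsub>completion \<iota>\<^esub> \<iota> F)) \<longlonglongrightarrow> 0"
      proof (rule tendsto_sandwich[OF always_eventually always_eventually tendsto_const lim])
        show "\<forall>n. 0 \<le> hnorm (completion \<iota>) (x n \<ominus>\<^bsub>completion \<iota>\<^esub> \<iota> F)"
          by (intro allI S.hnorm_nonneg S.diff_in x FV)
        show "\<forall>n. hnorm (completion \<iota>) (x n \<ominus>\<^bsub>completion \<iota>\<^esub> \<iota> F) \<le> inverse (real (Suc n)) + hnorm (completion \<iota>) (S.lincomb basis (d n) \<ominus>\<^bsub>completion \<iota>\<^esub> \<iota> F)"
        proof
          fix n
          have "hnorm (completion \<iota>) (x n \<ominus>\<^bsub>completion \<iota>\<^esub> \<iota> F) \<le> hnorm (completion \<iota>) (x n \<ominus>\<^bsub>completion \<iota>\<^esub> S.lincomb basis (d n)) + hnorm (completion \<iota>) (S.lincomb basis (d n) \<ominus>\<^bsub>completion \<iota>\<^esub> \<iota> F)"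
            by (intro S.hnorm_diff_triangle lV x FV)
          moreover have "hnorm (completion \<iota>) (x n \<ominus>\<^bsub>completion \<iota>\<^esub> S.lincomb basis (d n)) = hnorm (completion \<iota>) (S.lincomb basis (d n) \<ominus>\<^bsub>completion \<iota>\<^esub> x n)"
            by (intro S.hnorm_diff_commute lV x)
          ultimately show "hnorm (completion \<iota>) (x n \<ominus>\<^bsub>completion \<iota>\<^esub> \<iota> F) \<le> inverse (real (Suc n)) + hnorm (completion \<iota>) (S.lincomb basis (d n) \<ominus>\<^bsub>completion \<iota>\<^esub> \<iota> F)"
            using d[of n] by linarith
        qed
      qed
    qed
    then show "\<exists>l. limitin mtopology x l sequentially" unfolding S.hconv_iff_hdist by blast
  qed
qed

lemma total_basis: "S.total basis"
  unfolding S.total_def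
proof (intro conjI allI ballI impI)
  show "basis i \<in> carrier (completion \<iota>)" for i by (rule basis_in)
  fix v assume v: "v \<in> carrier (completion \<iota>)" "\<forall>i. cinner (completion \<iota>) v (basis i) = 0"
  then obtain F where F: "F \<in> H" "v = \<iota> F" by auto
  have "F j = 0" for j using v(2) F ip_ev_right[OF F(1), of j] by (simp add: basis_def)
  then have "F = (\<lambda>_. 0)" by auto
  then show "v = \<zero>\<^bsub>completion \<iota>\<^esub>" using F by simp
qed

lemma cinner_basis: "cinner (completion \<iota>) (basis i) (basis j) = K i j"
  by (simp add: basis_def ip_ev_right) (simp add: ev_def gram_def)

end

text \<open>The Kolmogorov decomposition of a kernel. The cardinality assumption supplies the
  injection that places the function space inside \<open>'h\<close>.\<close>

theorem kolmogorov:
  assumes "(UNIV :: ('i \<Rightarrow> complex) set) \<lesssim> (UNIV :: 'h set)"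
  obtains V :: "'h inner_space" and u where "hilbert_space V" "pre_hilbert_space.total V u"
    "\<And>i j. cinner V (u i) (u j) = K i j"
proof -
  obtain \<iota> :: "('i \<Rightarrow> complex) \<Rightarrow> 'h" where "inj \<iota>" using assms by (auto simp: lepoll_def)
  then show ?thesis using that hilbert_space_completion total_basis cinner_basis by blast
qed

end

section \<open>Trigonometric polynomials and measures on the circle\<close>

abbreviation circle :: "complex set" where "circle \<equiv> sphere 0 1"

definition trig_poly :: "(complex \<times> int) list \<Rightarrow> complex \<Rightarrow> complex" where
  "trig_poly xs z = (\<Sum>(c, k)\<leftarrow>xs. c * z powi k)"

lemma trig_poly_simps [simp]: "trig_poly [] z = 0" "trig_poly ((c, k) # xs) z = c * z powi k + trig_poly xs z"
  by (simp_all add: trig_poly_def)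

lemma trig_poly_append: "trig_poly (xs @ ys) z = trig_poly xs z + trig_poly ys z"
  by (simp add: trig_poly_def)

lemma trig_poly_lscale: "trig_poly (lscale c xs) z = c * trig_poly xs z"
  by (induction xs) (auto simp: algebra_simps)

lemma trig_poly_ldiff: "trig_poly (ldiff xs ys) z = trig_poly xs z - trig_poly ys z"
  by (simp add: ldiff_def trig_poly_append trig_poly_lscale)

lemma trig_poly_shift:
  assumes "z \<noteq> 0"
  shows "trig_poly (map (\<lambda>(d, l). (c * d, k + l)) ys) z = c * z powi k * trig_poly ys z"
  by (induction ys) (use assms in \<open>auto simp: power_int_add algebra_simps\<close>)

lemma trig_poly_mult:
  assumes "z \<noteq> 0"
  shows "trig_poly (concat (map (\<lambda>(c, k). map (\<lambda>(d, l). (c * d, k + l)) ys) xs)) z = trig_poly xs z * trig_poly ys z"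
  using assms by (induction xs) (auto simp: trig_poly_append trig_poly_shift algebra_simps)

lemma circle_nonzero [simp]: "z \<in> circle \<Longrightarrow> z \<noteq> 0" by auto

lemma cnj_circle: "z \<in> circle \<Longrightarrow> cnj z = inverse z"
  by (simp add: inverse_complex_def complex_eq_iff cmod_def)

lemma cnj_powi_circle: "z \<in> circle \<Longrightarrow> cnj z powi k = z powi (- k)"
  by (simp add: cnj_circle power_int_minus power_int_inverse)

lemma norm_powi_circle [simp]: "z \<in> circle \<Longrightarrow> cmod (z powi k) = 1"
  by (simp add: norm_power_int)

text \<open>On the circle the conjugate of z is its inverse, so Re z and Im z are trigonometric
  polynomials; these are closed under sums and products.\<close>

lemma real_polynomial_function_trig_poly:
  fixes f :: "complex \<Rightarrow> real"
  assumes "real_polynomial_function f"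
  shows "\<exists>xs. \<forall>z\<in>circle. of_real (f z) = trig_poly xs z"
  using assms
proof (induction rule: real_polynomial_function.induct)
  case (linear f)
  interpret bounded_linear f by fact
  have fz: "f z = Re z * f 1 + Im z * f \<i>" for z
  proof -
    have "z = Re z *\<^sub>R 1 + Im z *\<^sub>R \<i>" by (simp add: complex_eq_iff)
    then have "f z = f (Re z *\<^sub>R 1 + Im z *\<^sub>R \<i>)" by simp
    then show ?thesis by (simp only: add scaleR real_scaleR_def)
  qed
  show ?case
  proof (intro exI ballI)
    fix z :: complex assume z: "z \<in> circle"
    \<comment> \<open>A real-linear form is determined by its values at 1 and \<open>\<i>\<close>;
      the coefficients come from writing Re z and Im z through z and its conjugate.\<close>
    have "complex_of_real (f z) = (of_real (f 1) - \<i> * of_real (f \<i>)) / 2 * z + (of_real (f 1) + \<i> * of_real (f \<i>)) / 2 * cnj z"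
      by (subst fz) (simp add: complex_eq_iff field_simps)
    then show "complex_of_real (f z) =
        trig_poly [((of_real (f 1) - \<i> * of_real (f \<i>)) / 2, 1), ((of_real (f 1) + \<i> * of_real (f \<i>)) / 2, -1)] z"
      unfolding cnj_circle[OF z] by (simp add: power_int_minus)
  qed
next
  case (const c)
  show ?case by (rule exI[of _ "[(of_real c, 0)]"]) simp
next
  case (add f g)
  then obtain xs ys where "\<forall>z\<in>circle. of_real (f z) = trig_poly xs z" "\<forall>z\<in>circle. of_real (g z) = trig_poly ys z" by blast
  then show ?case by (intro exI[of _ "xs @ ys"]) (simp add: trig_poly_append)
next
  case (mult f g)
  then obtain xs ys where "\<forall>z\<in>circle. of_real (f z) = trig_poly xs z" "\<forall>z\<in>circle. of_real (g z) = trig_poly ys z" by blast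
  then show ?case
    by (intro exI[of _ "concat (map (\<lambda>(c, k). map (\<lambda>(d, l). (c * d, k + l)) ys) xs)"]) (simp add: trig_poly_mult)
qed

lemma trig_poly_approx:
  fixes g :: "complex \<Rightarrow> real"
  assumes "continuous_on circle g" "e > 0"
  obtains xs where "\<And>z. z \<in> circle \<Longrightarrow> cmod (of_real (g z) - trig_poly xs z) < e"
proof -
  obtain p where p: "polynomial_function p" "\<forall>z\<in>circle. norm (g z - p z) < e"
    using Stone_Weierstrass_polynomial_function[OF compact_sphere assms] by blast
  obtain xs where xs: "\<forall>z\<in>circle. of_real (p z) = trig_poly xs z"
    using real_polynomial_function_trig_poly p(1) real_polynomial_function_eq by metis
  have "cmod (of_real (g z) - trig_poly xs z) < e" if "z \<in> circle" for z
    using p(2) xs that by (metis norm_of_real of_real_diff real_norm_def)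
  then show ?thesis using that by blast
qed

section \<open>Finite measures on the circle and their Fourier coefficients\<close>

lemma space_circle_borel [simp]: "space circle_borel = circle"
  by (simp add: circle_borel_def space_restrict_space)

lemma sets_circle_borel_iff: "E \<in> sets circle_borel \<longleftrightarrow> E \<subseteq> circle \<and> E \<in> sets borel"
  unfolding circle_borel_def by (subst sets_restrict_space_iff) auto

definition fourier :: "complex measure \<Rightarrow> int \<Rightarrow> complex" where
  "fourier \<mu> k = (\<integral>z. z powi k \<partial>\<mu>)"

locale circle_measure = finite_measure \<mu> for \<mu> :: "complex measure" +
  assumes sets_eq: "sets \<mu> = sets circle_borel"
begin

lemma space_eq [simp]: "space \<mu> = circle"
  using sets_eq_imp_space_eq[OF sets_eq] by simp

lemma measurable_cong_circle: "measurable \<mu> N = measurable circle_borel N"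
  by (rule measurable_cong_sets[OF sets_eq refl])

lemma continuous_measurable: "continuous_on circle f \<Longrightarrow> f \<in> borel_measurable \<mu>"
  unfolding measurable_cong_circle circle_borel_def by (rule borel_measurable_continuous_on_restrict)

lemma powi_measurable [measurable]: "(\<lambda>z. z powi k) \<in> borel_measurable \<mu>"
  by (intro continuous_measurable continuous_intros) auto

lemma trig_poly_measurable [measurable]: "trig_poly xs \<in> borel_measurable \<mu>"
proof (induction xs)
  case (Cons x xs)
  obtain c k where x: "x = (c, k)" by (cases x)
  have "(\<lambda>z. c * z powi k + trig_poly xs z) \<in> borel_measurable \<mu>" using Cons by measurable
  then show ?case unfolding x by (simp add: trig_poly_simps(2)[abs_def])
qed (simp add: trig_poly_simps(1)[abs_def])

lemma bounded_integrable:
  fixes f :: "complex \<Rightarrow> 'b::{banach, second_countable_topology}"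
  assumes "f \<in> borel_measurable \<mu>" "\<And>z. z \<in> circle \<Longrightarrow> norm (f z) \<le> C"
  shows "integrable \<mu> f"
  by (rule integrable_const_bound[OF _ assms(1), of C]) (auto intro!: AE_I2 assms(2))

lemma powi_integrable: "integrable \<mu> (\<lambda>z. z powi k)"
  by (rule bounded_integrable[where C = 1]) auto

lemma trig_poly_bounded: "\<exists>C. \<forall>z\<in>circle. cmod (trig_poly xs z) \<le> C"
proof (induction xs)
  case (Cons x xs)
  obtain c k where x: "x = (c, k)" by (cases x)
  obtain C where C: "\<forall>z\<in>circle. cmod (trig_poly xs z) \<le> C" using Cons by blast
  have "cmod (trig_poly (x # xs) z) \<le> cmod c + C" if z: "z \<in> circle" for z
    using norm_triangle_ineq[of "c * z powi k" "trig_poly xs z"] bspec[OF C z] norm_powi_circle[OF z, of k]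
    by (simp add: x norm_mult)
  then show ?case by blast
qed auto

lemma trig_poly_integrable: "integrable \<mu> (trig_poly xs)"
proof -
  obtain C where "\<forall>z\<in>circle. cmod (trig_poly xs z) \<le> C" using trig_poly_bounded by blast
  then show ?thesis by (intro bounded_integrable[where C = C]) auto
qed

lemma integral_trig_poly: "(\<integral>z. trig_poly xs z \<partial>\<mu>) = (\<Sum>(c, k)\<leftarrow>xs. c * fourier \<mu> k)"
proof (induction xs)
  case (Cons x xs)
  obtain c k where x: "x = (c, k)" by (cases x)
  have "(\<integral>z. trig_poly (x # xs) z \<partial>\<mu>) = (\<integral>z. c * z powi k \<partial>\<mu>) + (\<integral>z. trig_poly xs z \<partial>\<mu>)"
    unfolding x trig_poly_simps by (intro Bochner_Integration.integral_add trig_poly_integrable integrable_mult_right powi_integrable)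
  then show ?case using Cons by (simp add: x fourier_def)
qed simp

lemma trig_poly_mult_cnj:
  "z \<in> circle \<Longrightarrow> trig_poly xs z * cnj (trig_poly ys z) = gram (\<lambda>k l. z powi (k - l)) xs ys"
proof -
  assume z: "z \<in> circle"
  have 1: "cnj (trig_poly ys z) = (\<Sum>(d, l)\<leftarrow>ys. cnj d * z powi (- l))"
    using z by (induction ys) (auto simp: cnj_powi_circle)
  have 2: "c * z powi k * (\<Sum>(d, l)\<leftarrow>ys. cnj d * z powi (- l)) = (\<Sum>(d, l)\<leftarrow>ys. c * cnj d * z powi (k - l))" for c k
    using z by (induction ys) (auto simp: algebra_simps power_int_diff power_int_minus divide_inverse)
  show ?thesis unfolding 1
    by (induction xs) (auto simp: gram_def distrib_right 2)
qed

lemma integral_gram: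
  "integrable \<mu> (\<lambda>z. gram (\<lambda>k l. z powi (k - l)) xs ys)"
  "(\<integral>z. gram (\<lambda>k l. z powi (k - l)) xs ys \<partial>\<mu>) = gram (\<lambda>k l. fourier \<mu> (k - l)) xs ys"
proof -
  have 1: "integrable \<mu> (\<lambda>z. \<Sum>(d, l)\<leftarrow>ys. c * cnj d * z powi (k - l)) \<and>
    (\<integral>z. (\<Sum>(d, l)\<leftarrow>ys. c * cnj d * z powi (k - l)) \<partial>\<mu>) = (\<Sum>(d, l)\<leftarrow>ys. c * cnj d * fourier \<mu> (k - l))" for c k
    by (induction ys) (auto simp: fourier_def powi_integrable)
  have "integrable \<mu> (\<lambda>z. gram (\<lambda>k l. z powi (k - l)) xs ys) \<and>
   (\<integral>z. gram (\<lambda>k l. z powi (k - l)) xs ys \<partial>\<mu>) = gram (\<lambda>k l. fourier \<mu> (k - l)) xs ys"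
    unfolding gram_def by (induction xs) (use 1 in auto)
  then show "integrable \<mu> (\<lambda>z. gram (\<lambda>k l. z powi (k - l)) xs ys)"
    "(\<integral>z. gram (\<lambda>k l. z powi (k - l)) xs ys \<partial>\<mu>) = gram (\<lambda>k l. fourier \<mu> (k - l)) xs ys" by auto
qed

lemma integral_trig_poly_mult_cnj:
  "(\<integral>z. trig_poly xs z * cnj (trig_poly ys z) \<partial>\<mu>) = gram (\<lambda>k l. fourier \<mu> (k - l)) xs ys"
  unfolding integral_gram(2)[symmetric]
  by (intro Bochner_Integration.integral_cong refl trig_poly_mult_cnj) simp

text \<open>The easy half of Herglotz's theorem: Fourier coefficients are positive definite because
  the form is the integral of a squared modulus.\<close>

lemma gram_fourier_self: "gram (\<lambda>k l. fourier \<mu> (k - l)) xs xs = of_real (\<integral>z. (cmod (trig_poly xs z))\<^sup>2 \<partial>\<mu>)"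
  unfolding integral_trig_poly_mult_cnj[symmetric] complex_norm_square[symmetric] by (rule integral_complex_of_real)

lemma fourier_zero: "fourier \<mu> 0 = of_real (measure \<mu> circle)"
  by (simp add: fourier_def scaleR_conv_of_real)

lemma cnj_fourier: "cnj (fourier \<mu> k) = fourier \<mu> (- k)"
proof -
  have "cnj (fourier \<mu> k) = (\<integral>z. cnj (z powi k) \<partial>\<mu>)" unfolding fourier_def by (rule Bochner_Integration.integral_cnj[symmetric])
  also have "\<dots> = fourier \<mu> (- k)" unfolding fourier_def
    by (intro Bochner_Integration.integral_cong refl) (simp add: cnj_powi_circle)
  finally show ?thesis .
qed

lemma compact_approx:
  assumes "E \<in> sets circle_borel" "e > 0"
  obtains K where "compact K" "K \<subseteq> E" "measure \<mu> (E - K) < e"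
proof -
  \<comment> \<open>Inner regularity is stated for measures on all Borel sets of the ambient space,
    so \<open>\<mu>\<close> is pushed forward along the inclusion of the circle.\<close>
  define M where "M = distr \<mu> borel (\<lambda>z. z)"
  have id: "(\<lambda>z. z) \<in> measurable \<mu> borel" by (intro continuous_measurable continuous_intros)
  have M: "emeasure M A = emeasure \<mu> (A \<inter> circle)" if "A \<in> sets borel" for A
    unfolding M_def using that by (subst emeasure_distr[OF id]) (auto simp: vimage_def Int_def)
  have E: "E \<subseteq> circle" "E \<in> sets borel" using assms(1) by (auto simp: sets_circle_borel_iff)
  have "emeasure M E = (SUP K\<in>{K. K \<subseteq> E \<and> compact K}. emeasure M K)"
  proof (rule inner_regular)
    show "sets M = sets borel" by (simp add: M_def)
    show "emeasure M (space M) \<noteq> \<infinity>" by (simp add: M_def emeasure_distr[OF id])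
  qed (rule E)
  moreover have "emeasure M E < emeasure M E + ennreal e"
    using assms(2) unfolding M[OF E(2)] emeasure_eq_measure
    by (simp add: ennreal_plus[symmetric] ennreal_less_iff del: ennreal_plus)
  ultimately have *: "emeasure M E < (SUP K\<in>{K. K \<subseteq> E \<and> compact K}. emeasure M K) + ennreal e"
    by simp
  have "\<exists>K. K \<subseteq> E \<and> compact K \<and> emeasure M E < emeasure M K + ennreal e"
  proof (rule ccontr)
    assume "\<not> ?thesis"
    then have "emeasure M K + ennreal e \<le> emeasure M E" if "K \<subseteq> E" "compact K" for K
      using that by (meson not_less)
    then have "(SUP K\<in>{K. K \<subseteq> E \<and> compact K}. emeasure M K + ennreal e) \<le> emeasure M E"
      by (intro SUP_least) auto
    moreover have "(SUP K\<in>{K. K \<subseteq> E \<and> compact K}. emeasure M K + ennreal e) =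
        (SUP K\<in>{K. K \<subseteq> E \<and> compact K}. emeasure M K) + ennreal e"
      by (rule ennreal_SUP_add_left) (use compact_empty in auto)
    ultimately show False using * by simp
  qed
  then obtain K where K: "K \<subseteq> E" "compact K" "emeasure M E < emeasure M K + ennreal e" by blast
  have Ks: "K \<in> sets \<mu>" "E \<in> sets \<mu>" using K E assms(1)
    by (auto simp: sets_eq sets_circle_borel_iff intro: borel_compact)
  have "emeasure \<mu> E < emeasure \<mu> K + ennreal e"
    using K(3) M[OF E(2)] M[OF borel_compact[OF K(2)]] E K(1) by (simp add: Int_absorb2)
  then have "measure \<mu> E < measure \<mu> K + e"
    using assms(2) by (simp add: emeasure_eq_measure ennreal_plus[symmetric] ennreal_less_iff del: ennreal_plus)
  then have "measure \<mu> (E - K) < e"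
    using finite_measure_Diff[OF Ks(2,1) K(1)] by simp
  then show ?thesis using that K by blast
qed

end

text \<open>A continuous cutoff, equal to 1 on \<open>K\<close> and, for n > 0, to 0 from distance 1
  / n on. As \<open>infdist z {}\<close> is 0, the cutoff of the empty set is constantly 1, which
  explains the nonemptiness assumptions below.\<close>

definition bump :: "complex set \<Rightarrow> nat \<Rightarrow> complex \<Rightarrow> real" where
  "bump K n z = max 0 (1 - real n * infdist z K)"

lemma bump_continuous: "continuous_on circle (bump K n)"
  unfolding bump_def by (intro continuous_intros)

lemma bump_bounds: "0 \<le> bump K n z" "bump K n z \<le> 1"
  by (auto simp: bump_def infdist_nonneg)

lemma bump_tendsto:
  assumes "closed K" "K \<noteq> {}"
  shows "(\<lambda>n. bump K n z) \<longlonglongrightarrow> indicator K z"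
proof (cases "z \<in> K")
  case True
  then show ?thesis by (simp add: bump_def)
next
  case False
  then have d: "infdist z K > 0"
    using in_closed_iff_infdist_zero[OF assms] infdist_nonneg[of z K] by (auto simp: less_le)
  obtain M where M: "1 < real M * infdist z K" using reals_Archimedean3[OF d] by blast
  have "bump K n z = 0" if "n \<ge> M" for n
  proof -
    have "real M * infdist z K \<le> real n * infdist z K" using that d by (intro mult_right_mono) auto
    then show ?thesis using M by (simp add: bump_def)
  qed
  then have "eventually (\<lambda>n. bump K n z = indicator K z) sequentially"
    using False by (auto simp: eventually_sequentially)
  then show ?thesis by (rule tendsto_eventually)
qed

context circle_measure
begin

lemma bump_measurable [measurable]: "bump K n \<in> borel_measurable \<mu>"
  by (intro continuous_measurable bump_continuous)

lemma bump_integral_tendsto: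
  assumes "compact K" "K \<noteq> {}" "K \<subseteq> circle"
  shows "(\<lambda>n. \<integral>z. bump K n z \<partial>\<mu>) \<longlonglongrightarrow> measure \<mu> K"
proof -
  have K: "K \<in> sets \<mu>" using assms by (auto simp: sets_eq sets_circle_borel_iff intro: borel_compact)
  have "(\<lambda>n. \<integral>z. bump K n z \<partial>\<mu>) \<longlonglongrightarrow> (\<integral>z. indicator K z \<partial>\<mu>)"
  proof (rule integral_dominated_convergence[where w = "\<lambda>_. 1"])
    show "AE z in \<mu>. (\<lambda>n. bump K n z) \<longlonglongrightarrow> indicator K z"
      using assms by (intro AE_I2 bump_tendsto compact_imp_closed)
    show "AE z in \<mu>. norm (bump K n z) \<le> 1" for n using bump_bounds by (intro AE_I2) auto
  qed (use K in auto)
  then show ?thesis using K sets.sets_into_space[OF K] by (simp add: Int_absorb1 Int_absorb2)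
qed

lemma bump_L2_tendsto:
  assumes "compact K" "K \<noteq> {}" "K \<subseteq> circle"
  shows "(\<lambda>n. \<integral>z. (bump K n z - indicator K z)\<^sup>2 \<partial>\<mu>) \<longlonglongrightarrow> 0"
proof -
  have K: "K \<in> sets \<mu>" using assms by (auto simp: sets_eq sets_circle_borel_iff intro: borel_compact)
  have "(\<lambda>n. \<integral>z. (bump K n z - indicator K z)\<^sup>2 \<partial>\<mu>) \<longlonglongrightarrow> (\<integral>z. 0 \<partial>\<mu>)"
  proof (rule integral_dominated_convergence[where w = "\<lambda>_. 1"])
    show "AE z in \<mu>. (\<lambda>n. (bump K n z - indicator K z)\<^sup>2) \<longlonglongrightarrow> 0"
    proof (intro AE_I2)
      fix z
      have "(\<lambda>n. (bump K n z - indicator K z)\<^sup>2) \<longlonglongrightarrow> (indicator K z - indicator K z)\<^sup>2"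
        using assms by (intro tendsto_intros bump_tendsto compact_imp_closed)
      then show "(\<lambda>n. (bump K n z - indicator K z)\<^sup>2) \<longlonglongrightarrow> 0" by simp
    qed
    show "AE z in \<mu>. norm ((bump K n z - indicator K z)\<^sup>2) \<le> 1" for n
      using bump_bounds[of K n] by (intro AE_I2) (auto simp: indicator_def abs_square_le_1 power2_commute)
  qed (use K in auto)
  then show ?thesis by simp
qed

text \<open>Three approximations in turn: \<open>E\<close> by a compact subset, its indicator by a
  continuous cutoff, and the cutoff uniformly by a trigonometric polynomial.\<close>

lemma indicator_approx:
  assumes E: "E \<in> sets circle_borel" and e: "e > 0"
  obtains xs where "(\<integral>z. (cmod (trig_poly xs z - indicator E z))\<^sup>2 \<partial>\<mu>) < e"
proof -
  define T where "T = measure \<mu> circle"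
  have E': "E \<in> sets \<mu>" using E sets_eq by simp
  have T: "T \<ge> 0" by (simp add: T_def)
  \<comment> \<open>The 9 is a factor 3 for the three errors times a factor 3 from (a + b + c)^2
    \<le> 3 (a^2 + b^2 + c^2).\<close>
  obtain K where K: "compact K" "K \<subseteq> E" "measure \<mu> (E - K) < e / 9"
    using compact_approx[OF E, of "e / 9"] e by auto
  have KC: "K \<subseteq> circle" using K(2) E by (auto simp: sets_circle_borel_iff)
  have K': "K \<in> sets \<mu>" using K KC by (auto simp: sets_eq sets_circle_borel_iff intro: borel_compact)
  obtain g :: "complex \<Rightarrow> real" where g: "continuous_on circle g" "\<And>z. 0 \<le> g z" "\<And>z. g z \<le> 1"
    "(\<integral>z. (g z - indicator K z)\<^sup>2 \<partial>\<mu>) < e / 9"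
  proof (cases "K = {}")
    case True
    show ?thesis by (rule that[of "\<lambda>_. 0"]) (use True e in auto)
  next
    case False
    have "eventually (\<lambda>n. (\<integral>z. (bump K n z - indicator K z)\<^sup>2 \<partial>\<mu>) < e / 9) sequentially"
      by (rule order_tendstoD(2)[OF bump_L2_tendsto[OF K(1) False KC]]) (use e in simp)
    then obtain n where "(\<integral>z. (bump K n z - indicator K z)\<^sup>2 \<partial>\<mu>) < e / 9"
      unfolding eventually_sequentially by blast
    then show ?thesis by (intro that[of "bump K n"] bump_continuous bump_bounds)
  qed
  define d where "d = sqrt (e / (9 * (T + 1)))"
  have d: "d > 0" using e T by (simp add: d_def)
  obtain xs where xs: "\<And>z. z \<in> circle \<Longrightarrow> cmod (of_real (g z) - trig_poly xs z) < d"
    using trig_poly_approx[OF g(1) d] by blast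
  have gm [measurable]: "g \<in> borel_measurable \<mu>" by (rule continuous_measurable[OF g(1)])
  note [measurable] = E' K'
  have bound: "(cmod (trig_poly xs z - indicator E z))\<^sup>2 \<le>
      3 * d\<^sup>2 + 3 * (g z - indicator K z)\<^sup>2 + 3 * indicator (E - K) z" if z: "z \<in> circle" for z
  proof -
    define a where "a = cmod (trig_poly xs z - of_real (g z))"
    define b where "b = \<bar>g z - indicator K z\<bar>"
    define c :: real where "c = indicator (E - K) z"
    have eq: "trig_poly xs z - indicator E z = (trig_poly xs z - of_real (g z)) + of_real (g z - indicator K z) - of_real c"
      using K(2) by (auto simp: c_def indicator_def)
    have "cmod (trig_poly xs z - indicator E z) \<le> a + b + \<bar>c\<bar>"
      unfolding eq a_def b_def
      by (rule order_trans[OF norm_triangle_ineq4]) (auto intro!: add_mono order_trans[OF norm_triangle_ineq] simp flip: of_real_diff)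
    then have "(cmod (trig_poly xs z - indicator E z))\<^sup>2 \<le> (a + b + \<bar>c\<bar>)\<^sup>2" by (intro power_mono) auto
    also have "\<dots> \<le> 3 * a\<^sup>2 + 3 * b\<^sup>2 + 3 * \<bar>c\<bar>\<^sup>2"
    proof -
      have "0 \<le> (a - b)\<^sup>2 + (b - \<bar>c\<bar>)\<^sup>2 + (a - \<bar>c\<bar>)\<^sup>2" by simp
      then show ?thesis by (simp add: power2_eq_square algebra_simps)
    qed
    also have "\<dots> \<le> 3 * d\<^sup>2 + 3 * (g z - indicator K z)\<^sup>2 + 3 * indicator (E - K) z"
      using xs[OF z] by (auto simp: a_def b_def c_def indicator_def norm_minus_commute intro!: power_mono)
    finally show ?thesis .
  qed
  have i1: "integrable \<mu> (\<lambda>z. (g z - indicator K z)\<^sup>2)"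
    by (rule bounded_integrable[where C = 1])
      (use g in \<open>auto simp: indicator_def abs_square_le_1 power2_commute\<close>)
  have i2: "integrable \<mu> (\<lambda>z. indicator (E - K) z :: real)"
    by (rule bounded_integrable[where C = 1]) (auto simp: indicator_def)
  have "(\<integral>z. (cmod (trig_poly xs z - indicator E z))\<^sup>2 \<partial>\<mu>) \<le>
      (\<integral>z. 3 * d\<^sup>2 + 3 * (g z - indicator K z)\<^sup>2 + 3 * indicator (E - K) z \<partial>\<mu>)"
  proof (rule integral_mono_AE')
    show "integrable \<mu> (\<lambda>z. 3 * d\<^sup>2 + 3 * (g z - indicator K z)\<^sup>2 + 3 * indicator (E - K) z)"
      using i1 i2 by auto
    show "AE z in \<mu>. (cmod (trig_poly xs z - indicator E z))\<^sup>2 \<le> 3 * d\<^sup>2 + 3 * (g z - indicator K z)\<^sup>2 + 3 * indicator (E - K) z"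
      using bound by (intro AE_I2) simp
  qed simp
  also have "\<dots> = 3 * d\<^sup>2 * T + 3 * (\<integral>z. (g z - indicator K z)\<^sup>2 \<partial>\<mu>) + 3 * measure \<mu> (E - K)"
    using i1 i2 sets.sets_into_space[of "E - K" \<mu>] by (simp add: T_def Int_absorb1 Int_absorb2)
  also have "3 * d\<^sup>2 * T \<le> e / 3"
    using e T by (simp add: d_def field_simps)
  finally have "(\<integral>z. (cmod (trig_poly xs z - indicator E z))\<^sup>2 \<partial>\<mu>) < e"
    using g(4) K(3) by linarith
  then show ?thesis by (rule that)
qed

end

text \<open>The uniqueness theorem for Fourier coefficients in additive form. The null measure as
  third measure gives ordinary uniqueness; the general case gives the splitting of a measure by a
  projection.\<close>

lemma measure_add_eqI_fourier:
  assumes "circle_measure \<mu>" "circle_measure \<nu>" "circle_measure \<nu>'"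
    and fourier: "\<And>k. fourier \<mu> k = fourier \<nu> k + fourier \<nu>' k"
    and E: "E \<in> sets circle_borel"
  shows "measure \<mu> E = measure \<nu> E + measure \<nu>' E"
proof -
  interpret m: circle_measure \<mu> by fact
  interpret n: circle_measure \<nu> by fact
  interpret n': circle_measure \<nu>' by fact
  have trig_poly: "(\<integral>z. trig_poly xs z \<partial>\<mu>) = (\<integral>z. trig_poly xs z \<partial>\<nu>) + (\<integral>z. trig_poly xs z \<partial>\<nu>')" for xs
    unfolding m.integral_trig_poly n.integral_trig_poly n'.integral_trig_poly fourier
    by (induction xs) (auto simp: algebra_simps)
  \<comment> \<open>Uniform approximation by a trigonometric polynomial changes each integral by at
    most the error times the total mass; \<open>T\<close> collects the three masses.\<close>
  have cont: "(\<integral>z. g z \<partial>\<mu>) = (\<integral>z. g z \<partial>\<nu>) + (\<integral>z. g z \<partial>\<nu>')" if g: "continuous_on circle g" for g :: "complex \<Rightarrow> real"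
  proof -
    define T where "T = measure \<mu> circle + measure \<nu> circle + measure \<nu>' circle"
    have T: "T \<ge> 0" by (simp add: T_def)
    have diff: "cmod (of_real (\<integral>z. g z \<partial>M) - (\<integral>z. trig_poly xs z \<partial>M)) \<le> e * measure M circle"
      if M: "circle_measure M" and xs: "\<And>z. z \<in> circle \<Longrightarrow> cmod (of_real (g z) - trig_poly xs z) < e" for M xs e
    proof -
      interpret M: circle_measure M by fact
      obtain C where "\<forall>z\<in>circle. norm (g z) \<le> C"
        using compact_imp_bounded[OF compact_continuous_image[OF g compact_sphere]] by (auto simp: bounded_iff)
      then have gi: "integrable M (\<lambda>z. complex_of_real (g z))"
        using M.continuous_measurable[OF g] by (intro M.bounded_integrable[where C = C]) auto
      have "of_real (\<integral>z. g z \<partial>M) - (\<integral>z. trig_poly xs z \<partial>M) = (\<integral>z. of_real (g z) - trig_poly xs z \<partial>M)"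
        using gi M.trig_poly_integrable[of xs] by simp
      also have "cmod \<dots> \<le> (\<integral>z. e \<partial>M)"
        using gi M.trig_poly_integrable[of xs] xs
        by (intro order_trans[OF integral_norm_bound] integral_mono) (auto intro: less_imp_le)
      finally show ?thesis by (simp add: mult.commute)
    qed
    have "\<bar>(\<integral>z. g z \<partial>\<mu>) - ((\<integral>z. g z \<partial>\<nu>) + (\<integral>z. g z \<partial>\<nu>'))\<bar> \<le> e" if "e > 0" for e
    proof -
      define d where "d = e / (T + 1)"
      have d: "d > 0" using T that by (simp add: d_def)
      obtain xs where xs: "\<And>z. z \<in> circle \<Longrightarrow> cmod (of_real (g z) - trig_poly xs z) < d" using trig_poly_approx[OF g d] by blast
      define A where "A = of_real (\<integral>z. g z \<partial>\<mu>) - (\<integral>z. trig_poly xs z \<partial>\<mu>)"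
      define B where "B = of_real (\<integral>z. g z \<partial>\<nu>) - (\<integral>z. trig_poly xs z \<partial>\<nu>)"
      define C where "C = of_real (\<integral>z. g z \<partial>\<nu>') - (\<integral>z. trig_poly xs z \<partial>\<nu>')"
      have "complex_of_real ((\<integral>z. g z \<partial>\<mu>) - ((\<integral>z. g z \<partial>\<nu>) + (\<integral>z. g z \<partial>\<nu>'))) = A - B - C"
        by (simp add: A_def B_def C_def trig_poly)
      then have "\<bar>(\<integral>z. g z \<partial>\<mu>) - ((\<integral>z. g z \<partial>\<nu>) + (\<integral>z. g z \<partial>\<nu>'))\<bar> = cmod (A - B - C)"
        by (metis norm_of_real)
      also have "\<dots> \<le> cmod A + cmod B + cmod C"
        using norm_triangle_ineq4[of "A - B" C] norm_triangle_ineq4[of A B] by linarith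
      also have "\<dots> \<le> d * T"
        using diff[OF assms(1) xs] diff[OF assms(2) xs] diff[OF assms(3) xs]
        by (simp add: A_def B_def C_def T_def algebra_simps)
      also have "\<dots> \<le> e" using T that by (simp add: d_def field_simps)
      finally show ?thesis .
    qed
    then show ?thesis using field_le_epsilon[of "\<bar>(\<integral>z. g z \<partial>\<mu>) - ((\<integral>z. g z \<partial>\<nu>) + (\<integral>z. g z \<partial>\<nu>'))\<bar>" 0] by simp
  qed
  \<comment> \<open>The continuous cutoffs of a compact set converge to its indicator, and dominated
    convergence carries the identity over.\<close>
  have comp: "measure \<mu> K = measure \<nu> K + measure \<nu>' K" if K: "compact K" "K \<subseteq> circle" for K
  proof (cases "K = {}")
    case False
    have "(\<lambda>n. \<integral>z. bump K n z \<partial>\<mu>) \<longlonglongrightarrow> measure \<nu> K + measure \<nu>' K"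
      unfolding cont[OF bump_continuous]
      by (intro tendsto_intros n.bump_integral_tendsto n'.bump_integral_tendsto K False)
    then show ?thesis using m.bump_integral_tendsto[OF K(1) False K(2)] LIMSEQ_unique by blast
  qed simp
  have EC: "E \<subseteq> circle" using E by (simp add: sets_circle_borel_iff)
  have small: "\<bar>measure M E - measure M K\<bar> \<le> e"
    if M: "circle_measure M" and K: "K' \<subseteq> K" "K \<subseteq> E" "compact K" "compact K'" "measure M (E - K') < e" for M K K' e
  proof -
    interpret M: circle_measure M by fact
    have s: "K \<in> sets M" "K' \<in> sets M" "E \<in> sets M" using K E EC
      by (auto simp: M.sets_eq sets_circle_borel_iff intro: borel_compact)
    have "measure M (E - K) \<le> measure M (E - K')" using s K by (intro M.finite_measure_mono) auto
    moreover have "measure M (E - K) = measure M E - measure M K" using s K by (intro M.finite_measure_Diff)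
    moreover have "0 \<le> measure M (E - K)" by simp
    ultimately show ?thesis using K(5) by linarith
  qed
  have "\<bar>measure \<mu> E - (measure \<nu> E + measure \<nu>' E)\<bar> \<le> e" if "e > 0" for e
  proof -
    have e3: "e / 3 > 0" using that by simp
    obtain K1 where K1: "compact K1" "K1 \<subseteq> E" "measure \<mu> (E - K1) < e / 3" using m.compact_approx[OF E e3] by blast
    obtain K2 where K2: "compact K2" "K2 \<subseteq> E" "measure \<nu> (E - K2) < e / 3" using n.compact_approx[OF E e3] by blast
    obtain K3 where K3: "compact K3" "K3 \<subseteq> E" "measure \<nu>' (E - K3) < e / 3" using n'.compact_approx[OF E e3] by blast
    \<comment> \<open>One compact subset of \<open>E\<close> that is close to \<open>E\<close> for
      all three measures at once.\<close>
    define K where "K = K1 \<union> K2 \<union> K3"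
    have K: "compact K" "K \<subseteq> E" "K1 \<subseteq> K" "K2 \<subseteq> K" "K3 \<subseteq> K" using K1 K2 K3 by (auto simp: K_def compact_Un)
    show ?thesis
      using small[OF assms(1) K(3,2,1) K1(1,3)] small[OF assms(2) K(4,2,1) K2(1,3)]
        small[OF assms(3) K(5,2,1) K3(1,3)] comp[OF K(1) order_trans[OF K(2) EC]] by linarith
  qed
  then show ?thesis using field_le_epsilon[of "\<bar>measure \<mu> E - (measure \<nu> E + measure \<nu>' E)\<bar>" 0] by simp
qed

lemma circle_measure_null: "circle_measure (null_measure circle_borel)"
proof -
  interpret finite_measure "null_measure circle_borel" by standard simp
  show ?thesis by standard simp
qed

lemma circle_measure_eqI_fourier:
  assumes "circle_measure \<mu>" "circle_measure \<nu>" "\<And>k. fourier \<mu> k = fourier \<nu> k"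
  shows "\<mu> = \<nu>"
proof (rule measure_eqI)
  interpret m: circle_measure \<mu> by fact
  interpret n: circle_measure \<nu> by fact
  show "sets \<mu> = sets \<nu>" by (simp add: m.sets_eq n.sets_eq)
  fix E assume "E \<in> sets \<mu>"
  then have "E \<in> sets circle_borel" by (simp add: m.sets_eq)
  moreover have "fourier (null_measure circle_borel) k = 0" for k by (simp add: fourier_def)
  ultimately have "measure \<mu> E = measure \<nu> E"
    using measure_add_eqI_fourier[OF assms(1,2) circle_measure_null] assms(3) by simp
  then show "emeasure \<mu> E = emeasure \<nu> E" by (simp add: m.emeasure_eq_measure n.emeasure_eq_measure)
qed

section \<open>Herglotz's theorem\<close>

lemma cis_integral:
  fixes k :: int
  shows "has_bochner_integral lborel (\<lambda>t. indicator {0..1} t *\<^sub>R cis (2 * pi * of_int k * t)) (if k = 0 then 1 else 0)"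
proof (cases "k = 0")
  case True
  have "has_bochner_integral lborel (indicator {0..1::real}) (measure lborel {0..1::real})"
    by (rule has_bochner_integral_real_indicator) simp_all
  from has_bochner_integral_scaleR_left[where c = "1::complex", OF this]
  have "has_bochner_integral lborel (\<lambda>t::real. indicator {0..1} t *\<^sub>R (1::complex)) 1" by simp
  then show ?thesis using True by simp
next
  case False
  define w where "w = 2 * pi * of_int k"
  have w: "w \<noteq> 0" using False by (simp add: w_def)
  have der: "((\<lambda>t. cis (w * t) / (\<i> * of_real w)) has_vector_derivative cis (w * t)) (at t within S)" for t S
  proof -
    have "((\<lambda>z. exp (\<i> * of_real w * z) / (\<i> * of_real w)) has_field_derivative exp (\<i> * of_real w * of_real t)) (at (of_real t))"
      using w by (auto intro!: derivative_eq_intros)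
    from has_vector_derivative_real_field[OF this]
    have "((\<lambda>t. exp (\<i> * of_real w * of_real t) / (\<i> * of_real w)) has_vector_derivative
        exp (\<i> * of_real w * of_real t)) (at t within S)" .
    then show ?thesis using w by (simp add: cis_conv_exp mult_ac)
  qed
  have "has_bochner_integral lborel (\<lambda>t. indicator {0..1} t *\<^sub>R cis (w * t))
      (cis (w * 1) / (\<i> * of_real w) - cis (w * 0) / (\<i> * of_real w))"
    by (rule has_bochner_integral_FTC_Icc[where F = "\<lambda>t. cis (w * t) / (\<i> * of_real w)"])
      (auto intro!: der continuous_intros)
  moreover have "cis (w * 1) = 1" unfolding w_def by (simp add: cis_multiple_2pi)
  ultimately show ?thesis using False by (simp add: w_def)
qed

lemma cis_2pi_measurable: "(\<lambda>t::real. cis (2 * pi * t)) \<in> borel \<rightarrow>\<^sub>M circle_borel"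
proof -
  have "(\<lambda>t::real. cis (2 * pi * t)) \<in> borel_measurable borel"
    by (intro borel_measurable_continuous_onI continuous_intros)
  then show ?thesis unfolding circle_borel_def by (intro measurable_restrict_space2) auto
qed

lemma powi_measurable_circle: "(\<lambda>z. z powi k) \<in> borel_measurable circle_borel"
  unfolding circle_borel_def
  by (intro borel_measurable_continuous_on_restrict continuous_intros) auto

lemma fourier_distr_cis:
  assumes "sets M = sets borel"
  shows "fourier (distr M circle_borel (\<lambda>t. cis (2 * pi * t))) k = (\<integral>t. cis (2 * pi * of_int k * t) \<partial>M)"
proof -
  have "(\<lambda>t::real. cis (2 * pi * t)) \<in> M \<rightarrow>\<^sub>M circle_borel"
    using cis_2pi_measurable measurable_cong_sets[OF assms refl] by blast
  then show ?thesis unfolding fourier_def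
    by (subst integral_distr[OF _ powi_measurable_circle]) (simp_all add: cis_power_int mult_ac)
qed

lemma circle_measure_distr_cis:
  assumes "prob_space M" "sets M = sets borel"
  shows "circle_measure (distr M circle_borel (\<lambda>t. cis (2 * pi * t)))"
    "prob_space (distr M circle_borel (\<lambda>t. cis (2 * pi * t)))"
proof -
  have m: "(\<lambda>t::real. cis (2 * pi * t)) \<in> M \<rightarrow>\<^sub>M circle_borel"
    using cis_2pi_measurable measurable_cong_sets[OF assms(2) refl] by blast
  show p: "prob_space (distr M circle_borel (\<lambda>t. cis (2 * pi * t)))"
    by (rule prob_space.prob_space_distr[OF assms(1) m])
  interpret prob_space "distr M circle_borel (\<lambda>t. cis (2 * pi * t))" by (rule p)
  show "circle_measure (distr M circle_borel (\<lambda>t. cis (2 * pi * t)))" by unfold_locales simp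
qed

lemma circle_measure_lebesgue: "circle_measure circle_lebesgue"
proof -
  interpret prob_space circle_lebesgue by (rule prob_space_circle_lebesgue)
  show ?thesis by unfold_locales (simp add: circle_lebesgue_def)
qed

lemma fourier_lebesgue: "fourier circle_lebesgue k = (if k = 0 then 1 else 0)"
proof -
  have "uniform_measure lborel {0..<1::real} = density lborel (\<lambda>t. ennreal (indicator {0..<1} t))"
    unfolding uniform_measure_def by (intro density_cong) (auto simp: indicator_def divide_ennreal_def)
  then have "fourier circle_lebesgue k = (\<integral>t. cis (2 * pi * of_int k * t) \<partial>density lborel (\<lambda>t. ennreal (indicator {0..<1} t)))"
    unfolding circle_lebesgue_def by (subst fourier_distr_cis) simp_all
  also have "\<dots> = (\<integral>t. indicator {0..<1} t *\<^sub>R cis (2 * pi * of_int k * t) \<partial>lborel)"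
    by (intro integral_density) (auto intro!: borel_measurable_continuous_onI continuous_intros)
  \<comment> \<open>Normalized Lebesgue measure is defined on the half-open interval, while
    \<open>cis_integral\<close> uses the closed one; they differ by the null set {1}.\<close>
  also have "\<dots> = (\<integral>t. indicator {0..1} t *\<^sub>R cis (2 * pi * of_int k * t) \<partial>lborel)"
  proof (rule integral_cong_AE)
    have c: "(\<lambda>t. cis (2 * pi * of_int k * t)) \<in> borel_measurable borel"
      by (intro borel_measurable_continuous_onI continuous_intros)
    show "(\<lambda>t. indicator {0..<1} t *\<^sub>R cis (2 * pi * of_int k * t)) \<in> borel_measurable lborel"
      "(\<lambda>t. indicator {0..1} t *\<^sub>R cis (2 * pi * of_int k * t)) \<in> borel_measurable lborel"
      using c by auto
    show "AE t in lborel. indicator {0..<1} t *\<^sub>R cis (2 * pi * of_int k * t) = indicator {0..1} t *\<^sub>R cis (2 * pi * of_int k * t)"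
      using AE_lborel_singleton[of "1::real"] by eventually_elim (auto simp: indicator_def)
  qed
  also have "\<dots> = (if k = 0 then 1 else 0)"
    by (rule has_bochner_integral_integral_eq[OF cis_integral])
  finally show ?thesis .
qed

text \<open>Divided by n + 1, this count is the Fejer weight of the k-th coefficient;
  \<open>nat\<close> truncates it to zero for large \<open>k\<close>.\<close>

lemma card_diff_eq:
  "card {(j, l). j \<in> {0..int n} \<and> l \<in> {0..int n} \<and> j - l = k} = nat (int n + 1 - \<bar>k\<bar>)"
proof -
  have "bij_betw (\<lambda>l. (l + k, l)) {max 0 (- k)..min (int n) (int n - k)}
      {(j, l). j \<in> {0..int n} \<and> l \<in> {0..int n} \<and> j - l = k}"
    by (rule bij_betwI[where g = snd]) (auto simp: max_def min_def split: if_splits)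
  from bij_betw_same_card[OF this]
  have "card {(j, l). j \<in> {0..int n} \<and> l \<in> {0..int n} \<and> j - l = k} = card {max 0 (- k)..min (int n) (int n - k)}"
    by simp
  then show ?thesis by (simp add: max_def min_def) (auto simp: abs_if)
qed

text \<open>The Fejer means are densities of probability measures on [0, 1], hence a tight family on
  the line. A weak limit of a subsequence, wrapped around the circle, has the prescribed
  coefficients.\<close>

lemma herglotz_prob:
  fixes \<phi> :: "int \<Rightarrow> complex"
  assumes "psd_kernel (\<lambda>k l. \<phi> (k - l))" and one: "\<phi> 0 = 1"
  obtains \<mu> where "circle_measure \<mu>" "prob_space \<mu>" "\<And>k. fourier \<mu> k = \<phi> k"
proof -
  interpret psd_kernel "\<lambda>k l. \<phi> (k - l)" by fact
  define I where "I n = {0..int n}" for n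
  \<comment> \<open>With these phases at the indices 0, ..., n the form becomes the double sum of
    \<phi>(j - l) e^(2 pi i (l - j) t), which is n + 1 times a Fejer mean.\<close>
  define xs where "xs n t = map (\<lambda>j. (cis (- 2 * pi * of_int j * t), j)) [0..int n]" for n t
  \<comment> \<open>The Fejer means of the Fourier series with coefficients \<open>\<phi>\<close>: positive definiteness makes
    them nonnegative, and their Fourier coefficients tend to \<open>\<phi>\<close>.\<close>
  define D where "D n t = Re (B (xs n t) (xs n t)) / real (Suc n)" for n t
  have B_eq: "B (xs n t) (xs n t) = (\<Sum>j\<in>I n. \<Sum>l\<in>I n. \<phi> (j - l) * cis (2 * pi * of_int (l - j) * t))" for n t
    by (simp add: gram_def xs_def o_def sum_list_distinct_conv_sum_set I_def cis_cnj cis_mult mult_ac)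
      (simp add: algebra_simps)
  have D_eq: "of_real (D n t) = (\<Sum>j\<in>I n. \<Sum>l\<in>I n. \<phi> (j - l) * cis (2 * pi * of_int (l - j) * t)) / of_nat (Suc n)" for n t
    unfolding B_eq[symmetric] D_def using B_self[of "xs n t"] by (simp add: N_sq)
  have D_nonneg: "0 \<le> D n t" for n t by (simp add: D_def psd)
  have D_meas [measurable]: "D n \<in> borel_measurable borel" for n
  proof -
    have "D n = (\<lambda>t. Re ((\<Sum>j\<in>I n. \<Sum>l\<in>I n. \<phi> (j - l) * cis (2 * pi * of_int (l - j) * t)) / of_nat (Suc n)))"
      by (rule ext) (metis D_eq Re_complex_of_real)
    also have "\<dots> \<in> borel_measurable borel"
      by (intro borel_measurable_continuous_onI continuous_intros) (simp del: of_nat_Suc)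
    finally show ?thesis .
  qed
  \<comment> \<open>Only the pairs with j - l = k survive integration, and
    \<open>card_diff_eq\<close> counts them.\<close>
  have moment: "has_bochner_integral lborel (\<lambda>t. (indicator {0..1} t * D n t) *\<^sub>R cis (2 * pi * of_int k * t))
      (of_nat (nat (int n + 1 - \<bar>k\<bar>)) / of_nat (Suc n) * \<phi> k)" for n k
  proof -
    have "has_bochner_integral lborel
       (\<lambda>t. (\<Sum>j\<in>I n. \<Sum>l\<in>I n. \<phi> (j - l) * (indicator {0..1} t *\<^sub>R cis (2 * pi * of_int (l - j + k) * t))) / of_nat (Suc n))
       ((\<Sum>j\<in>I n. \<Sum>l\<in>I n. \<phi> (j - l) * (if l - j + k = 0 then 1 else 0)) / of_nat (Suc n))"
      by (intro has_bochner_integral_divide_zero has_bochner_integral_sum has_bochner_integral_mult_right cis_integral)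
    moreover have "(\<Sum>j\<in>I n. \<Sum>l\<in>I n. \<phi> (j - l) * (indicator {0..1} t *\<^sub>R cis (2 * pi * of_int (l - j + k) * t))) / of_nat (Suc n)
       = (indicator {0..1} t * D n t) *\<^sub>R cis (2 * pi * of_int k * t)" for t :: real
    proof -
      have "cis (2 * pi * of_int (l - j + k) * t) = cis (2 * pi * of_int (l - j) * t) * cis (2 * pi * of_int k * t)" for j l
        by (simp add: cis_mult algebra_simps)
      then show ?thesis
        by (simp add: scaleR_conv_of_real D_eq sum_distrib_left sum_distrib_right sum_divide_distrib mult_ac)
    qed
    moreover have "(\<Sum>j\<in>I n. \<Sum>l\<in>I n. \<phi> (j - l) * (if l - j + k = 0 then 1 else 0)) = of_nat (nat (int n + 1 - \<bar>k\<bar>)) * \<phi> k"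
    proof -
      have "(\<Sum>j\<in>I n. \<Sum>l\<in>I n. \<phi> (j - l) * (if l - j + k = 0 then 1 else 0)) =
          (\<Sum>(j, l)\<in>I n \<times> I n. if j - l = k then \<phi> k else 0)"
        by (subst sum.cartesian_product) (rule sum.cong, auto)
      also have "\<dots> = (\<Sum>(j, l)\<in>{(j, l). j \<in> I n \<and> l \<in> I n \<and> j - l = k}. \<phi> k)"
        by (rule sum.mono_neutral_cong_right) (auto simp: I_def split: if_splits)
      also have "\<dots> = of_nat (card {(j, l). j \<in> I n \<and> l \<in> I n \<and> j - l = k}) * \<phi> k"
        by (simp add: split_def)
      finally show ?thesis unfolding I_def card_diff_eq .
    qed
    ultimately show ?thesis by simp
  qed
  define M where "M n = density lborel (\<lambda>t. ennreal (indicator {0..1} t * D n t))" for n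
  have M_sets [simp]: "sets (M n) = sets borel" for n by (simp add: M_def)
  have M_int: "(\<integral>t. cis (2 * pi * of_int k * t) \<partial>M n) = of_nat (nat (int n + 1 - \<bar>k\<bar>)) / of_nat (Suc n) * \<phi> k" for n k
  proof -
    have "(\<integral>t. cis (2 * pi * of_int k * t) \<partial>M n) = (\<integral>t. (indicator {0..1} t * D n t) *\<^sub>R cis (2 * pi * of_int k * t) \<partial>lborel)"
      unfolding M_def by (rule integral_density)
        (auto intro!: borel_measurable_continuous_onI continuous_intros AE_I2 mult_nonneg_nonneg D_nonneg)
    then show ?thesis using has_bochner_integral_integral_eq[OF moment] by simp
  qed
  have M_prob: "prob_space (M n)" for n
  proof
    have "has_bochner_integral lborel (\<lambda>t. complex_of_real (indicator {0..1} t * D n t)) (of_real 1)"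
    proof -
      have "nat (int n + 1 - \<bar>0\<bar>) = Suc n" by simp
      then have "of_nat (nat (int n + 1 - \<bar>0\<bar>)) / of_nat (Suc n) * \<phi> 0 = (1::complex)"
        by (simp only: one) (simp del: of_nat_Suc)
      then show ?thesis using moment[of n 0] by (simp add: scaleR_conv_of_real)
    qed
    then have *: "has_bochner_integral lborel (\<lambda>t. indicator {0..1} t * D n t) 1"
      unfolding has_bochner_integral_iff complex_of_real_integrable_eq integral_complex_of_real
      by (simp only: of_real_eq_iff)
    have "emeasure (M n) (space (M n)) = (\<integral>\<^sup>+t. ennreal (indicator {0..1} t * D n t) \<partial>lborel)"
      unfolding M_def by (subst emeasure_density) (auto intro!: nn_integral_cong)
    also have "\<dots> = ennreal (\<integral>t. indicator {0..1} t * D n t \<partial>lborel)"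
      using * unfolding has_bochner_integral_iff
      by (intro nn_integral_eq_integral) (auto intro!: AE_I2 mult_nonneg_nonneg D_nonneg)
    also have "\<dots> = 1" using * by (simp add: has_bochner_integral_iff)
    finally show "emeasure (M n) (space (M n)) = 1" .
  qed
  have M_real: "real_distribution (M n)" for n
    using M_prob by (simp add: real_distribution_def real_distribution_axioms_def)
  have "tight M"
    unfolding tight_def
  proof (intro conjI allI impI M_real)
    fix e :: real assume e: "e > 0"
    \<comment> \<open>Tightness is tested on intervals open on the left; starting at -1 keeps the
      point 0 inside.\<close>
    have "measure (M n) {-1<..1} = 1" for n
    proof -
      interpret prob_space "M n" by (rule M_prob)
      have "AE t in M n. t \<in> {-1<..1}"
        unfolding M_def by (subst AE_density) (auto simp: indicator_def)
      then show ?thesis by (subst prob_eq_1) auto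
    qed
    then show "\<exists>a b. a < b \<and> (\<forall>n. measure (M n) {a<..b} > 1 - e)"
      using e by (intro exI[of _ "-1"] exI[of _ 1]) auto
  qed
  from tight_imp_convergent_subsubsequence[OF this strict_mono_id]
  obtain r M' where r: "strict_mono r" and M': "real_distribution M'" and wc: "weak_conv_m (\<lambda>n. M (r n)) M'"
    by (auto simp: o_def)
  interpret M': real_distribution M' by (rule M')
  have M'_int: "(\<integral>t. cis (2 * pi * of_int k * t) \<partial>M') = \<phi> k" for k
  proof (rule LIMSEQ_unique)
    show "(\<lambda>n. \<integral>t. cis (2 * pi * of_int k * t) \<partial>M (r n)) \<longlonglongrightarrow> (\<integral>t. cis (2 * pi * of_int k * t) \<partial>M')"
    proof (rule weak_conv_imp_integral_bdd_continuous_conv[OF M_real M' wc, where B = 1])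
      have "continuous_on UNIV (\<lambda>t. cis (2 * pi * real_of_int k * t))" by (intro continuous_intros)
      then show "isCont (\<lambda>t. cis (2 * pi * real_of_int k * t)) x" for x
        by (simp add: continuous_on_eq_continuous_at)
    qed simp
    have "(\<lambda>n. of_real (real (nat (int n + 1 - \<bar>k\<bar>)) / real (Suc n)) * \<phi> k) \<longlonglongrightarrow> of_real 1 * \<phi> k"
    proof (intro tendsto_intros)
      have 1: "(\<lambda>n. 1 - \<bar>real_of_int k\<bar> * inverse (real (Suc n))) \<longlonglongrightarrow> 1 - \<bar>real_of_int k\<bar> * 0"
        by (intro tendsto_intros LIMSEQ_inverse_real_of_nat)
      have "eventually (\<lambda>n. 1 - \<bar>real_of_int k\<bar> * inverse (real (Suc n)) = real (nat (int n + 1 - \<bar>k\<bar>)) / real (Suc n)) sequentially"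
        unfolding eventually_sequentially
      proof (intro exI allI impI)
        fix n assume "nat \<bar>k\<bar> \<le> n"
        then have "real (nat (int n + 1 - \<bar>k\<bar>)) = real (Suc n) - \<bar>real_of_int k\<bar>" by (simp add: of_nat_nat)
        then show "1 - \<bar>real_of_int k\<bar> * inverse (real (Suc n)) = real (nat (int n + 1 - \<bar>k\<bar>)) / real (Suc n)"
          by (simp add: field_simps)
      qed
      from Lim_transform_eventually[OF 1 this]
      show "(\<lambda>n. real (nat (int n + 1 - \<bar>k\<bar>)) / real (Suc n)) \<longlonglongrightarrow> 1" by simp
    qed
    from LIMSEQ_subseq_LIMSEQ[OF this r]
    show "(\<lambda>n. \<integral>t. cis (2 * pi * of_int k * t) \<partial>M (r n)) \<longlonglongrightarrow> \<phi> k"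
      unfolding M_int by (simp add: o_def)
  qed
  show ?thesis
  proof (rule that[of "distr M' circle_borel (\<lambda>t. cis (2 * pi * t))"])
    show "circle_measure (distr M' circle_borel (\<lambda>t. cis (2 * pi * t)))"
      "prob_space (distr M' circle_borel (\<lambda>t. cis (2 * pi * t)))"
      by (intro circle_measure_distr_cis M'.prob_space_axioms M'.events_eq_borel)+
    show "fourier (distr M' circle_borel (\<lambda>t. cis (2 * pi * t))) k = \<phi> k" for k
      by (simp add: fourier_distr_cis M'_int)
  qed
qed

lemma gram_scale_kernel: "gram (\<lambda>k l. c * K k l) xs ys = c * gram K xs ys"
  by (simp add: gram_def split_def mult_ac flip: sum_list_const_mult)

text \<open>Normalize by the value at 0 and rescale the measure afterwards. If that value is zero,
  Cauchy-Schwarz makes all of \<phi> vanish and the null measure serves.\<close>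

theorem herglotz:
  fixes \<phi> :: "int \<Rightarrow> complex"
  assumes K: "psd_kernel (\<lambda>k l. \<phi> (k - l))"
  obtains \<mu> where "circle_measure \<mu>" "\<And>k. fourier \<mu> k = \<phi> k"
proof -
  interpret psd_kernel "\<lambda>k l. \<phi> (k - l)" by fact
  have N1: "(N [(1, k)])\<^sup>2 = Re (\<phi> 0)" for k by (simp add: N_sq gram_def)
  have phi0: "\<phi> 0 = of_real (Re (\<phi> 0))" using B_self[of "[(1, 0)]"] N1[of 0] by (simp add: gram_def)
  have nn: "Re (\<phi> 0) \<ge> 0" using N1[of 0] by (metis zero_le_power2)
  show ?thesis
  proof (cases "Re (\<phi> 0) = 0")
    case True
    have "\<phi> k = 0" for k
      using B_Cauchy_Schwarz[of "[(1, k)]" "[(1, 0)]"] N1[of 0] True by (simp add: gram_def)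
    then show ?thesis
      by (intro that[OF circle_measure_null]) (simp add: fourier_def)
  next
    case False
    define r where "r = Re (\<phi> 0)"
    have r: "r > 0" using False nn by (simp add: r_def)
    have "psd_kernel (\<lambda>k l. of_real (1 / r) * \<phi> (k - l))"
    proof
      show "of_real (1 / r) * \<phi> (j - i) = cnj (of_real (1 / r) * \<phi> (i - j))" for i j
        using hermitian[of j i] by simp
      show "0 \<le> Re (gram (\<lambda>k l. of_real (1 / r) * \<phi> (k - l)) xs xs)" for xs
        using psd[of xs] r unfolding gram_scale_kernel by simp
    qed
    moreover have "of_real (1 / r) * \<phi> 0 = 1" 
      using r by (subst phi0) (simp add: r_def[symmetric])
    ultimately obtain \<mu> where \<mu>: "circle_measure \<mu>" "\<And>k. fourier \<mu> k = of_real (1 / r) * \<phi> k"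
      using herglotz_prob[of "\<lambda>k. of_real (1 / r) * \<phi> k"] by blast
    interpret circle_measure \<mu> by fact
    define \<nu> where "\<nu> = density \<mu> (\<lambda>_. ennreal r)"
    have "emeasure \<nu> (space \<nu>) \<noteq> \<infinity>"
      using sets.top[of \<mu>]
      by (simp add: \<nu>_def emeasure_density_const ennreal_mult_eq_top_iff emeasure_eq_measure)
    then interpret n: finite_measure \<nu> by (rule finite_measureI)
    have "circle_measure \<nu>" by unfold_locales (simp add: \<nu>_def sets_eq)
    moreover have "fourier \<nu> k = \<phi> k" for k
    proof -
      have "fourier \<nu> k = (\<integral>z. r *\<^sub>R z powi k \<partial>\<mu>)"
        unfolding \<nu>_def fourier_def using r by (intro integral_density) auto
      also have "\<dots> = of_real r * fourier \<mu> k" by (simp add: fourier_def scaleR_conv_of_real)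
      finally show ?thesis using r \<mu>(2) by simp
    qed
    ultimately show ?thesis by (rule that)
  qed
qed

section \<open>Invariant and ergodic measures\<close>

text \<open>By uniqueness of Fourier coefficients this is invariance under z^n for finite measures
  of any mass, in a form that can be read off from the matrix coefficients of fixed vectors.\<close>

definition fourier_invariant :: "nat \<Rightarrow> complex measure \<Rightarrow> bool" where
  "fourier_invariant n \<mu> \<longleftrightarrow> (\<forall>k. fourier \<mu> (int n * k) = fourier \<mu> k)"

lemma fourier_invariant_mult: "fourier_invariant m \<mu> \<Longrightarrow> fourier_invariant n \<mu> \<Longrightarrow> fourier_invariant (m * n) \<mu>"
  by (simp add: fourier_invariant_def mult.assoc)

lemma fourier_invariant_power: "fourier_invariant n \<mu> \<Longrightarrow> fourier_invariant (n ^ i) \<mu>"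
  by (induction i) (auto simp: fourier_invariant_mult, simp add: fourier_invariant_def)

lemma power_measurable_circle: "(\<lambda>z. z ^ n) \<in> circle_borel \<rightarrow>\<^sub>M circle_borel"
proof -
  have "(\<lambda>z::complex. z ^ n) \<in> borel_measurable circle_borel"
    unfolding circle_borel_def by (intro borel_measurable_continuous_on_restrict continuous_intros)
  then show ?thesis
    by (subst (2) circle_borel_def) (intro measurable_restrict_space2, auto simp: norm_power)
qed

lemma circle_diff_finite: "finite F \<Longrightarrow> circle - F \<in> sets circle_borel"
  unfolding sets_circle_borel_iff
  by (intro conjI Diff_subset sets.Diff borel_closed closed_sphere finite_imp_closed)

lemma circle_preimage_measurable [measurable]:
  assumes "E \<in> sets circle_borel" shows "circle_preimage n E \<in> sets circle_borel"
proof -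
  have "circle_preimage n E = (\<lambda>z. z ^ n) -` E \<inter> space circle_borel"
    by (auto simp: circle_preimage_def)
  then show ?thesis using measurable_sets[OF power_measurable_circle assms] by simp
qed

context circle_measure
begin

lemma measure_eq_0_AE_iff: "A \<in> sets circle_borel \<Longrightarrow> measure \<mu> A = 0 \<longleftrightarrow> (AE z in \<mu>. z \<notin> A)"
  by (subst AE_iff_null_sets[symmetric]) (auto simp: sets_eq null_sets_def emeasure_eq_measure)

lemma power_measurable: "(\<lambda>z. z ^ n) \<in> \<mu> \<rightarrow>\<^sub>M circle_borel"
  using power_measurable_circle measurable_cong_circle by blast

lemma circle_measure_distr_power: "circle_measure (distr \<mu> circle_borel (\<lambda>z. z ^ n))"
proof -
  interpret d: finite_measure "distr \<mu> circle_borel (\<lambda>z. z ^ n)"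
    by (rule finite_measure_distr[OF power_measurable])
  show ?thesis by unfold_locales simp
qed

lemma fourier_distr_power: "fourier (distr \<mu> circle_borel (\<lambda>z. z ^ n)) k = fourier \<mu> (int n * k)"
proof -
  have "(\<lambda>z. z powi k) \<in> borel_measurable circle_borel"
    using powi_measurable measurable_cong_circle by blast
  then have "fourier (distr \<mu> circle_borel (\<lambda>z. z ^ n)) k = (\<integral>z. (z ^ n) powi k \<partial>\<mu>)"
    unfolding fourier_def by (rule integral_distr[OF power_measurable])
  also have "\<dots> = fourier \<mu> (int n * k)"
    unfolding fourier_def by (simp add: power_int_mult)
  finally show ?thesis .
qed

lemma measure_distr_power:
  assumes "E \<in> sets circle_borel"
  shows "measure (distr \<mu> circle_borel (\<lambda>z. z ^ n)) E = measure \<mu> (circle_preimage n E)"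
proof -
  have "circle_preimage n E = (\<lambda>z. z ^ n) -` E \<inter> space \<mu>" by (auto simp: circle_preimage_def)
  then show ?thesis using measure_distr[OF power_measurable assms] by simp
qed

lemma fourier_invariant_distr: "fourier_invariant n \<mu> \<Longrightarrow> distr \<mu> circle_borel (\<lambda>z. z ^ n) = \<mu>"
  by (rule circle_measure_eqI_fourier[OF circle_measure_distr_power circle_measure_axioms])
    (simp add: fourier_distr_power fourier_invariant_def)

lemma fourier_invariant_measure:
  "fourier_invariant n \<mu> \<Longrightarrow> E \<in> sets circle_borel \<Longrightarrow> measure \<mu> (circle_preimage n E) = measure \<mu> E"
  using measure_distr_power fourier_invariant_distr by metis

lemma fourier_invariantI:
  assumes "\<And>E. E \<in> sets circle_borel \<Longrightarrow> measure \<mu> (circle_preimage n E) = measure \<mu> E"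
  shows "fourier_invariant n \<mu>"
proof -
  interpret d: circle_measure "distr \<mu> circle_borel (\<lambda>z. z ^ n)" by (rule circle_measure_distr_power)
  have "distr \<mu> circle_borel (\<lambda>z. z ^ n) = \<mu>"
  proof (rule measure_eqI)
    fix A assume "A \<in> sets (distr \<mu> circle_borel (\<lambda>z. z ^ n))"
    then have "A \<in> sets circle_borel" by simp
    then show "emeasure (distr \<mu> circle_borel (\<lambda>z. z ^ n)) A = emeasure \<mu> A"
      by (simp add: d.emeasure_eq_measure emeasure_eq_measure measure_distr_power assms)
  qed (simp add: sets_eq)
  then show ?thesis using fourier_distr_power[of n] by (simp add: fourier_invariant_def)
qed

lemma fourier_invariant_AE:
  assumes "fourier_invariant n \<mu>" "AE z in \<mu>. P z"
  shows "AE z in \<mu>. P (z ^ n)"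
proof -
  have "AE z in distr \<mu> circle_borel (\<lambda>z. z ^ n). P z"
    using assms(2) unfolding fourier_invariant_distr[OF assms(1)] .
  then show ?thesis by (rule AE_distrD[OF power_measurable])
qed

end

lemma circle_measure_invariant:
  assumes "invariant_prob p q \<mu>"
  shows "circle_measure \<mu>" "prob_space \<mu>" "fourier_invariant p \<mu>" "fourier_invariant q \<mu>"
proof -
  show p: "prob_space \<mu>" using assms by (simp add: invariant_prob_def)
  interpret prob_space \<mu> by (rule p)
  show c: "circle_measure \<mu>" by unfold_locales (use assms in \<open>simp add: invariant_prob_def\<close>)
  show "fourier_invariant p \<mu>" "fourier_invariant q \<mu>"
    using assms by (auto simp: invariant_prob_def intro!: circle_measure.fourier_invariantI[OF c])
qed

lemma invariant_probI:
  assumes "circle_measure \<mu>" "prob_space \<mu>" "fourier_invariant p \<mu>" "fourier_invariant q \<mu>"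
  shows "invariant_prob p q \<mu>"
  using assms circle_measure.sets_eq[OF assms(1)] circle_measure.fourier_invariant_measure[OF assms(1)]
  by (auto simp: invariant_prob_def)

locale ergodic_measure = prob_space \<mu> + circle_measure \<mu>
  for p q :: nat and \<mu> :: "complex measure" +
  assumes ergodic: "ergodic_prob p q \<mu>"
begin

lemma inv_p: "fourier_invariant p \<mu>" and inv_q: "fourier_invariant q \<mu>"
  using circle_measure_invariant ergodic by (auto simp: ergodic_prob_def)

text \<open>Ergodicity speaks of strictly invariant sets only. The sets that arise from densities
  are invariant up to null sets, so each is replaced by a strictly invariant set of the same
  measure.\<close>

lemma AE_invariant_trivial:
  assumes B: "B \<in> sets circle_borel"
    and Bp: "AE z in \<mu>. z ^ p \<in> B \<longleftrightarrow> z \<in> B" and Bq: "AE z in \<mu>. z ^ q \<in> B \<longleftrightarrow> z \<in> B"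
  shows "measure \<mu> B \<in> {0, 1}"
proof -
  \<comment> \<open>The strictly invariant set of the points whose orbit is eventually in \<open>B\<close>.\<close>
  define E where "E = (\<Union>M. \<Inter>m\<in>{M..}. \<Inter>n\<in>{M..}. circle_preimage (p ^ m * q ^ n) B)"
  have E_iff: "z \<in> E \<longleftrightarrow> z \<in> circle \<and> (\<exists>M. \<forall>m\<ge>M. \<forall>n\<ge>M. z ^ (p ^ m * q ^ n) \<in> B)" for z
    unfolding E_def circle_preimage_def by auto
  have E: "E \<in> sets circle_borel"
    unfolding E_def using B by (intro sets.countable_UN' sets.countable_INT' circle_preimage_measurable) auto
  have circ: "z ^ n \<in> circle" if "z \<in> circle" for z :: complex and n using that by (simp add: norm_power)
  have "circle_preimage p E = E"
  proof (rule Set.set_eqI)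
    fix z
    have "(\<exists>M. \<forall>m\<ge>M. \<forall>n\<ge>M. z ^ (p ^ Suc m * q ^ n) \<in> B) \<longleftrightarrow> (\<exists>M. \<forall>m\<ge>M. \<forall>n\<ge>M. z ^ (p ^ m * q ^ n) \<in> B)"
    proof (intro iffI; elim exE)
      fix M assume M: "\<forall>m\<ge>M. \<forall>n\<ge>M. z ^ (p ^ Suc m * q ^ n) \<in> B"
      have "z ^ (p ^ m * q ^ n) \<in> B" if "m \<ge> Suc M" "n \<ge> Suc M" for m n
        using M[rule_format, of "m - 1" n] that by simp
      then show "\<exists>M. \<forall>m\<ge>M. \<forall>n\<ge>M. z ^ (p ^ m * q ^ n) \<in> B" by blast
    next
      fix M assume M: "\<forall>m\<ge>M. \<forall>n\<ge>M. z ^ (p ^ m * q ^ n) \<in> B"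
      then show "\<exists>M. \<forall>m\<ge>M. \<forall>n\<ge>M. z ^ (p ^ Suc m * q ^ n) \<in> B" by (metis le_SucI)
    qed
    then show "z \<in> circle_preimage p E \<longleftrightarrow> z \<in> E"
      unfolding circle_preimage_def E_iff using circ by (auto simp: mult.assoc simp flip: power_mult)
  qed
  moreover have "circle_preimage q E = E"
  proof (rule Set.set_eqI)
    fix z
    have "(\<exists>M. \<forall>m\<ge>M. \<forall>n\<ge>M. z ^ (p ^ m * q ^ Suc n) \<in> B) \<longleftrightarrow> (\<exists>M. \<forall>m\<ge>M. \<forall>n\<ge>M. z ^ (p ^ m * q ^ n) \<in> B)"
    proof (intro iffI; elim exE)
      fix M assume M: "\<forall>m\<ge>M. \<forall>n\<ge>M. z ^ (p ^ m * q ^ Suc n) \<in> B"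
      have "z ^ (p ^ m * q ^ n) \<in> B" if "m \<ge> Suc M" "n \<ge> Suc M" for m n
        using M[rule_format, of m "n - 1"] that by simp
      then show "\<exists>M. \<forall>m\<ge>M. \<forall>n\<ge>M. z ^ (p ^ m * q ^ n) \<in> B" by blast
    next
      fix M assume M: "\<forall>m\<ge>M. \<forall>n\<ge>M. z ^ (p ^ m * q ^ n) \<in> B"
      then show "\<exists>M. \<forall>m\<ge>M. \<forall>n\<ge>M. z ^ (p ^ m * q ^ Suc n) \<in> B" by (metis le_SucI)
    qed
    then show "z \<in> circle_preimage q E \<longleftrightarrow> z \<in> E"
      unfolding circle_preimage_def E_iff using circ by (auto simp: mult_ac simp flip: power_mult)
  qed
  ultimately have "measure \<mu> E \<in> {0, 1}" using ergodic E by (simp add: ergodic_prob_def)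
  moreover have "measure \<mu> E = measure \<mu> B"
  proof -
    \<comment> \<open>The exceptional null set for the exponent \<open>r\<close> is pulled back
      along z^N, which keeps it null because \<mu> is invariant.\<close>
    have step: "AE z in \<mu>. z ^ (N * r) \<in> B \<longleftrightarrow> z \<in> B"
      if "fourier_invariant N \<mu>" "AE z in \<mu>. z ^ N \<in> B \<longleftrightarrow> z \<in> B" "AE z in \<mu>. z ^ r \<in> B \<longleftrightarrow> z \<in> B" for N r
      using fourier_invariant_AE[OF that(1,3)] that(2) by eventually_elim (simp add: power_mult)
    have "AE z in \<mu>. z ^ (p ^ m) \<in> B \<longleftrightarrow> z \<in> B" for m
    proof (induction m)
      case (Suc m)
      then show ?case using step[OF fourier_invariant_power[OF inv_p] Suc Bp] by (simp add: mult.commute)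
    qed simp
    then have "AE z in \<mu>. z ^ (p ^ m * q ^ n) \<in> B \<longleftrightarrow> z \<in> B" for m n
    proof (induction n)
      case (Suc n)
      then show ?case
        using step[OF fourier_invariant_mult[OF fourier_invariant_power[OF inv_p] fourier_invariant_power[OF inv_q]] _ Bq, of m n]
        by (simp add: mult_ac)
    qed simp
    then have "AE z in \<mu>. \<forall>m n. z ^ (p ^ m * q ^ n) \<in> B \<longleftrightarrow> z \<in> B" by (simp add: AE_all_countable)
    then have "AE z in \<mu>. z \<in> E \<longleftrightarrow> z \<in> B"
      using AE_space by eventually_elim (auto simp: E_iff)
    then show ?thesis using E B by (intro finite_measure_eq_AE) (auto simp: sets_eq)
  qed
  ultimately show ?thesis by simp
qed

text \<open>Ergodic measures are extreme among the invariant ones. The set where the density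
  \<open>D\<close> exceeds its mean is invariant up to null sets, hence trivial; then
  \<open>D\<close> minus its mean has one sign almost everywhere and integral zero.\<close>

lemma dominated_proportional:
  assumes "circle_measure \<nu>" "fourier_invariant p \<nu>" "fourier_invariant q \<nu>"
    and le: "\<And>E. E \<in> sets circle_borel \<Longrightarrow> measure \<nu> E \<le> measure \<mu> E"
  shows "fourier \<nu> k = of_real (measure \<nu> circle) * fourier \<mu> k"
proof -
  interpret n: circle_measure \<nu> by fact
  have "absolutely_continuous \<mu> \<nu>"
    unfolding absolutely_continuous_def
  proof
    fix N assume N: "N \<in> null_sets \<mu>"
    then have "measure \<nu> N \<le> 0" using le[of N] by (auto simp: null_sets_def sets_eq measure_def)
    then show "N \<in> null_sets \<nu>" using N
      by (simp add: null_sets_def sets_eq n.sets_eq n.emeasure_eq_measure measure_le_0_iff)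
  qed
  moreover have "sets \<nu> = sets \<mu>" by (simp add: sets_eq n.sets_eq)
  ultimately obtain D where D: "D \<in> borel_measurable \<mu>" "AE x in \<mu>. RN_deriv \<mu> \<nu> x = ennreal (D x)" "\<And>x. 0 \<le> D x"
    and RN: "density \<mu> (RN_deriv \<mu> \<nu>) = \<nu>"
    using real_RN_deriv[OF n.finite_measure_axioms] density_RN_deriv by blast
  note [measurable] = D(1)
  have dens: "\<nu> = density \<mu> (\<lambda>x. ennreal (D x))"
    using D(2) by (subst RN[symmetric]) (intro density_cong, auto)
  have Dint: "integrable \<mu> D"
  proof (rule integrableI_nn_integral_finite[where x = "measure \<nu> circle"])
    have "(\<integral>\<^sup>+x. ennreal (D x) \<partial>\<mu>) = emeasure (density \<mu> (\<lambda>x. ennreal (D x))) (space \<mu>)"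
      using sets.top[of \<mu>] by (subst emeasure_density) (auto intro!: nn_integral_cong)
    then show "(\<integral>\<^sup>+x. ennreal (D x) \<partial>\<mu>) = ennreal (measure \<nu> circle)"
      unfolding dens[symmetric] by (simp add: n.emeasure_eq_measure)
  qed (auto simp: D)
  have meas: "measure \<nu> A = (\<integral>x. D x * indicator A x \<partial>\<mu>)" if A: "A \<in> sets circle_borel" for A
  proof -
    have [measurable]: "A \<in> sets \<mu>" using A by (simp add: sets_eq)
    have "measure \<nu> A = (\<integral>x. indicator A x \<partial>\<nu>)"
      using A n.sets_eq sets.sets_into_space[OF A] by (simp add: Int_absorb2)
    also have "\<dots> = (\<integral>x. D x *\<^sub>R indicator A x \<partial>\<mu>)"
      unfolding dens by (intro integral_density) (auto simp: D)
    finally show ?thesis by simp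
  qed
  \<comment> \<open>The mean of \<open>D\<close>, since \<mu> is a probability measure.\<close>
  define c where "c = measure \<nu> circle"
  define B where "B = {z \<in> circle. D z > c}"
  have B: "B \<in> sets circle_borel"
  proof -
    have "B = {z \<in> space \<mu>. c < D z}" by (simp add: B_def)
    also have "\<dots> \<in> sets \<mu>" by measurable
    finally show ?thesis by (simp add: sets_eq)
  qed
  have diff: "measure \<nu> A - c * measure \<mu> A = (\<integral>x. (D x - c) * indicator A x \<partial>\<mu>)"
    and int: "integrable \<mu> (\<lambda>x. (D x - c) * indicator A x)" if A: "A \<in> sets circle_borel" for A
  proof -
    have A' [measurable]: "A \<in> sets \<mu>" using A by (simp add: sets_eq)
    have i: "integrable \<mu> (\<lambda>x. D x * indicator A x)"
      using integrable_mult_indicator[OF A' Dint] by (simp add: mult.commute)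
    have "integrable \<mu> (\<lambda>x. c * indicator A x)" by (intro integrable_mult_right) (simp add: less_top[symmetric])
    moreover have "(\<integral>x. c * indicator A x \<partial>\<mu>) = c * measure \<mu> A"
      using sets.sets_into_space[OF A'] by (simp add: Int_absorb2)
    ultimately show "measure \<nu> A - c * measure \<mu> A = (\<integral>x. (D x - c) * indicator A x \<partial>\<mu>)"
      "integrable \<mu> (\<lambda>x. (D x - c) * indicator A x)"
      unfolding meas[OF A] left_diff_distrib using i by (simp_all only: Bochner_Integration.integral_diff Bochner_Integration.integrable_diff)
  qed
  \<comment> \<open>Let \<open>C\<close> be the preimage of \<open>B\<close>. By invariance \<open>B - C\<close> and \<open>C - B\<close> have equal measure under both
    \<open>\<mu>\<close> and \<open>\<nu>\<close>, but \<open>\<nu> - c \<mu>\<close> is positive on the former unless it is null, and at most zero on the latter.\<close>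
  have inv: "AE z in \<mu>. z ^ r \<in> B \<longleftrightarrow> z \<in> B" if r: "fourier_invariant r \<mu>" "fourier_invariant r \<nu>" for r
  proof -
    define C where "C = circle_preimage r B"
    have C: "C \<in> sets circle_borel" unfolding C_def using B by measurable
    have s [simp]: "B \<in> sets \<mu>" "C \<in> sets \<mu>" "B \<in> sets \<nu>" "C \<in> sets \<nu>" using B C by (simp_all add: sets_eq n.sets_eq)
    have m1: "measure \<mu> (B - C) = measure \<mu> (C - B)"
      using fourier_invariant_measure[OF r(1) B] finite_measure_Diff'[of B C] finite_measure_Diff'[of C B]
      by (simp add: C_def[symmetric] Int_commute)
    have m2: "measure \<nu> (B - C) = measure \<nu> (C - B)"
      using n.fourier_invariant_measure[OF r(2) B] n.finite_measure_Diff'[of B C] n.finite_measure_Diff'[of C B]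
      by (simp add: C_def[symmetric] Int_commute)
    have BC: "B - C \<in> sets circle_borel" "C - B \<in> sets circle_borel" using B C by auto
    have "(\<integral>x. (D x - c) * indicator (C - B) x \<partial>\<mu>) \<le> (\<integral>x. 0 \<partial>\<mu>)"
      by (rule integral_mono[OF int[OF BC(2)]]) (auto simp: B_def indicator_def)
    then have "(\<integral>x. (D x - c) * indicator (B - C) x \<partial>\<mu>) \<le> 0"
      using diff[OF BC(1)] diff[OF BC(2)] m1 m2 by simp
    moreover have nn: "AE x in \<mu>. 0 \<le> (D x - c) * indicator (B - C) x"
      by (intro AE_I2) (auto simp: B_def indicator_def)
    ultimately have "(\<integral>x. (D x - c) * indicator (B - C) x \<partial>\<mu>) = 0"
      using integral_nonneg_AE[OF nn] by linarith
    then have "AE x in \<mu>. (D x - c) * indicator (B - C) x = 0"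
      using integral_nonneg_eq_0_iff_AE[OF int[OF BC(1)] nn] by blast
    then have 1: "AE x in \<mu>. x \<notin> B - C"
      by eventually_elim (auto simp: B_def indicator_def split: if_splits)
    then have "measure \<mu> (B - C) = 0"
      using BC(1) by (subst measure_eq_0_AE_iff) (auto simp: sets_eq)
    then have "measure \<mu> (C - B) = 0" using m1 by simp
    then have "AE x in \<mu>. x \<notin> C - B"
      using BC(2) by (subst (asm) measure_eq_0_AE_iff) (auto simp: sets_eq)
    then show ?thesis using 1 AE_space by eventually_elim (auto simp: C_def circle_preimage_def)
  qed
  have B01: "measure \<mu> B = 0 \<or> measure \<mu> B = 1"
    using AE_invariant_trivial[OF B inv[OF inv_p assms(2)] inv[OF inv_q assms(3)]] by simp
  have zero: "(\<integral>x. D x - c \<partial>\<mu>) = 0"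
  proof -
    have "(\<integral>x. D x - c \<partial>\<mu>) = (\<integral>x. (D x - c) * indicator circle x \<partial>\<mu>)"
      by (intro Bochner_Integration.integral_cong) auto
    also have "\<dots> = measure \<nu> circle - c * measure \<mu> circle"
      by (rule diff[symmetric]) (use sets.top[of circle_borel] in simp)
    also have "\<dots> = 0" using prob_space by (simp add: c_def)
    finally show ?thesis .
  qed
  have i: "integrable \<mu> (\<lambda>x. D x - c)" using Dint by simp
  from B01 have "AE x in \<mu>. D x = c"
  proof
    assume "measure \<mu> B = 0"
    then have "AE x in \<mu>. x \<notin> B" using B by (subst (asm) measure_eq_0_AE_iff) (auto simp: sets_eq)
    then have nn: "AE x in \<mu>. 0 \<le> c - D x" using AE_space by eventually_elim (auto simp: B_def)
    have i': "integrable \<mu> (\<lambda>x. c - D x)" using Dint by simp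
    have "(\<integral>x. c - D x \<partial>\<mu>) = 0" using zero Dint by simp
    then have "AE x in \<mu>. c - D x = 0" using integral_nonneg_eq_0_iff_AE[OF i' nn] by blast
    then show ?thesis by eventually_elim simp
  next
    assume "measure \<mu> B = 1"
    then have "AE x in \<mu>. x \<in> B" using B by (simp add: prob_eq_1 sets_eq)
    then have nn: "AE x in \<mu>. 0 \<le> D x - c" by eventually_elim (simp add: B_def)
    have "AE x in \<mu>. D x - c = 0" using integral_nonneg_eq_0_iff_AE[OF i nn] zero by blast
    then show ?thesis by eventually_elim simp
  qed
  then have "(\<integral>z. D z *\<^sub>R z powi k \<partial>\<mu>) = (\<integral>z. c *\<^sub>R z powi k \<partial>\<mu>)"
    by (intro integral_cong_AE) auto
  moreover have "fourier \<nu> k = (\<integral>z. D z *\<^sub>R z powi k \<partial>\<mu>)"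
    unfolding fourier_def dens by (intro integral_density) (auto simp: D)
  ultimately show ?thesis by (simp add: fourier_def c_def scaleR_conv_of_real)
qed

end

text \<open>By invariance the point z^p has at least the mass of z. The forward orbit of an atom
  thus stays among finitely many atoms, and every atom is a root of unity.\<close>

lemma finitely_supported_imp_fourier_one:
  assumes inv: "invariant_prob p q \<mu>" and p: "p > 1" and fin: "finitely_supported \<mu>"
  shows "\<exists>k::int. k \<noteq> 0 \<and> fourier \<mu> k = 1"
proof -
  interpret prob_space \<mu> using circle_measure_invariant[OF inv] by blast
  interpret circle_measure \<mu> using circle_measure_invariant[OF inv] by blast
  have ip: "fourier_invariant p \<mu>" using circle_measure_invariant[OF inv] by blast
  obtain F where F: "finite F" "F \<subseteq> circle" "measure \<mu> (circle - F) = 0"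
    using fin by (auto simp: finitely_supported_def)
  have sing: "{z} \<in> sets circle_borel" if "z \<in> circle" for z using that by (simp add: sets_circle_borel_iff)
  \<comment> \<open>A finite supporting set may also contain points of mass zero, about which
    invariance says nothing; only the atoms are kept.\<close>
  define A where "A = {z \<in> F. measure \<mu> {z} > 0}"
  have AF: "finite A" "A \<subseteq> circle" using F by (auto simp: A_def)
  have pow: "z ^ (p ^ i) \<in> A" if z: "z \<in> A" for z i
  proof -
    have zc: "z \<in> circle" and z0: "measure \<mu> {z} > 0" using z F by (auto simp: A_def)
    have wc: "z ^ (p ^ i) \<in> circle" using zc by (simp add: norm_power)
    have "measure \<mu> {z} \<le> measure \<mu> (circle_preimage (p ^ i) {z ^ (p ^ i)})"
      using zc wc circle_preimage_measurable[OF sing[OF wc]]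
      by (intro finite_measure_mono) (auto simp: circle_preimage_def sets_eq)
    also have "\<dots> = measure \<mu> {z ^ (p ^ i)}"
      by (rule fourier_invariant_measure[OF fourier_invariant_power[OF ip] sing[OF wc]])
    finally have pos: "measure \<mu> {z ^ (p ^ i)} > 0" using z0 by linarith
    have "z ^ (p ^ i) \<in> F"
    proof (rule ccontr)
      assume "z ^ (p ^ i) \<notin> F"
      moreover have "circle - F \<in> sets \<mu>"
        using F by (simp add: sets_eq circle_diff_finite)
      ultimately have "measure \<mu> {z ^ (p ^ i)} \<le> measure \<mu> (circle - F)"
        using wc by (intro finite_measure_mono) auto
      then show False using pos F(3) by linarith
    qed
    then show ?thesis using pos by (simp add: A_def)
  qed
  have "\<exists>n>0. z ^ n = 1" if z: "z \<in> A" for z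
  proof -
    \<comment> \<open>Pigeonhole: two powers in the orbit of z coincide, so z is a root of
      unity.\<close>
    have "\<not> inj (\<lambda>i. z ^ (p ^ i))"
      using pow[OF z] AF(1) by (meson finite_imageD finite_subset image_subsetI infinite_UNIV_nat)
    then obtain i j where ij: "i < j" "z ^ (p ^ i) = z ^ (p ^ j)"
      by (metis injI linorder_neqE_nat)
    have le: "p ^ i < p ^ j" using p ij(1) by simp
    have "z ^ (p ^ i) * z ^ (p ^ j - p ^ i) = z ^ (p ^ i)"
      using ij(2) le by (subst power_add[symmetric]) simp
    moreover have "z \<noteq> 0" using z AF(2) by auto
    ultimately have "z ^ (p ^ j - p ^ i) = 1" by simp
    then show ?thesis using le by (intro exI[of _ "p ^ j - p ^ i"]) simp
  qed
  then obtain n where n: "\<And>z. z \<in> A \<Longrightarrow> n z > 0" "\<And>z. z \<in> A \<Longrightarrow> z ^ n z = 1" by metis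
  \<comment> \<open>A common multiple of the orders, so that z^k = 1 at every atom.\<close>
  define k where "k = (\<Prod>z\<in>A. n z)"
  have k: "k > 0" using n by (auto simp: k_def intro!: prod_pos)
  have zk: "z ^ k = 1" if "z \<in> A" for z
  proof -
    have "n z dvd k" unfolding k_def using that AF(1) by (intro dvd_prodI)
    then obtain l where "k = n z * l" by (auto simp: dvd_def)
    then show ?thesis using n(2)[OF that] by (simp add: power_mult)
  qed
  have "AE z in \<mu>. z \<notin> circle - F"
    using F by (subst measure_eq_0_AE_iff[symmetric]) (auto simp: sets_eq circle_diff_finite)
  moreover have "AE z in \<mu>. z \<notin> F - A"
  proof -
    have "AE z in \<mu>. \<forall>w\<in>F - A. z \<noteq> w"
    proof (rule AE_finite_allI)
      fix w assume w: "w \<in> F - A"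
      then have "measure \<mu> {w} = 0" using measure_nonneg[of \<mu> "{w}"] by (auto simp: A_def less_le)
      then have "AE z in \<mu>. z \<notin> {w}" using w F sing[of w]
        by (subst measure_eq_0_AE_iff[symmetric]) (auto simp: sets_eq)
      then show "AE z in \<mu>. z \<noteq> w" by simp
    qed (use F in simp)
    then show ?thesis by eventually_elim auto
  qed
  ultimately have "AE z in \<mu>. z powi int k = 1"
    using AE_space by eventually_elim (use zk in auto)
  then have "fourier \<mu> (int k) = (\<integral>z. 1 \<partial>\<mu>)"
    unfolding fourier_def by (intro integral_cong_AE powi_measurable) simp_all
  also have "\<dots> = 1" using prob_space by simp
  finally show ?thesis using k by (intro exI[of _ "int k"]) simp
qed

text \<open>The function 1 - Re z^k is nonnegative on the circle and has integral zero; hence almost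
  every point is a root of z^k = 1.\<close>

lemma fourier_one_imp_finitely_supported:
  assumes "circle_measure \<mu>" "prob_space \<mu>" and k: "k \<noteq> 0" "fourier \<mu> k = 1"
  shows "finitely_supported \<mu>"
proof -
  interpret prob_space \<mu> by fact
  interpret circle_measure \<mu> by fact
  have i: "integrable \<mu> (\<lambda>z. Re (1 - z powi k))" using powi_integrable by (intro integrable_Re) auto
  have nn: "AE z in \<mu>. 0 \<le> Re (1 - z powi k)"
  proof (rule AE_I2)
    fix z assume "z \<in> space \<mu>"
    then show "0 \<le> Re (1 - z powi k)" using complex_Re_le_cmod[of "z powi k"] by simp
  qed
  have "(\<integral>z. Re (1 - z powi k) \<partial>\<mu>) = Re (\<integral>z. 1 - z powi k \<partial>\<mu>)"
    using powi_integrable by (intro integral_Re) auto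
  also have "\<dots> = 0" using k prob_space powi_integrable[of k] by (simp add: fourier_def)
  finally have "AE z in \<mu>. Re (1 - z powi k) = 0"
    using integral_nonneg_eq_0_iff_AE[OF i nn] by blast
  then have AE: "AE z in \<mu>. z \<notin> circle - {z \<in> circle. z powi k = 1}"
  proof eventually_elim
    case (elim z)
    show ?case
    proof
      assume "z \<in> circle - {z \<in> circle. z powi k = 1}"
      then have z: "z \<in> circle" "z powi k \<noteq> 1" by auto
      have "(Re (z powi k))\<^sup>2 + (Im (z powi k))\<^sup>2 = 1"
        using norm_powi_circle[OF z(1), of k] by (metis cmod_power2 one_power2)
      then have "Im (z powi k) = 0" using elim by simp
      then have "z powi k = 1" using elim by (simp add: complex_eq_iff)
      then show False using z by simp
    qed
  qed
  define F where "F = {z \<in> circle. z powi k = 1}"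
  have "F \<subseteq> {z. z ^ nat \<bar>k\<bar> = 1}"
    using k by (auto simp: F_def power_int_def abs_if power_inverse split: if_splits)
  then have F: "finite F"
    by (rule finite_subset) (rule finite_roots_unity, use k in simp)
  have "measure \<mu> (circle - F) = 0"
    using AE unfolding measure_eq_0_AE_iff[OF circle_diff_finite[OF F]] by (simp only: F_def)
  then show ?thesis using F by (auto simp: finitely_supported_def F_def)
qed

section \<open>Representations of the semidirect product\<close>

locale pq =
  fixes p q :: nat
  assumes p: "p > 1" and q: "q > 1"
begin

abbreviation G :: "rat set" where "G \<equiv> carrier (Z_inv (p * q))"
abbreviation \<Gamma> :: "(rat \<times> int \<times> int) monoid" where "\<Gamma> \<equiv> furstenberg_group p q"

text \<open>The affine action of the semidirect product on the rationals. It restricts to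
  \<open>G\<close>, which as a set with this action is the coset space modulo
  \<open>\<int>^2\<close>; this is why it indexes the orbit of a fixed vector.\<close>

definition act :: "rat \<times> int \<times> int \<Rightarrow> rat \<Rightarrow> rat" where
  "act g k = fst g + Z2_action p q (snd g) k"

lemma pq_pos: "p > 0" "q > 0" "p * q > 0" using p q by auto

lemma group_\<Gamma>: "group \<Gamma>" by (rule group_furstenberg_group[OF pq_pos(1,2)])

lemma G_int [simp]: "of_int a \<in> G" by (rule Z_invI[of _ a _ 0]) simp
lemma G_zero [simp]: "0 \<in> G" using G_int[of 0] by simp
lemma G_add: "k \<in> G \<Longrightarrow> l \<in> G \<Longrightarrow> k + l \<in> G" by (rule Z_inv_closed(1)[OF _ _ pq_pos(3)])
lemma G_diff: "k \<in> G \<Longrightarrow> l \<in> G \<Longrightarrow> k - l \<in> G" using G_add[of k "- l"] Z_inv_uminus[of l] by simp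
lemma G_Z2: "k \<in> G \<Longrightarrow> Z2_action p q h k \<in> G" by (rule Z2_action_closed[OF pq_pos(1,2)])

lemma Z2_action_diff: "Z2_action p q h (k - l) = Z2_action p q h k - Z2_action p q h l"
  by (simp add: Z2_action_def split_def algebra_simps)

lemma Z2_action_zero [simp]: "Z2_action p q h 0 = 0" by (simp add: Z2_action_def split_def)

lemma Z2_action_id [simp]: "Z2_action p q (0, 0) k = k" by (simp add: Z2_action_def)

lemma Z2_action_cancel:
  "Z2_action p q (m, n) (Z2_action p q (- m, - n) k) = k"
  "Z2_action p q (- m, - n) (Z2_action p q (m, n) k) = k"
  by (simp_all flip: Z2_action_add[OF pq_pos(1,2)])

lemma G_Z2_iff: "Z2_action p q h k \<in> G \<longleftrightarrow> k \<in> G"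
proof
  obtain m n where h: "h = (m, n)" by (cases h)
  assume "Z2_action p q h k \<in> G"
  then have "Z2_action p q (- m, - n) (Z2_action p q (m, n) k) \<in> G" unfolding h by (rule G_Z2)
  then show "k \<in> G" by (simp add: Z2_action_cancel)
qed (rule G_Z2)

lemma \<Gamma>_carrier: "g \<in> carrier \<Gamma> \<longleftrightarrow> fst g \<in> G"
  by (cases g) (simp add: furstenberg_group_simps)

lemma zpow_\<Gamma> [simp]: "zpow k \<in> carrier \<Gamma> \<longleftrightarrow> k \<in> G" by (simp add: \<Gamma>_carrier zpow_def)

lemma Z2_\<Gamma> [simp]: "(0, h) \<in> carrier \<Gamma>" by (simp add: \<Gamma>_carrier)

lemma \<Gamma>_mult: "g \<otimes>\<^bsub>\<Gamma>\<^esub> h = (act g (fst h), (fst (snd g) + fst (snd h), snd (snd g) + snd (snd h)))"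
  by (cases g; cases h) (auto simp: furstenberg_group_simps act_def)

lemma act_in_iff: "g \<in> carrier \<Gamma> \<Longrightarrow> act g k \<in> G \<longleftrightarrow> k \<in> G"
proof -
  assume g: "g \<in> carrier \<Gamma>"
  have "act g k \<in> G \<longleftrightarrow> Z2_action p q (snd g) k \<in> G"
    using g G_add[of "fst g"] G_diff[of "act g k" "fst g"] by (auto simp: act_def \<Gamma>_carrier)
  then show ?thesis by (simp add: G_Z2_iff)
qed

lemma act_mult: "act (g \<otimes>\<^bsub>\<Gamma>\<^esub> h) k = act g (act h k)"
  by (cases g; cases h)
    (simp add: \<Gamma>_mult act_def Z2_action_add[OF pq_pos(1,2)] Z2_action_distrib)

lemma act_diff: "act g k - act g l = Z2_action p q (snd g) (k - l)"
  by (simp add: act_def Z2_action_diff)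

lemma act_surj: "\<exists>k. act g k = l"
proof -
  obtain a m n where g: "g = (a, (m, n))" by (metis surj_pair)
  have "act g (Z2_action p q (- m, - n) (l - a)) = l"
    by (simp add: g act_def Z2_action_cancel)
  then show ?thesis ..
qed

lemma act_zpow [simp]: "act (zpow l) k = l + k" by (simp add: act_def zpow_def)
lemma act_Z2 [simp]: "act (0, h) k = Z2_action p q h k" by (simp add: act_def)

lemma G_clear_denominator:
  assumes "k \<in> G" obtains N a where "k * of_nat (p * q) ^ N = of_int a"
proof -
  obtain a n where "k = of_int a / of_nat (p * q) ^ n" using assms by (auto simp: Z_inv_def)
  then have "k * of_nat (p * q) ^ n = of_int a" using pq_pos by simp
  then show ?thesis by (rule that)
qed

text \<open>The diagonal elements of \<open>\<int>^2\<close> clear denominators.\<close>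

lemma Z2_action_diag: "Z2_action p q (int N, int N) k = k * of_nat (p * q) ^ N"
  by (simp add: Z2_action_def power_mult_distrib)

end

locale furstenberg_unitary = pq +
  fixes V :: "'h inner_space" and U :: "rat \<times> int \<times> int \<Rightarrow> 'h \<Rightarrow> 'h"
  assumes rep: "unitary_rep \<Gamma> V U"
begin

sublocale hilbert_space V using rep by (simp add: unitary_rep_def)
sublocale act: group_action \<Gamma> "carrier V" U using rep by (simp add: unitary_rep_def)

lemma U_unitary: "g \<in> carrier \<Gamma> \<Longrightarrow> unitary_map V V (U g)" using rep by (simp add: unitary_rep_def)

lemma U_in [simp, intro]: "g \<in> carrier \<Gamma> \<Longrightarrow> x \<in> carrier V \<Longrightarrow> U g x \<in> carrier V"
  using act.element_image by blast

lemma U_add: "g \<in> carrier \<Gamma> \<Longrightarrow> x \<in> carrier V \<Longrightarrow> y \<in> carrier V \<Longrightarrow> U g (x \<oplus>\<^bsub>V\<^esub> y) = U g x \<oplus>\<^bsub>V\<^esub> U g y"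
  using U_unitary by (simp add: unitary_map_def)

lemma U_smult: "g \<in> carrier \<Gamma> \<Longrightarrow> x \<in> carrier V \<Longrightarrow> U g (c \<odot>\<^bsub>V\<^esub> x) = c \<odot>\<^bsub>V\<^esub> U g x"
  using U_unitary by (simp add: unitary_map_def)

lemma U_diff: "g \<in> carrier \<Gamma> \<Longrightarrow> x \<in> carrier V \<Longrightarrow> y \<in> carrier V \<Longrightarrow> U g (x \<ominus>\<^bsub>V\<^esub> y) = U g x \<ominus>\<^bsub>V\<^esub> U g y"
  by (simp add: diff_smult U_add U_smult)

lemma U_zero: "g \<in> carrier \<Gamma> \<Longrightarrow> U g \<zero>\<^bsub>V\<^esub> = \<zero>\<^bsub>V\<^esub>"
  using U_smult[of g "\<zero>\<^bsub>V\<^esub>" 0] by simp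

lemma U_cinner: "g \<in> carrier \<Gamma> \<Longrightarrow> x \<in> carrier V \<Longrightarrow> y \<in> carrier V \<Longrightarrow> cinner V (U g x) (U g y) = cinner V x y"
  using U_unitary by (simp add: unitary_map_def)

lemma U_mult: "g \<in> carrier \<Gamma> \<Longrightarrow> h \<in> carrier \<Gamma> \<Longrightarrow> x \<in> carrier V \<Longrightarrow> U (g \<otimes>\<^bsub>\<Gamma>\<^esub> h) x = U g (U h x)"
  by (rule act.composition_rule)

lemma U_one: "x \<in> carrier V \<Longrightarrow> U \<one>\<^bsub>\<Gamma>\<^esub> x = x"
  using act.id_eq_one by (metis restrict_apply')

lemma U_inv:
  assumes "g \<in> carrier \<Gamma>" "x \<in> carrier V"
  shows "U (inv\<^bsub>\<Gamma>\<^esub> g) (U g x) = x" "U g (U (inv\<^bsub>\<Gamma>\<^esub> g) x) = x"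
proof -
  interpret group \<Gamma> by (rule group_\<Gamma>)
  show "U (inv\<^bsub>\<Gamma>\<^esub> g) (U g x) = x" "U g (U (inv\<^bsub>\<Gamma>\<^esub> g) x) = x"
    using assms by (simp_all add: U_one flip: U_mult)
qed

lemma inv_in [simp]: "g \<in> carrier \<Gamma> \<Longrightarrow> inv\<^bsub>\<Gamma>\<^esub> g \<in> carrier \<Gamma>"
  using group.inv_closed[OF group_\<Gamma>] .

lemma U_cinner_inv:
  assumes "g \<in> carrier \<Gamma>" "x \<in> carrier V" "y \<in> carrier V"
  shows "cinner V (U g x) y = cinner V x (U (inv\<^bsub>\<Gamma>\<^esub> g) y)"
  using U_cinner[of g x "U (inv\<^bsub>\<Gamma>\<^esub> g) y"] assms by (simp add: U_inv)

lemma U_hconv: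
  assumes "g \<in> carrier \<Gamma>" "hconv s x" shows "hconv (\<lambda>n. U g (s n)) (U g x)"
proof -
  have "hnorm V (U g (s n) \<ominus>\<^bsub>V\<^esub> U g x) = hnorm V (s n \<ominus>\<^bsub>V\<^esub> x)" for n
    using assms(1) hconv_in[OF assms(2)] by (simp add: hnorm_def U_cinner flip: U_diff)
  then show ?thesis using assms hconv_in[OF assms(2)] by (simp add: hconv_def U_in)
qed

section \<open>Fixed vectors, their orbits and matrix coefficients\<close>

abbreviation Fix :: "'h set" where "Fix \<equiv> Z2_fixed V U"

lemma Fix_in: "x \<in> Fix \<Longrightarrow> x \<in> carrier V" by (simp add: Z2_fixed_def)
lemma Fix_eq: "x \<in> Fix \<Longrightarrow> U (0, h) x = x" by (cases h) (simp add: Z2_fixed_def)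

lemma FixI: "x \<in> carrier V \<Longrightarrow> (\<And>h. U (0, h) x = x) \<Longrightarrow> x \<in> Fix" by (simp add: Z2_fixed_def)

lemma Fix_diff: "x \<in> Fix \<Longrightarrow> y \<in> Fix \<Longrightarrow> x \<ominus>\<^bsub>V\<^esub> y \<in> Fix"
  by (intro FixI) (auto simp: Fix_in U_diff Fix_eq)

lemma Fix_smult: "x \<in> Fix \<Longrightarrow> c \<odot>\<^bsub>V\<^esub> x \<in> Fix"
  by (intro FixI) (auto simp: Fix_in U_smult Fix_eq)

text \<open>Indexing the orbit by all rationals, with value zero outside \<open>\<int>[1/(pq)]\<close>, lets \<open>act g\<close> permute a
  whole type.\<close>

definition orb :: "'h \<Rightarrow> rat \<Rightarrow> 'h" where
  "orb x k = (if k \<in> G then U (zpow k) x else \<zero>\<^bsub>V\<^esub>)"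

lemma orb_in [simp, intro]: "x \<in> carrier V \<Longrightarrow> orb x k \<in> carrier V" by (simp add: orb_def U_in)

lemma orb_zero: "x \<in> carrier V \<Longrightarrow> orb x 0 = x"
  using U_one by (simp add: orb_def zpow_def furstenberg_group_simps)

lemma orb_diff: "x \<in> carrier V \<Longrightarrow> y \<in> carrier V \<Longrightarrow> orb (x \<ominus>\<^bsub>V\<^esub> y) k = orb x k \<ominus>\<^bsub>V\<^esub> orb y k"
  by (simp add: orb_def U_diff)

lemma orb_smult: "x \<in> carrier V \<Longrightarrow> orb (c \<odot>\<^bsub>V\<^esub> x) k = c \<odot>\<^bsub>V\<^esub> orb x k"
  by (simp add: orb_def U_smult)

text \<open>In \<Gamma>, \<open>g\<close> times z^k equals z^(\<open>act g k\<close>) times the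
  \<open>\<int>^2\<close>-part of \<open>g\<close>, and that part fixes \<open>x\<close>. Outside
  \<open>G\<close> both sides are zero.\<close>

lemma U_orb:
  assumes x: "x \<in> Fix" and g: "g \<in> carrier \<Gamma>"
  shows "U g (orb x k) = orb x (act g k)"
proof (cases "k \<in> G")
  case True
  have xV: "x \<in> carrier V" using x by (rule Fix_in)
  have "g \<otimes>\<^bsub>\<Gamma>\<^esub> zpow k = zpow (act g k) \<otimes>\<^bsub>\<Gamma>\<^esub> (0, snd g)"
    unfolding \<Gamma>_mult by (simp add: zpow_def) (simp add: act_def)
  then have "U g (U (zpow k) x) = U (zpow (act g k)) (U (0, snd g) x)"
    using g True xV act_in_iff[OF g] by (simp flip: U_mult)
  then show ?thesis using True x act_in_iff[OF g] by (simp add: orb_def Fix_eq)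
next
  case False
  then show ?thesis using act_in_iff[OF g] g by (simp add: orb_def U_zero)
qed

lemma cinner_orb_act:
  assumes "x \<in> Fix" "y \<in> Fix" "g \<in> carrier \<Gamma>"
  shows "cinner V (orb x (act g k)) (orb y (act g l)) = cinner V (orb x k) (orb y l)"
  using U_cinner[OF assms(3) orb_in orb_in, of x y k l] assms by (simp add: U_orb Fix_in)

definition mcoeff :: "'h \<Rightarrow> 'h \<Rightarrow> rat \<Rightarrow> complex" where
  "mcoeff x y k = cinner V (orb x k) y"

lemma cinner_orb_eq_mcoeff:
  assumes "x \<in> Fix" "y \<in> Fix" "k \<in> G" "l \<in> G"
  shows "cinner V (orb x k) (orb y l) = mcoeff x y (k - l)"
  using cinner_orb_act[OF assms(1,2), of "zpow (- l)" k l] assms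
  by (simp add: mcoeff_def orb_zero Fix_in Z_inv_uminus)

lemma cinner_orb_orb:
  assumes "x \<in> Fix" "y \<in> Fix"
  shows "cinner V (orb x k) (orb y l) = (if k \<in> G \<and> l \<in> G then mcoeff x y (k - l) else 0)"
proof (cases "k \<in> G \<and> l \<in> G")
  case False
  then show ?thesis using assms orb_in[of x k] orb_in[of y l] Fix_in
    by (auto simp: orb_def cinner_zero_left cinner_zero_right)
qed (simp add: cinner_orb_eq_mcoeff assms)

lemma mcoeff_Z2:
  assumes "x \<in> Fix" "y \<in> Fix" shows "mcoeff x y (Z2_action p q h k) = mcoeff x y k"
  using cinner_orb_act[OF assms, of "(0, h)" k 0] assms by (simp add: mcoeff_def orb_zero Fix_in)

text \<open>The reduction from \<open>\<int>[1/(pq)]\<close> to the integers, where the Fourier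
  coefficients of circle measures live.\<close>

lemma mcoeff_eq_int:
  assumes "x \<in> Fix" "y \<in> Fix" "k * of_nat (p * q) ^ N = of_int a"
  shows "mcoeff x y k = mcoeff x y (of_int a)"
  using mcoeff_Z2[OF assms(1,2), of "(int N, int N)" k] unfolding Z2_action_diag assms(3) by simp

lemma mcoeff_diff_left: "x \<in> carrier V \<Longrightarrow> x' \<in> carrier V \<Longrightarrow> y \<in> carrier V \<Longrightarrow> mcoeff (x \<ominus>\<^bsub>V\<^esub> x') y k = mcoeff x y k - mcoeff x' y k"
  by (simp add: mcoeff_def orb_diff cinner_diff_left)

lemma mcoeff_diff_right: "x \<in> carrier V \<Longrightarrow> y' \<in> carrier V \<Longrightarrow> y \<in> carrier V \<Longrightarrow> mcoeff x (y \<ominus>\<^bsub>V\<^esub> y') k = mcoeff x y k - mcoeff x y' k"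
  by (simp add: mcoeff_def cinner_diff_right)

lemma mcoeff_smult_left: "x \<in> carrier V \<Longrightarrow> y \<in> carrier V \<Longrightarrow> mcoeff (c \<odot>\<^bsub>V\<^esub> x) y k = c * mcoeff x y k"
  by (simp add: mcoeff_def orb_smult cinner_smult_left)

lemma mcoeff_smult_right: "x \<in> carrier V \<Longrightarrow> y \<in> carrier V \<Longrightarrow> mcoeff x (c \<odot>\<^bsub>V\<^esub> y) k = cnj c * mcoeff x y k"
  by (simp add: mcoeff_def cinner_smult_right)

lemmas mcoeff_linear = mcoeff_diff_left mcoeff_diff_right mcoeff_smult_left mcoeff_smult_right

lemma mcoeff_zero: "x \<in> carrier V \<Longrightarrow> mcoeff x y 0 = cinner V x y"
  by (simp add: mcoeff_def orb_zero)

lemma mcoeff_commute: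
  assumes "x \<in> Fix" "y \<in> Fix" "k \<in> G" shows "mcoeff y x (- k) = cnj (mcoeff x y k)"
proof -
  have "mcoeff y x (- k) = cinner V (orb y 0) (orb x k)" using cinner_orb_eq_mcoeff[OF assms(2,1), of 0 k] assms by simp
  also have "\<dots> = cnj (cinner V (orb x k) (orb y 0))" using assms by (intro cinner_commute orb_in Fix_in)
  finally show ?thesis using assms by (simp add: mcoeff_def orb_zero Fix_in)
qed

lemma mcoeff_self_psd: 
  assumes "x \<in> Fix" shows "psd_kernel (\<lambda>k l::int. mcoeff x x (of_int (k - l)))"
proof
  have eq: "mcoeff x x (of_int (k - l)) = cinner V (orb x (of_int k)) (orb x (of_int l))" for k l :: int
    using cinner_orb_eq_mcoeff[OF assms assms, of "of_int k" "of_int l"] by simp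
  have xV: "\<And>k. orb x (of_int k) \<in> carrier V" using assms by (intro orb_in Fix_in)
  show "mcoeff x x (of_int (j - i)) = cnj (mcoeff x x (of_int (i - j)))" for i j :: int
    unfolding eq by (intro cinner_commute xV)
  show "0 \<le> Re (gram (\<lambda>k l::int. mcoeff x x (of_int (k - l))) xs xs)" for xs
    unfolding eq cinner_lincomb[OF xV xV, symmetric] by (intro cinner_nonneg lincomb_in xV)
qed

text \<open>Irreducibility is applied to the orthogonal complement of an orbit instead of the cyclic
  subspace: it is closed by continuity of the inner product, and no closure has to be
  formed.\<close>

lemma orthogonal_closed_subspace:
  assumes y: "y \<in> Fix"
  shows "closed_subspace V {w \<in> carrier V. \<forall>k. cinner V w (orb y k) = 0}"
  unfolding closed_subspace_iff
proof (intro conjI allI ballI impI)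
  have yV: "orb y k \<in> carrier V" for k using y by (intro orb_in Fix_in)
  let ?W = "{w \<in> carrier V. \<forall>k. cinner V w (orb y k) = 0}"
  show "?W \<subseteq> carrier V" by auto
  show "\<zero>\<^bsub>V\<^esub> \<in> ?W" using yV by (simp add: cinner_zero_left)
  show "x \<oplus>\<^bsub>V\<^esub> x' \<in> ?W" if "x \<in> ?W" "x' \<in> ?W" for x x' using that yV by (simp add: cinner_add_left)
  show "c \<odot>\<^bsub>V\<^esub> x \<in> ?W" if "x \<in> ?W" for c x using that yV by (simp add: cinner_smult_left)
  show "x \<in> ?W" if s: "(\<forall>n. s n \<in> ?W) \<and> hconv s x" for s x
  proof -
    have "cinner V x (orb y k) = 0" for k
      using hconv_cinner[of s x "\<lambda>_. orb y k" "orb y k"] hconv_const[OF yV] s LIMSEQ_unique[OF _ tendsto_const] by simp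
    then show ?thesis using s hconv_in by blast
  qed
qed

lemma orthogonal_invariant:
  assumes y: "y \<in> Fix" and g: "g \<in> carrier \<Gamma>"
    and w: "w \<in> carrier V" "\<forall>k. cinner V w (orb y k) = 0"
  shows "cinner V (U g w) (orb y k) = 0"
proof -
  \<comment> \<open>As \<open>act g\<close> is surjective, every vector of the orbit is the image
    under \<open>U g\<close> of another one.\<close>
  obtain l where l: "k = act g l" using act_surj[of g k] by metis
  have "cinner V (U g w) (U g (orb y l)) = cinner V w (orb y l)" using g w(1) orb_in[OF Fix_in[OF y]] by (rule U_cinner)
  then show ?thesis using w y g by (simp add: U_orb l)
qed

lemma irreducible_orthogonal:
  assumes irr: "irreducible_rep \<Gamma> V U" and y: "y \<in> Fix"
    and w: "w \<in> carrier V" "\<And>k. cinner V w (orb y k) = 0"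
  shows "w = \<zero>\<^bsub>V\<^esub> \<or> y = \<zero>\<^bsub>V\<^esub>"
proof -
  define W where "W = {w \<in> carrier V. \<forall>k. cinner V w (orb y k) = 0}"
  have "closed_subspace V W" unfolding W_def by (rule orthogonal_closed_subspace[OF y])
  moreover have "\<forall>g\<in>carrier \<Gamma>. U g ` W \<subseteq> W"
    using orthogonal_invariant[OF y] by (auto simp: W_def)
  ultimately have "W = {\<zero>\<^bsub>V\<^esub>} \<or> W = carrier V" using irr by (simp add: irreducible_rep_def)
  then show ?thesis
  proof
    assume "W = {\<zero>\<^bsub>V\<^esub>}"
    then show ?thesis using w by (auto simp: W_def)
  next
    assume "W = carrier V"
    then have "cinner V y (orb y 0) = 0" using y Fix_in by (auto simp: W_def)
    then show ?thesis using y by (simp add: orb_zero Fix_in cinner_self_eq_zero)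
  qed
qed

lemma irreducible_total:
  assumes "irreducible_rep \<Gamma> V U" "y \<in> Fix" "y \<noteq> \<zero>\<^bsub>V\<^esub>"
  shows "total (orb y)"
  unfolding total_def using irreducible_orthogonal[OF assms(1,2)] assms(2,3) by (auto simp: Fix_in)

text \<open>Let \<open>y\<close> be the projection of the cyclic vector \<open>e\<close> to an
  invariant closed subspace. It is fixed and its translates are orthogonal to
  \<open>e \<ominus> y\<close>, so by \<open>key\<close> it is a multiple of \<open>e\<close>; being
  a projection, it is zero or \<open>e\<close>.\<close>

lemma irreducibleI:
  assumes e: "e \<in> Fix" "e \<noteq> \<zero>\<^bsub>V\<^esub>" and tot: "total (orb e)"
    and key: "\<And>y. y \<in> Fix \<Longrightarrow> (\<And>k. k \<in> G \<Longrightarrow> mcoeff y (e \<ominus>\<^bsub>V\<^esub> y) k = 0) \<Longrightarrow> \<exists>c. y = c \<odot>\<^bsub>V\<^esub> e"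
  shows "irreducible_rep \<Gamma> V U"
  unfolding irreducible_rep_def
proof (intro conjI allI impI rep)
  have eV: "e \<in> carrier V" using e by (simp add: Fix_in)
  show "carrier V \<noteq> {\<zero>\<^bsub>V\<^esub>}" using e eV by auto
  fix W assume W: "closed_subspace V W \<and> (\<forall>g\<in>carrier \<Gamma>. U g ` W \<subseteq> W)"
  then have WV: "W \<subseteq> carrier V" and W0: "\<zero>\<^bsub>V\<^esub> \<in> W"
    and Wadd: "\<And>v w. v \<in> W \<Longrightarrow> w \<in> W \<Longrightarrow> v \<oplus>\<^bsub>V\<^esub> w \<in> W"
    and Wsm: "\<And>c w. w \<in> W \<Longrightarrow> c \<odot>\<^bsub>V\<^esub> w \<in> W"
    unfolding closed_subspace_iff by blast+
  have Winv: "\<And>g w. g \<in> carrier \<Gamma> \<Longrightarrow> w \<in> W \<Longrightarrow> U g w \<in> W" using W by blast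
  have Wdiff: "v \<ominus>\<^bsub>V\<^esub> w \<in> W" if "v \<in> W" "w \<in> W" for v w
    using that WV Wadd Wsm by (simp add: diff_smult subset_iff)
  obtain y where y: "y \<in> W" "\<And>w. w \<in> W \<Longrightarrow> cinner V (e \<ominus>\<^bsub>V\<^esub> y) w = 0"
    using projection_exists[of W e] W eV by blast
  have yV: "y \<in> carrier V" using y WV by blast
  have "y \<in> Fix"
  proof (rule FixI[OF yV])
    fix h :: "int \<times> int"
    define g where "g = (0::rat, h)"
    have g: "g \<in> carrier \<Gamma>" by (simp add: g_def)
    \<comment> \<open>Both \<open>y\<close> and \<open>U g y\<close> are projections of
      \<open>e\<close> to \<open>W\<close>, since \<open>e\<close> is fixed and \<open>W\<close>
      invariant. Their difference lies in \<open>W\<close> and is orthogonal to itself.\<close>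
    define d where "d = y \<ominus>\<^bsub>V\<^esub> U g y"
    have dW: "d \<in> W" unfolding d_def by (intro Wdiff y Winv g)
    then have dV: "d \<in> carrier V" using WV by blast
    have "cinner V (e \<ominus>\<^bsub>V\<^esub> U g y) d = cinner V (U g (e \<ominus>\<^bsub>V\<^esub> y)) d"
      using e g eV yV by (simp add: U_diff g_def Fix_eq)
    also have "\<dots> = cinner V (e \<ominus>\<^bsub>V\<^esub> y) (U (inv\<^bsub>\<Gamma>\<^esub> g) d)"
      using g eV yV dV by (intro U_cinner_inv diff_in)
    also have "\<dots> = 0" using g by (intro y Winv dW inv_in)
    finally have 1: "cinner V (e \<ominus>\<^bsub>V\<^esub> U g y) d = 0" .
    have 2: "cinner V (e \<ominus>\<^bsub>V\<^esub> y) d = 0" by (rule y(2)[OF dW])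
    have gyV: "U g y \<in> carrier V" using g yV by (rule U_in)
    have "cinner V d d = cinner V (e \<ominus>\<^bsub>V\<^esub> U g y) d - cinner V (e \<ominus>\<^bsub>V\<^esub> y) d"
      using eV yV gyV dV by (simp add: cinner_diff_left) (simp add: d_def cinner_diff_left diff_in yV gyV)
    then have "d = \<zero>\<^bsub>V\<^esub>" using 1 2 dV by (simp add: cinner_self_eq_zero)
    then show "U (0, h) y = y" using yV gyV by (simp add: d_def g_def diff_eq_zero_iff)
  qed
  moreover have "mcoeff y (e \<ominus>\<^bsub>V\<^esub> y) k = 0" if "k \<in> G" for k
  proof -
    have oW: "orb y k \<in> W" using that y Winv by (simp add: orb_def)
    have "mcoeff y (e \<ominus>\<^bsub>V\<^esub> y) k = cnj (cinner V (e \<ominus>\<^bsub>V\<^esub> y) (orb y k))"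
      unfolding mcoeff_def using eV yV by (intro cinner_commute diff_in orb_in)
    then show ?thesis using y(2)[OF oW] by simp
  qed
  ultimately obtain c where c: "y = c \<odot>\<^bsub>V\<^esub> e" using key by blast
  \<comment> \<open>Orthogonality of \<open>e \<ominus> y\<close> to \<open>y\<close> itself. For c
    = 1 the whole orbit of \<open>e\<close> lies in \<open>W\<close>; for c = 0 it is orthogonal to
    \<open>W\<close>.\<close>
  have "(1 - c) * cnj c * cinner V e e = 0"
    using y(2)[OF y(1)] eV unfolding c by (simp add: cinner_linear algebra_simps)
  then have "c = 1 \<or> c = 0" using e eV by (simp add: cinner_self_eq_zero)
  then show "W = {\<zero>\<^bsub>V\<^esub>} \<or> W = carrier V"
  proof
    assume "c = 1"
    then have eW: "e \<in> W" using y c eV by simp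
    have "v \<in> W" if v: "v \<in> carrier V" for v
    proof -
      obtain v' where v': "v' \<in> W" "\<And>w. w \<in> W \<Longrightarrow> cinner V (v \<ominus>\<^bsub>V\<^esub> v') w = 0"
        using projection_exists[of W v] W v by blast
      have v'V: "v' \<in> carrier V" using v' WV by blast
      have "orb e k \<in> W" for k using eW Winv W0 by (simp add: orb_def)
      then have "\<forall>k. cinner V (v \<ominus>\<^bsub>V\<^esub> v') (orb e k) = 0" using v'(2) by blast
      then have "v \<ominus>\<^bsub>V\<^esub> v' = \<zero>\<^bsub>V\<^esub>" using tot v v'V unfolding total_def by blast
      then show ?thesis using v v'V v'(1) by (simp add: diff_eq_zero_iff)
    qed
    then show ?thesis using WV by blast
  next
    assume "c = 0"
    then have y0: "y = \<zero>\<^bsub>V\<^esub>" using c eV by simp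
    have "w = \<zero>\<^bsub>V\<^esub>" if w: "w \<in> W" for w
    proof -
      have wV: "w \<in> carrier V" using w WV by blast
      have "cinner V w (orb e k) = 0" for k
      proof (cases "k \<in> G")
        case True
        then have g: "zpow k \<in> carrier \<Gamma>" by simp
        have "cinner V (orb e k) w = cinner V e (U (inv\<^bsub>\<Gamma>\<^esub> (zpow k)) w)"
          using True g eV wV by (simp add: orb_def U_cinner_inv)
        also have "\<dots> = cinner V (e \<ominus>\<^bsub>V\<^esub> y) (U (inv\<^bsub>\<Gamma>\<^esub> (zpow k)) w)"
          using g eV wV U_in[OF inv_in[OF g] wV] by (simp add: y0 cinner_diff_left cinner_zero_left)
        also have "\<dots> = 0" using g by (intro y Winv w inv_in)
        finally show ?thesis using cinner_commute[OF orb_in[OF eV] wV, of k] by simp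
      next
        case False
        then show ?thesis using wV by (simp add: orb_def cinner_zero_right)
      qed
      then show ?thesis using tot wV unfolding total_def by blast
    qed
    then show ?thesis using W0 by blast
  qed
qed

text \<open>The definition asks about every nonzero fixed vector, but testing \<open>e\<close> is
  enough: if z^k fixes a nonzero fixed \<open>x\<close>, then \<open>mcoeff e x\<close> has period
  \<open>k\<close>. The vector \<open>orb e k \<ominus> e\<close> is then orthogonal to the total
  orbit of \<open>x\<close>, so z^k fixes \<open>e\<close> too.\<close>

lemma furstenberg_repI:
  assumes irr: "irreducible_rep \<Gamma> V U" and e: "e \<in> Fix" "e \<noteq> \<zero>\<^bsub>V\<^esub>"
    and moved: "\<And>k::int. k \<noteq> 0 \<Longrightarrow> mcoeff e e (of_int k) \<noteq> cinner V e e"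
  shows "furstenberg_rep p q V U"
  unfolding furstenberg_rep_def
proof (intro conjI irr allI ballI impI)
  show "Fix \<noteq> {\<zero>\<^bsub>V\<^esub>}" using e by auto
  fix k :: int and x assume x: "x \<in> Fix" and kx: "k \<noteq> 0 \<and> x \<noteq> \<zero>\<^bsub>V\<^esub>"
  have eV: "e \<in> carrier V" and xV: "x \<in> carrier V" using e x by (auto simp: Fix_in)
  have tot: "total (orb x)" using irreducible_total[OF irr x] kx by blast
  show "U (zpow (of_int k)) x \<noteq> x"
  proof
    assume ux: "U (zpow (of_int k)) x = x"
    have "cinner V (orb e (of_int k) \<ominus>\<^bsub>V\<^esub> e) (orb x l) = 0" for l
    proof (cases "l \<in> G")
      case True
      have "orb x (of_int k) = x" using ux by (simp add: orb_def)
      then have "cinner V e (orb x l) = cinner V (orb e 0) (U (zpow l) (orb x (of_int k)))"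
        using True eV by (simp add: orb_zero) (simp add: orb_def)
      also have "\<dots> = cinner V (orb e 0) (orb x (l + of_int k))"
        using x True by (subst U_orb) auto
      also have "\<dots> = mcoeff e x (- (l + of_int k))"
        using cinner_orb_eq_mcoeff[OF e(1) x G_zero, of "l + of_int k"] True G_add[OF True G_int] by simp
      finally have a: "cinner V e (orb x l) = mcoeff e x (- l - of_int k)" by (simp add: algebra_simps)
      have b: "cinner V (orb e (of_int k)) (orb x l) = mcoeff e x (of_int k - l)"
        by (rule cinner_orb_eq_mcoeff[OF e(1) x G_int True])
      have per: "mcoeff e x (m + of_int k) = mcoeff e x m" if m: "m \<in> G" for m
      proof -
        have "mcoeff e x (m + of_int k) = cinner V (orb e (m + of_int k)) (orb x (of_int k))"
          using \<open>orb x (of_int k) = x\<close> by (simp add: mcoeff_def)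
        also have "\<dots> = mcoeff e x m" using cinner_orb_eq_mcoeff[OF e(1) x G_add[OF m G_int] G_int, of k k] by simp
        finally show ?thesis .
      qed
      have "- l - of_int k \<in> G" using True Z_inv_uminus[OF G_add[OF True G_int, of k]] by simp
      from per[OF this] have "mcoeff e x (- l) = mcoeff e x (- l - of_int k)" by simp
      moreover have "mcoeff e x (of_int k - l) = mcoeff e x (- l)"
        using per[OF Z_inv_uminus[OF True]] by (simp add: algebra_simps)
      ultimately show ?thesis using a b eV xV by (simp add: cinner_diff_left)
    next
      case False
      then show ?thesis using eV by (simp add: orb_def cinner_zero_right U_in)
    qed
    then have "orb e (of_int k) \<ominus>\<^bsub>V\<^esub> e = \<zero>\<^bsub>V\<^esub>" using tot eV unfolding total_def by blast
    then have "orb e (of_int k) = e" using eV by (simp add: diff_eq_zero_iff)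
    then show False using moved[of k] kx by (simp add: mcoeff_def)
  qed
qed

end

section \<open>The cyclic representation of an invariant measure\<close>

text \<open>A real number is coded by a set of naturals, hence a function from the rationals to the
  complex numbers by countably many such sets, and these merge into one set of naturals.\<close>

lemma rat_complex_lepoll:
  assumes "(UNIV :: real set) \<lesssim> (UNIV :: 'h set)"
  shows "(UNIV :: (rat \<Rightarrow> complex) set) \<lesssim> (UNIV :: 'h set)"
proof -
  have "(UNIV :: real set) \<lesssim> (UNIV :: nat set set)"
    using nat_sets_eqpoll_reals eqpoll_sym eqpoll_imp_lepoll by blast
  then obtain a :: "real \<Rightarrow> nat set" where a: "inj a" by (auto simp: lepoll_def)
  \<comment> \<open>The index \<open>b\<close> chooses between the real and the imaginary part of
    the value at \<open>r\<close>.\<close>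
  define S :: "(rat \<Rightarrow> complex) \<Rightarrow> nat set" where
    "S F = to_nat ` {(r, b, n). n \<in> (if b then a (Re (F r)) else a (Im (F r)))}" for F
  have S: "to_nat (r, b, n) \<in> S F \<longleftrightarrow> n \<in> (if b then a (Re (F r)) else a (Im (F r)))" for r b n F
    unfolding S_def by (subst inj_image_mem_iff) auto
  have "inj S"
  proof (rule injI, rule ext)
    fix F F' r assume eq: "S F = S F'"
    have "a (Re (F r)) = a (Re (F' r))" "a (Im (F r)) = a (Im (F' r))"
      using S[of r True _ F] S[of r True _ F'] S[of r False _ F] S[of r False _ F'] eq by auto
    then show "F r = F' r" using a by (simp add: inj_eq complex_eq_iff)
  qed
  then have "(UNIV :: (rat \<Rightarrow> complex) set) \<lesssim> (UNIV :: nat set set)" by (auto simp: lepoll_def)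
  also have "(UNIV :: nat set set) \<lesssim> (UNIV :: real set)"
    by (rule eqpoll_imp_lepoll[OF nat_sets_eqpoll_reals])
  also note assms
  finally show ?thesis .
qed

lemma gram_Cons_left: "gram K ((c, i) # xs) ys = (\<Sum>(d, j)\<leftarrow>ys. c * cnj d * K i j) + gram K xs ys"
  by (simp add: gram_def)

text \<open>Lets a kernel on the rationals inherit positivity from one on the integers:
  \<open>P\<close> selects the indices in \<open>G\<close>, and \<open>f\<close> is the
  multiplication that makes finitely many of them integral.\<close>

lemma gram_restrict:
  assumes "\<And>i j. i \<in> snd ` set xs \<Longrightarrow> j \<in> snd ` set ys \<Longrightarrow>
    L i j = (if P i \<and> P j then K (f i) (f j) else 0)"
  shows "gram L xs ys =
    gram K (map (\<lambda>(c, i). (c, f i)) (filter (P \<circ> snd) xs)) (map (\<lambda>(c, i). (c, f i)) (filter (P \<circ> snd) ys))"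
  using assms
proof (induction xs)
  case (Cons x xs)
  obtain c i where x: "x = (c, i)" by (cases x)
  have L: "j \<in> snd ` set ys \<Longrightarrow> L i j = (if P i \<and> P j then K (f i) (f j) else 0)" for j
    using Cons.prems x by auto
  have "(\<Sum>(d, j)\<leftarrow>ys. c * cnj d * L i j) =
      (if P i then (\<Sum>(d, j)\<leftarrow>map (\<lambda>(c, i). (c, f i)) (filter (P \<circ> snd) ys). c * cnj d * K (f i) j) else 0)"
    using L by (induction ys) auto
  moreover have "gram L xs ys = gram K (map (\<lambda>(c, i). (c, f i)) (filter (P \<circ> snd) xs)) (map (\<lambda>(c, i). (c, f i)) (filter (P \<circ> snd) ys))"
    using Cons by (auto simp: o_def)
  ultimately show ?case by (simp add: x gram_Cons_left o_def)
qed simp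

locale pq_measure = pq p q + circle_measure \<mu> for p q and \<mu> +
  assumes inv_p: "fourier_invariant p \<mu>" and inv_q: "fourier_invariant q \<mu>"
begin

text \<open>Some \<open>k (pq)\<^sup>N\<close> is an integer, and by invariance its Fourier coefficient does not depend on \<open>N\<close>.\<close>

definition phi :: "rat \<Rightarrow> complex" where
  "phi k = fourier \<mu> (SOME a. \<exists>N. k * of_nat (p * q) ^ N = of_int a)"

lemma fourier_mult_power: "fourier \<mu> (int p ^ m * int q ^ n * k) = fourier \<mu> k"
  using fourier_invariant_mult[OF fourier_invariant_power[OF inv_p, of m] fourier_invariant_power[OF inv_q, of n]]
  by (simp add: fourier_invariant_def)

text \<open>Well-definedness of the choice: numerators \<open>a\<close> and \<open>b\<close> of the
  same \<open>k\<close>, for exponents \<open>N\<close> and \<open>M\<close>, agree after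
  multiplication by (pq)^M and (pq)^N respectively, and invariance of \<mu> removes these
  factors.\<close>

lemma phi_eq:
  assumes "k * of_nat (p * q) ^ N = of_int a"
  shows "phi k = fourier \<mu> a"
proof -
  define b where "b = (SOME a. \<exists>N. k * of_nat (p * q) ^ N = of_int a)"
  have "\<exists>N. k * of_nat (p * q) ^ N = of_int b"
    unfolding b_def by (rule someI) (use assms in blast)
  then obtain M where M: "k * of_nat (p * q) ^ M = of_int b" by blast
  have "rat_of_int (int p ^ M * int q ^ M * a) = k * of_nat (p * q) ^ (N + M)"
    by (simp add: assms[symmetric] power_add power_mult_distrib)
  also have "\<dots> = rat_of_int (int p ^ N * int q ^ N * b)"
    by (simp add: M[symmetric] power_add power_mult_distrib)
  finally have "int p ^ M * int q ^ M * a = int p ^ N * int q ^ N * b" by linarith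
  then have "fourier \<mu> a = fourier \<mu> b" using fourier_mult_power by metis
  then show ?thesis by (simp add: phi_def b_def)
qed

lemma phi_int [simp]: "phi (of_int a) = fourier \<mu> a"
  by (rule phi_eq[of _ 0]) simp

lemma phi_Z2:
  assumes "k \<in> G" shows "phi (Z2_action p q h k) = phi k"
proof -
  obtain m n where h: "h = (m, n)" by (cases h)
  obtain N a where a: "k * of_nat (p * q) ^ N = of_int a" using G_clear_denominator[OF assms] by blast
  \<comment> \<open>Large enough for both exponents \<open>m + int M\<close> and
    \<open>n + int M\<close> to be nonnegative.\<close>
  define M where "M = nat (\<bar>m\<bar> + \<bar>n\<bar>)"
  have pos: "m + int M \<ge> 0" "n + int M \<ge> 0" by (auto simp: M_def)
  have "Z2_action p q h k * of_nat (p * q) ^ (N + M) = Z2_action p q (m + int M, n + int M) (k * of_nat (p * q) ^ N)"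
    using pq_pos by (simp add: h Z2_action_def power_add power_int_add power_mult_distrib mult_ac)
  also have "\<dots> = of_int (int p ^ nat (m + int M) * int q ^ nat (n + int M) * a)"
    unfolding a using pos by (simp add: Z2_action_def power_int_def mult_ac)
  finally have "phi (Z2_action p q h k) = fourier \<mu> (int p ^ nat (m + int M) * int q ^ nat (n + int M) * a)"
    by (rule phi_eq)
  then show ?thesis using phi_eq[OF a] fourier_mult_power by simp
qed

text \<open>The Gram matrix that the orbit of the cyclic vector is going to have, with the same
  value zero outside \<open>G\<close> as in \<open>orb\<close>.\<close>

definition K :: "rat \<Rightarrow> rat \<Rightarrow> complex" where
  "K k l = (if k \<in> G \<and> l \<in> G then phi (k - l) else 0)"

lemma K_act: "g \<in> carrier \<Gamma> \<Longrightarrow> K (act g k) (act g l) = K k l"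
  by (simp add: K_def act_in_iff act_diff phi_Z2 G_diff)

lemma common_denominator:
  "\<exists>N. \<forall>k\<in>set ks. k \<in> G \<longrightarrow> (\<exists>a. k * of_nat (p * q) ^ N = of_int a)"
proof (induction ks)
  case (Cons k ks)
  then obtain N where N: "\<forall>k\<in>set ks. k \<in> G \<longrightarrow> (\<exists>a. k * of_nat (p * q) ^ N = of_int a)" by blast
  obtain M where M: "k \<in> G \<longrightarrow> (\<exists>b. k * of_nat (p * q) ^ M = of_int b)"
    using G_clear_denominator[of k] by metis
  have up: "\<exists>c. l * of_nat (p * q) ^ (i + j) = of_int c" if "l * of_nat (p * q) ^ i = of_int b" for l b i j
    by (rule exI[of _ "b * int (p * q) ^ j"]) (use that in \<open>simp add: power_add flip: mult.assoc\<close>)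
  show ?case
  proof (intro exI[of _ "N + M"] ballI impI)
    fix l assume l: "l \<in> set (k # ks)" "l \<in> G"
    show "\<exists>a. l * of_nat (p * q) ^ (N + M) = of_int a"
    proof (cases "l = k")
      case True
      then obtain b where "l * of_nat (p * q) ^ M = of_int b" using M l by blast
      from up[OF this, of N] show ?thesis by (simp only: add.commute)
    next
      case False
      then obtain b where "l * of_nat (p * q) ^ N = of_int b" using N l by auto
      from up[OF this] show ?thesis .
    qed
  qed
qed simp

text \<open>A common denominator turns the finitely many indices that lie in \<open>G\<close> into
  integers, and the form into the integral of a squared modulus of a trigonometric
  polynomial.\<close>

lemma psd_K: "psd_kernel K"
proof
  show "K l k = cnj (K k l)" for k l
  proof (cases "k \<in> G \<and> l \<in> G")
    case True
    then obtain N a where a: "(k - l) * of_nat (p * q) ^ N = of_int a"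
      using G_clear_denominator[OF G_diff] by blast
    then have "(l - k) * of_nat (p * q) ^ N = of_int (- a)" by (simp add: algebra_simps)
    from phi_eq[OF this] phi_eq[OF a] True show ?thesis by (simp add: K_def cnj_fourier)
  qed (auto simp: K_def)
  fix xs :: "(complex \<times> rat) list"
  obtain N where N: "\<forall>k\<in>set (map snd xs). k \<in> G \<longrightarrow> (\<exists>a. k * of_nat (p * q) ^ N = of_int a)"
    using common_denominator by blast
  then obtain f where f: "\<And>k. k \<in> snd ` set xs \<Longrightarrow> k \<in> G \<Longrightarrow> k * of_nat (p * q) ^ N = of_int (f k)"
    by (simp only: set_map) metis
  have "gram K xs xs = gram (\<lambda>k l. fourier \<mu> (k - l)) (map (\<lambda>(c, i). (c, f i)) (filter ((\<lambda>k. k \<in> G) \<circ> snd) xs))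
      (map (\<lambda>(c, i). (c, f i)) (filter ((\<lambda>k. k \<in> G) \<circ> snd) xs))"
  proof (rule gram_restrict)
    fix i j assume ij: "i \<in> snd ` set xs" "j \<in> snd ` set xs"
    have "phi (i - j) = fourier \<mu> (f i - f j)" if "i \<in> G" "j \<in> G"
      by (rule phi_eq[of _ N]) (use f[OF ij(1) that(1)] f[OF ij(2) that(2)] in \<open>simp add: left_diff_distrib\<close>)
    then show "K i j = (if i \<in> G \<and> j \<in> G then fourier \<mu> (f i - f j) else 0)" by (simp add: K_def)
  qed
  then show "0 \<le> Re (gram K xs xs)" by (simp add: gram_fourier_self)
qed

text \<open>The affine action permutes the indices and preserves \<open>K\<close>, so each group
  element matches the total family with its permuted copy by a unitary map.\<close>

theorem cyclic_rep_exists: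
  assumes "(UNIV :: real set) \<lesssim> (UNIV :: 'h set)"
  obtains V :: "'h inner_space" and U e where "furstenberg_unitary p q V U" "e \<in> Z2_fixed V U"
    "pre_hilbert_space.total V (furstenberg_unitary.orb p q V U e)"
    "\<And>k. furstenberg_unitary.mcoeff p q V U e e (of_int k) = fourier \<mu> k"
proof -
  obtain V :: "'h inner_space" and u where V: "hilbert_space V" and tot: "pre_hilbert_space.total V u"
    and gram: "\<And>i j. cinner V (u i) (u j) = K i j"
    using psd_kernel.kolmogorov[OF psd_K rat_complex_lepoll[OF assms]] by blast
  interpret V: hilbert_space V by fact
  have uV [simp]: "u k \<in> carrier V" for k using tot by (simp add: V.total_def)
  have tot_act: "V.total (\<lambda>k. u (act g k))" for g
    using tot act_surj[of g] unfolding V.total_def by metis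
  have "\<exists>f. unitary_map V V f \<and> (\<forall>k. f (u k) = u (act g k)) \<and>
      (\<forall>v\<in>carrier V. \<forall>k. cinner V (f v) (u (act g k)) = cinner V v (u k))" if g: "g \<in> carrier \<Gamma>" for g
  proof -
    interpret T: two_hilbert V V u "\<lambda>k. u (act g k)"
      by unfold_locales (simp_all add: tot tot_act gram K_act[OF g])
    show ?thesis using T.unitary_exists by metis
  qed
  then obtain F where F: "\<And>g. g \<in> carrier \<Gamma> \<Longrightarrow> unitary_map V V (F g)"
    and F_u: "\<And>g k. g \<in> carrier \<Gamma> \<Longrightarrow> F g (u k) = u (act g k)"
    and F_cinner: "\<And>g v k. g \<in> carrier \<Gamma> \<Longrightarrow> v \<in> carrier V \<Longrightarrow> cinner V (F g v) (u (act g k)) = cinner V v (u k)"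
    by metis
  \<comment> \<open>\<open>group_action\<close> demands operators that are undefined outside the
    carrier.\<close>
  define U where "U g = restrict (F g) (carrier V)" for g
  have U_eq: "U g v = F g v" if "v \<in> carrier V" for g v using that by (simp add: U_def)
  have F_in: "F g v \<in> carrier V" if "g \<in> carrier \<Gamma>" "v \<in> carrier V" for g v
    using F[OF that(1)] that(2) by (auto simp: unitary_map_def bij_betw_def)
  have U_unitary: "unitary_map V V (U g)" if g: "g \<in> carrier \<Gamma>" for g
    using F[OF g] bij_betw_cong[of "carrier V" "U g" "F g"] U_eq
    by (simp add: unitary_map_def)
  have U_Bij: "U g \<in> Bij (carrier V)" if g: "g \<in> carrier \<Gamma>" for g
    using U_unitary[OF g] by (simp add: Bij_def unitary_map_def U_def)
  \<comment> \<open>The two sides have the same inner products with the total family permuted by the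
    product.\<close>
  have mult: "U (g \<otimes>\<^bsub>\<Gamma>\<^esub> h) = compose (carrier V) (U g) (U h)"
    if g: "g \<in> carrier \<Gamma>" and h: "h \<in> carrier \<Gamma>" for g h
  proof (rule ext)
    fix v
    show "U (g \<otimes>\<^bsub>\<Gamma>\<^esub> h) v = compose (carrier V) (U g) (U h) v"
    proof (cases "v \<in> carrier V")
      case True
      have gh: "g \<otimes>\<^bsub>\<Gamma>\<^esub> h \<in> carrier \<Gamma>" using group_\<Gamma> g h by (simp add: group.is_monoid monoid.m_closed)
      have "cinner V (F (g \<otimes>\<^bsub>\<Gamma>\<^esub> h) v \<ominus>\<^bsub>V\<^esub> F g (F h v)) (u (act (g \<otimes>\<^bsub>\<Gamma>\<^esub> h) k)) = 0" for k
        using F_cinner[OF gh True, of k] F_cinner[OF g F_in[OF h True], of "act h k"] F_cinner[OF h True, of k]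
          F_in[OF gh True] F_in[OF g F_in[OF h True]]
        by (simp add: V.cinner_diff_left act_mult)
      then have "F (g \<otimes>\<^bsub>\<Gamma>\<^esub> h) v \<ominus>\<^bsub>V\<^esub> F g (F h v) = \<zero>\<^bsub>V\<^esub>"
        using tot_act[of "g \<otimes>\<^bsub>\<Gamma>\<^esub> h"] F_in[OF gh True] F_in[OF g F_in[OF h True]]
        unfolding V.total_def by (simp add: V.diff_in)
      then show ?thesis
        using True F_in[OF h True] F_in[OF gh True] F_in[OF g F_in[OF h True]]
        by (simp add: U_eq compose_def V.diff_eq_zero_iff)
    qed (simp add: U_def compose_def)
  qed
  have hom: "U \<in> hom \<Gamma> (BijGroup (carrier V))"
    by (rule homI) (simp_all add: BijGroup_def U_Bij mult)
  have "group_hom \<Gamma> (BijGroup (carrier V)) U"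
    using hom group_\<Gamma> group_BijGroup[of "carrier V"] by (simp add: group_hom_def group_hom_axioms_def)
  then have "unitary_rep \<Gamma> V U"
    using V U_unitary by (simp add: unitary_rep_def group_action_def)
  then interpret R: furstenberg_unitary p q V U by unfold_locales
  have u_out: "u k = \<zero>\<^bsub>V\<^esub>" if "k \<notin> G" for k
    using V.cinner_self_eq_zero[OF uV, of k] that by (simp add: gram K_def)
  have fix_u: "u 0 \<in> R.Fix"
    by (rule R.FixI) (simp_all add: U_eq F_u)
  have orb_u: "R.orb (u 0) = u"
    by (rule ext) (simp add: R.orb_def U_eq F_u u_out)
  have mcoeff_u: "R.mcoeff (u 0) (u 0) (of_int k) = fourier \<mu> k" for k
    unfolding R.mcoeff_def orb_u gram by (simp add: K_def)
  show ?thesis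
    by (rule that[OF R.furstenberg_unitary_axioms fix_u _ mcoeff_u]) (simp add: orb_u tot)
qed

end

section \<open>Irreducible representations\<close>

context furstenberg_unitary
begin

lemma mcoeff_delta:
  assumes e: "e \<in> Fix" and delta: "\<And>k::int. mcoeff e e (of_int k) = (if k = 0 then 1 else 0)" and k: "k \<in> G"
  shows "mcoeff e e k = (if k = 0 then 1 else 0)"
proof -
  obtain N a where a: "k * of_nat (p * q) ^ N = of_int a" using G_clear_denominator[OF k] by blast
  have "of_nat (p * q) ^ N \<noteq> (0::rat)" using pq_pos by simp
  then have "a = 0 \<longleftrightarrow> k = 0" using a by (metis mult_eq_0_iff of_int_0_eq_iff)
  then show ?thesis using mcoeff_eq_int[OF e e a] delta[of a] by simp
qed

text \<open>The vectors with indices \<open>k p\<^sup>i\<close> are orthonormal and have the same inner product with \<open>y\<close>, which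
  vanishes by Bessel's inequality.\<close>

lemma delta_orthogonal:
  assumes e: "e \<in> Fix" and delta: "\<And>k::int. mcoeff e e (of_int k) = (if k = 0 then 1 else 0)"
    and y: "y \<in> Fix" and k: "k \<in> G" "k \<noteq> 0"
  shows "cinner V y (orb e k) = 0"
proof -
  have eV: "e \<in> carrier V" and yV: "y \<in> carrier V" using e y by (auto simp: Fix_in)
  have oV: "orb e l \<in> carrier V" for l using eV by (rule orb_in)
  define f where "f i = k * of_nat p ^ i" for i :: nat
  have f_act: "f i = Z2_action p q (int i, 0) k" for i by (simp add: f_def Z2_action_def)
  have fG: "f i \<in> G" for i unfolding f_act by (rule G_Z2[OF k(1)])
  have f_inj: "f i = f j \<longleftrightarrow> i = j" for i j
    using k p power_inject_exp[of "rat_of_nat p" i j] by (simp add: f_def)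
  define b where "b = cinner V y (orb e k)"
  have b_eq: "cinner V y (orb e (f i)) = b" for i
  proof -
    have "cinner V (orb y (act (0, (int i, 0)) 0)) (orb e (act (0, (int i, 0)) k)) = cinner V (orb y 0) (orb e k)"
      by (rule cinner_orb_act[OF y e]) simp
    then show ?thesis using yV by (simp add: b_def f_act orb_zero)
  qed
  have "real n * (cmod b)\<^sup>2 \<le> (hnorm V y)\<^sup>2" for n
  proof (cases "n = 0")
    case False
    \<comment> \<open>All n Bessel coefficients equal \<open>b\<close>, so Cauchy-Schwarz against
      the sum of the n vectors gives Bessel's inequality.\<close>
    define xs where "xs = map (\<lambda>i. (1::complex, f i)) [0..<n]"
    define v where "v = lincomb (orb e) xs"
    have vV: "v \<in> carrier V" unfolding v_def by (rule lincomb_in[OF oV])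
    have "cinner V y v = of_nat n * b"
      unfolding v_def xs_def using oV yV
      by (simp add: cinner_lincomb_right b_eq o_def interv_sum_list_conv_sum_set_nat)
    moreover have "cinner V v v = of_nat n"
    proof -
      have "cinner V v v = (\<Sum>i\<in>{0..<n}. \<Sum>j\<in>{0..<n}. cinner V (orb e (f i)) (orb e (f j)))"
        unfolding v_def xs_def using oV
        by (simp add: cinner_lincomb gram_def o_def interv_sum_list_conv_sum_set_nat)
      also have "\<dots> = (\<Sum>i\<in>{0..<n}. \<Sum>j\<in>{0..<n}. if j = i then 1 else 0)"
      proof (intro sum.cong refl)
        fix i j
        show "cinner V (orb e (f i)) (orb e (f j)) = (if j = i then 1 else 0)"
          using cinner_orb_eq_mcoeff[OF e e fG fG, of i j] mcoeff_delta[OF e delta G_diff[OF fG fG], of i j] f_inj[of i j] by auto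
      qed
      also have "\<dots> = of_nat n" by simp
      finally show ?thesis .
    qed
    then have "(hnorm V v)\<^sup>2 = real n" using vV by (simp add: hnorm_sq)
    moreover have "cmod (cinner V y v) \<le> hnorm V y * hnorm V v" by (rule Cauchy_Schwarz[OF yV vV])
    ultimately have "(real n * cmod b)\<^sup>2 \<le> (hnorm V y)\<^sup>2 * real n"
      by (metis norm_mult norm_of_nat power_mult_distrib power_mono norm_ge_zero)
    then have "real n * (real n * (cmod b)\<^sup>2) \<le> real n * (hnorm V y)\<^sup>2"
      by (simp add: power2_eq_square mult_ac)
    then show ?thesis using False by simp
  qed simp
  then have "\<not> (cmod b)\<^sup>2 > 0"
    by (metis reals_Archimedean3 not_less)
  then show ?thesis by (simp add: b_def)
qed

text \<open>The difference of the two sides is orthogonal to \<open>e\<close> by the choice of the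
  coefficient, and to the other orbit vectors by \<open>delta_orthogonal\<close>, applied to
  \<open>y\<close> and to \<open>e\<close> itself.\<close>

lemma delta_fixed:
  assumes e: "e \<in> Fix" and delta: "\<And>k::int. mcoeff e e (of_int k) = (if k = 0 then 1 else 0)"
    and tot: "total (orb e)" and y: "y \<in> Fix"
  shows "y = cinner V y e \<odot>\<^bsub>V\<^esub> e"
proof -
  have eV: "e \<in> carrier V" and yV: "y \<in> carrier V" using e y by (auto simp: Fix_in)
  have ee: "cinner V e e = 1" using delta[of 0] eV by (simp add: mcoeff_zero)
  define w where "w = y \<ominus>\<^bsub>V\<^esub> cinner V y e \<odot>\<^bsub>V\<^esub> e"
  have wV: "w \<in> carrier V" using eV yV by (simp add: w_def)
  have "cinner V w (orb e k) = 0" for k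
  proof (cases "k \<in> G")
    case True
    show ?thesis
    proof (cases "k = 0")
      case True
      then show ?thesis using eV yV by (simp add: orb_zero w_def cinner_linear ee)
    next
      case False
      then show ?thesis
        using delta_orthogonal[OF e delta y \<open>k \<in> G\<close> False] delta_orthogonal[OF e delta e \<open>k \<in> G\<close> False] eV yV
        by (simp add: w_def cinner_linear orb_in)
    qed
  next
    case False
    then show ?thesis using wV by (simp add: orb_def cinner_zero_right)
  qed
  then have "w = \<zero>\<^bsub>V\<^esub>" using tot wV unfolding total_def by blast
  then show ?thesis using eV yV by (simp add: w_def diff_eq_zero_iff)
qed

text \<open>The assumption \<open>key\<close> of \<open>irreducibleI\<close> holds for every fixed
  vector, since all are multiples of \<open>e\<close>.\<close>

lemma furstenberg_rep_delta:
  assumes e: "e \<in> Fix" and delta: "\<And>k::int. mcoeff e e (of_int k) = (if k = 0 then 1 else 0)"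
    and tot: "total (orb e)"
  shows "furstenberg_rep p q V U"
proof -
  have ee: "cinner V e e = 1" using delta[of 0] e by (simp add: mcoeff_zero Fix_in)
  then have e0: "e \<noteq> \<zero>\<^bsub>V\<^esub>" using cinner_zero_left[of "\<zero>\<^bsub>V\<^esub>"] by auto
  have "irreducible_rep \<Gamma> V U"
    by (rule irreducibleI[OF e e0 tot]) (use delta_fixed[OF e delta tot] in blast)
  then show ?thesis
    by (rule furstenberg_repI[OF _ e e0]) (simp add: delta ee)
qed

lemma mcoeff_fourier_invariant:
  assumes "x \<in> Fix" "\<And>k::int. fourier \<nu> k = mcoeff x x (of_int k)"
  shows "fourier_invariant p \<nu>" "fourier_invariant q \<nu>"
  using mcoeff_Z2[OF assms(1,1), of "(1, 0)"] mcoeff_Z2[OF assms(1,1), of "(0, 1)"]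
  by (simp_all add: fourier_invariant_def assms(2) Z2_action_def mult.commute)

lemma herglotz_Fix:
  assumes x: "x \<in> Fix"
  obtains \<nu> where "circle_measure \<nu>" "\<And>k. fourier \<nu> k = mcoeff x x (of_int k)"
  using herglotz[of "\<lambda>k. mcoeff x x (of_int k)"] mcoeff_self_psd[OF x] by blast

lemma furstenberg_rep_ergodic:
  assumes \<mu>: "ergodic_prob p q \<mu>" and inf: "\<not> finitely_supported \<mu>"
    and e: "e \<in> Fix" and tot: "total (orb e)" and mcoeff: "\<And>k::int. mcoeff e e (of_int k) = fourier \<mu> k"
  shows "furstenberg_rep p q V U"
proof -
  have inv: "invariant_prob p q \<mu>" using \<mu> by (simp add: ergodic_prob_def)
  interpret prob_space \<mu> by (rule circle_measure_invariant[OF inv])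
  interpret circle_measure \<mu> by (rule circle_measure_invariant[OF inv])
  interpret E: ergodic_measure p q \<mu> by unfold_locales (rule \<mu>)
  have eV: "e \<in> carrier V" using e by (rule Fix_in)
  have fc0: "fourier \<mu> 0 = 1" using prob_space by (simp add: fourier_zero)
  have ee: "cinner V e e = 1" using mcoeff[of 0] fc0 eV by (simp add: mcoeff_zero)
  then have e0: "e \<noteq> \<zero>\<^bsub>V\<^esub>" using cinner_zero_left[of "\<zero>\<^bsub>V\<^esub>"] by auto
  have "irreducible_rep \<Gamma> V U"
  proof (rule irreducibleI[OF e e0 tot])
    fix y assume y: "y \<in> Fix" and orth: "\<And>k. k \<in> G \<Longrightarrow> mcoeff y (e \<ominus>\<^bsub>V\<^esub> y) k = 0"
    define y' where "y' = e \<ominus>\<^bsub>V\<^esub> y"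
    have y': "y' \<in> Fix" unfolding y'_def by (rule Fix_diff[OF e y])
    have yV: "y \<in> carrier V" and y'V: "y' \<in> carrier V" using y y' by (auto simp: Fix_in)
    obtain \<nu> where \<nu>: "circle_measure \<nu>" "\<And>k. fourier \<nu> k = mcoeff y y (of_int k)" using herglotz_Fix[OF y] by blast
    obtain \<nu>' where \<nu>': "circle_measure \<nu>'" "\<And>k. fourier \<nu>' k = mcoeff y' y' (of_int k)" using herglotz_Fix[OF y'] by blast
    \<comment> \<open>Orthogonality reduces the mixed coefficients of \<open>y\<close> and
      \<open>e\<close> to those of \<open>y\<close>, so the expansion for \<open>y'\<close> has no
      cross terms left: \<mu> is the sum of \<nu> and \<open>\<nu>'\<close>.\<close>
    have ye: "mcoeff y e k = mcoeff y y k" if "k \<in> G" for k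
      using orth[OF that] eV yV by (simp add: mcoeff_linear)
    have ey: "mcoeff e y k = mcoeff y y k" if k: "k \<in> G" for k
      using mcoeff_commute[OF y e, of "- k"] mcoeff_commute[OF y y, of "- k"] ye[of "- k"] Z_inv_uminus[OF k] by simp
    have sum: "fourier \<mu> k = fourier \<nu> k + fourier \<nu>' k" for k
      using eV yV ye[of "of_int k"] ey[of "of_int k"]
      by (simp add: \<nu>(2) \<nu>'(2) mcoeff[symmetric] y'_def mcoeff_linear)
    have "measure \<nu> E \<le> measure \<mu> E" if "E \<in> sets circle_borel" for E
      using measure_add_eqI_fourier[OF circle_measure_axioms \<nu>(1) \<nu>'(1) sum that] measure_nonneg[of \<nu>' E] by linarith
    from E.dominated_proportional[OF \<nu>(1) mcoeff_fourier_invariant[OF y \<nu>(2)] this]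
    have prop_c: "fourier \<nu> k = of_real (measure \<nu> circle) * fourier \<mu> k" for k by blast
    \<comment> \<open>Proportionality gives \<open>y\<close> and \<open>c \<odot> e\<close> the same
      matrix coefficients with \<open>e\<close> at the integers, hence on all of \<open>G\<close>;
      as the orbit of \<open>e\<close> is total, the two vectors agree.\<close>
    define c where "c = complex_of_real (measure \<nu> circle)"
    define w where "w = y \<ominus>\<^bsub>V\<^esub> c \<odot>\<^bsub>V\<^esub> e"
    have w: "w \<in> Fix" unfolding w_def by (intro Fix_diff Fix_smult y e)
    have wV: "w \<in> carrier V" using w by (rule Fix_in)
    have we: "mcoeff w e k = 0" if k: "k \<in> G" for k
    proof -
      obtain N a where a: "k * of_nat (p * q) ^ N = of_int a" using G_clear_denominator[OF k] by blast
      have "mcoeff w e k = mcoeff w e (of_int a)" by (rule mcoeff_eq_int[OF w e a])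
      also have "\<dots> = mcoeff y y (of_int a) - c * mcoeff e e (of_int a)"
        using eV yV ye[of "of_int a"] by (simp add: w_def mcoeff_linear)
      also have "\<dots> = 0" using prop_c[of a] by (simp add: c_def mcoeff \<nu>(2)[symmetric])
      finally show ?thesis .
    qed
    have "cinner V w (orb e k) = 0" for k
      using cinner_orb_orb[OF w e, of 0 k] we[of "- k"] wV Z_inv_uminus[of k] by (auto simp: orb_zero)
    then have "w = \<zero>\<^bsub>V\<^esub>" using tot wV unfolding total_def by blast
    then show "\<exists>c. y = c \<odot>\<^bsub>V\<^esub> e" using eV yV by (auto simp: w_def diff_eq_zero_iff)
  qed
  then show ?thesis
  proof (rule furstenberg_repI[OF _ e e0])
    fix k :: int assume "k \<noteq> 0"
    then show "mcoeff e e (of_int k) \<noteq> cinner V e e"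
      using fourier_one_imp_finitely_supported[OF circle_measure_axioms prob_space_axioms, of k] inf
      by (auto simp: mcoeff ee)
  qed
qed

lemma U_lincomb:
  assumes "g \<in> carrier \<Gamma>" "\<And>i. u i \<in> carrier V"
  shows "U g (lincomb u xs) = lincomb (\<lambda>i. U g (u i)) xs"
  using assms by (induction xs) (auto simp: U_zero U_add U_smult)

lemma lincomb_map: "lincomb u (map (\<lambda>(c, i). (c, f i)) xs) = lincomb (\<lambda>i. u (f i)) xs"
  by (induction xs) auto

lemma FixI_generators:
  assumes y: "y \<in> carrier V" and 1: "U (0, (1, 0)) y = y" and 2: "U (0, (0, 1)) y = y"
  shows "y \<in> Fix"
proof -
  \<comment> \<open>Stated as an equivalence, so that the integer induction can go upward and
    downward.\<close>
  have step: "U (g \<otimes>\<^bsub>\<Gamma>\<^esub> h) y = y \<longleftrightarrow> U h y = y" if g: "U g y = y" "g \<in> carrier \<Gamma>" and h: "h \<in> carrier \<Gamma>" for g h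
    using U_mult[OF g(2) h y] g(1) U_inv(1)[OF g(2) y] U_inv(1)[OF g(2) U_in[OF h y]] by metis
  have m: "U (0, (m, 0)) y = y" for m
  proof (induction m rule: int_induct[where k = 0])
    case base
    show ?case using U_one[OF y] by (simp add: furstenberg_group_simps)
  next
    case (step1 i)
    then show ?case using step[OF 1, of "(0, (i, 0))"] by (simp add: \<Gamma>_mult add.commute)
  next
    case (step2 i)
    then show ?case using step[OF 1, of "(0, (i - 1, 0))"] by (simp add: \<Gamma>_mult)
  qed
  have n: "U (0, (0, n)) y = y" for n
  proof (induction n rule: int_induct[where k = 0])
    case base
    show ?case by (rule m)
  next
    case (step1 i)
    then show ?case using step[OF 2, of "(0, (0, i))"] by (simp add: \<Gamma>_mult add.commute)
  next
    case (step2 i)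
    then show ?case using step[OF 2, of "(0, (0, i - 1))"] by (simp add: \<Gamma>_mult)
  qed
  show ?thesis
  proof (rule FixI[OF y])
    fix h :: "int \<times> int"
    obtain i j where "h = (i, j)" by (cases h)
    then show "U (0, h) y = y" using step[OF m[of i], of "(0, (0, j))"] n[of j] by (simp add: \<Gamma>_mult)
  qed
qed

end

text \<open>On a finite measure space convergence in \<open>L^2\<close> implies convergence in
  \<open>L^1\<close>, which survives a bounded multiplier. This evaluates the inner products with
  the limit vector that replaces \<open>1\<^sub>E x\<close>.\<close>

lemma (in circle_measure) trig_poly_L1_tendsto:
  assumes E: "E \<in> sets circle_borel" and h: "h \<in> borel_measurable \<mu>" "\<And>z. z \<in> circle \<Longrightarrow> cmod (h z) \<le> C"
    and xs: "(\<lambda>n. \<integral>z. (cmod (trig_poly (xs n) z - indicator E z))\<^sup>2 \<partial>\<mu>) \<longlonglongrightarrow> 0"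
  shows "(\<lambda>n. \<integral>z. h z * trig_poly (xs n) z \<partial>\<mu>) \<longlonglongrightarrow> (\<integral>z. h z * indicator E z \<partial>\<mu>)"
proof -
  have E' [measurable]: "E \<in> sets \<mu>" using E by (simp add: sets_eq)
  note [measurable] = h(1)
  define D where "D n z = trig_poly (xs n) z - indicator E z" for n z
  have Dm [measurable]: "D n \<in> borel_measurable \<mu>" for n unfolding D_def by measurable
  have Db: "\<exists>B. \<forall>z\<in>circle. cmod (D n z) \<le> B" for n
  proof -
    obtain B where "\<forall>z\<in>circle. cmod (trig_poly (xs n) z) \<le> B" using trig_poly_bounded by blast
    then have "cmod (D n z) \<le> B + 1" if "z \<in> circle" for z
      using that norm_triangle_ineq4[of "trig_poly (xs n) z" "indicator E z"] unfolding D_def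
      by (force simp: indicator_def split: if_splits)
    then show ?thesis by blast
  qed
  have i1: "integrable \<mu> (\<lambda>z. cmod (D n z))" and i2: "integrable \<mu> (\<lambda>z. (cmod (D n z))\<^sup>2)"
    and i3: "integrable \<mu> (\<lambda>z. h z * D n z)" for n
  proof -
    obtain B where B: "\<forall>z\<in>circle. cmod (D n z) \<le> B" using Db by blast
    show "integrable \<mu> (\<lambda>z. cmod (D n z))" by (rule bounded_integrable[where C = B]) (use B in auto)
    show "integrable \<mu> (\<lambda>z. (cmod (D n z))\<^sup>2)"
      by (rule bounded_integrable[where C = "B\<^sup>2"]) (use B in \<open>auto intro: power_mono\<close>)
    show "integrable \<mu> (\<lambda>z. h z * D n z)"
    proof (rule bounded_integrable[where C = "C * B"])
      show "norm (h z * D n z) \<le> C * B" if "z \<in> circle" for z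
        unfolding norm_mult using h(2)[OF that] B that by (intro mult_mono) (auto intro: order_trans[OF norm_ge_zero])
    qed simp
  qed
  have i4: "integrable \<mu> (\<lambda>z. h z * indicator E z)"
  proof (rule bounded_integrable[where C = C])
    show "norm (h z * indicator E z) \<le> C" if "z \<in> circle" for z
      using h(2)[OF that] order_trans[OF norm_ge_zero h(2)[OF that]] by (simp add: indicator_def)
  qed simp
  have i5: "integrable \<mu> (\<lambda>z. h z * trig_poly (xs n) z)" for n
  proof -
    have "(\<lambda>z. h z * trig_poly (xs n) z) = (\<lambda>z. h z * D n z + h z * indicator E z)"
      by (rule ext) (simp add: D_def algebra_simps)
    then show ?thesis using i3[of n] i4 by simp
  qed
  define T where "T = measure \<mu> circle"
  have C: "C \<ge> 0" using order_trans[OF norm_ge_zero h(2)[of 1]] by simp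
  have small: "(\<lambda>n. \<integral>z. cmod (D n z) \<partial>\<mu>) \<longlonglongrightarrow> 0"
  proof (rule LIMSEQ_I)
    fix e :: real assume e: "e > 0"
    \<comment> \<open>In 2 d |D| \<le> d^2 + |D|^2 the choice d T < e makes the integral of the
      right-hand side less than 2 d e once the \<open>L^2\<close> error is below d e.\<close>
    define d where "d = e / (T + 1)"
    have T: "T \<ge> 0" by (simp add: T_def)
    have d: "d > 0" using e T by (simp add: d_def)
    have dT: "d * T < e" using e T by (simp add: d_def field_simps)
    have "eventually (\<lambda>n. (\<integral>z. (cmod (D n z))\<^sup>2 \<partial>\<mu>) < d * e) sequentially"
      using xs e d unfolding D_def by (intro order_tendstoD(2)) auto
    then obtain M where M: "\<And>n. n \<ge> M \<Longrightarrow> (\<integral>z. (cmod (D n z))\<^sup>2 \<partial>\<mu>) < d * e"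
      unfolding eventually_sequentially by blast
    have "(\<integral>z. cmod (D n z) \<partial>\<mu>) < e" if n: "n \<ge> M" for n
    proof -
      have "(\<integral>z. 2 * d * cmod (D n z) \<partial>\<mu>) \<le> (\<integral>z. d\<^sup>2 + (cmod (D n z))\<^sup>2 \<partial>\<mu>)"
      proof (rule integral_mono)
        show "2 * d * cmod (D n z) \<le> d\<^sup>2 + (cmod (D n z))\<^sup>2" for z
          using sum_squares_bound[of d "cmod (D n z)"] by simp
      qed (use i1 i2 in auto)
      then have "2 * d * (\<integral>z. cmod (D n z) \<partial>\<mu>) \<le> d\<^sup>2 * T + (\<integral>z. (cmod (D n z))\<^sup>2 \<partial>\<mu>)"
        using i2 by (simp add: T_def mult.commute)
      also have "\<dots> < d * (d * T) + d * e" using M[OF n] by (simp add: power2_eq_square mult.assoc)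
      also have "\<dots> < d * e + d * e" using d dT by simp
      finally show ?thesis using d by simp
    qed
    then show "\<exists>M. \<forall>n\<ge>M. norm ((\<integral>z. cmod (D n z) \<partial>\<mu>) - 0) < e" by (intro exI[of _ M]) simp
  qed
  have "(\<lambda>n. C * (\<integral>z. cmod (D n z) \<partial>\<mu>)) \<longlonglongrightarrow> C * 0" by (intro tendsto_intros small)
  then have lim: "(\<lambda>n. C * (\<integral>z. cmod (D n z) \<partial>\<mu>)) \<longlonglongrightarrow> 0" by simp
  have "(\<lambda>n. (\<integral>z. h z * trig_poly (xs n) z \<partial>\<mu>) - (\<integral>z. h z * indicator E z \<partial>\<mu>)) \<longlonglongrightarrow> 0"
  proof (rule Lim_null_comparison[OF always_eventually lim], rule allI)
    fix n
    have "(\<integral>z. h z * trig_poly (xs n) z \<partial>\<mu>) - (\<integral>z. h z * indicator E z \<partial>\<mu>) = (\<integral>z. h z * D n z \<partial>\<mu>)"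
      using i4 i5[of n] by (simp add: D_def right_diff_distrib flip: Bochner_Integration.integral_diff)
    also have "norm \<dots> \<le> (\<integral>z. norm (h z * D n z) \<partial>\<mu>)" by (rule integral_norm_bound)
    also have "\<dots> \<le> (\<integral>z. C * cmod (D n z) \<partial>\<mu>)"
    proof (rule integral_mono)
      show "integrable \<mu> (\<lambda>z. norm (h z * D n z))" by (rule integrable_norm[OF i3])
      show "integrable \<mu> (\<lambda>z. C * cmod (D n z))" using i1 by simp
      show "norm (h z * D n z) \<le> C * cmod (D n z)" if "z \<in> space \<mu>" for z
        unfolding norm_mult using that h(2) by (intro mult_right_mono) auto
    qed
    finally show "norm ((\<integral>z. h z * trig_poly (xs n) z \<partial>\<mu>) - (\<integral>z. h z * indicator E z \<partial>\<mu>)) \<le> C * (\<integral>z. cmod (D n z) \<partial>\<mu>)"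
      by simp
  qed
  then show ?thesis by (simp add: LIM_zero_iff)
qed

section \<open>Trigonometric polynomials applied to a fixed vector\<close>

context furstenberg_unitary
begin

definition tvec :: "'h \<Rightarrow> (complex \<times> int) list \<Rightarrow> 'h" where
  "tvec x xs = lincomb (\<lambda>k. orb x (of_int k)) xs"

lemma tvec_in [simp]: "x \<in> carrier V \<Longrightarrow> tvec x xs \<in> carrier V"
  unfolding tvec_def by (rule lincomb_in) (rule orb_in)

lemma U_tvec_zpow:
  assumes "x \<in> Fix"
  shows "U (zpow (of_int k)) (tvec x xs) = tvec x (map (\<lambda>(c, l). (1 * c, k + l)) xs)"
proof -
  have "U (zpow (of_int k)) (tvec x xs) = lincomb (\<lambda>l. orb x (of_int (k + l))) xs"
    unfolding tvec_def using assms by (subst U_lincomb) (auto simp: U_orb Fix_in)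
  then show ?thesis by (simp add: tvec_def lincomb_map)
qed

lemma U_tvec_Z2:
  assumes "x \<in> Fix" "\<And>k. Z2_action p q h (of_int k) = of_int (int r * k)"
  shows "U (0, h) (tvec x xs) = tvec x (map (\<lambda>(c, l). (c, int r * l)) xs)"
proof -
  have "U (0, h) (tvec x xs) = lincomb (\<lambda>l. orb x (of_int (int r * l))) xs"
    unfolding tvec_def using assms by (subst U_lincomb) (auto simp: U_orb Fix_in)
  then show ?thesis by (simp add: tvec_def lincomb_map)
qed

text \<open>The assignment of \<open>tvec x xs\<close> to \<open>trig_poly xs\<close> is isometric
  for the norm of \<open>L^2(\<mu>)\<close>; this is how functions on the circle enter the abstract
  space.\<close>

lemma cinner_tvec:
  assumes x: "x \<in> Fix" and \<mu>: "circle_measure \<mu>" "\<And>k. fourier \<mu> k = mcoeff x x (of_int k)"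
  shows "cinner V (tvec x xs) (tvec x ys) = (\<integral>z. trig_poly xs z * cnj (trig_poly ys z) \<partial>\<mu>)"
proof -
  interpret circle_measure \<mu> by fact
  have "cinner V (orb x (of_int k)) (orb x (of_int l)) = fourier \<mu> (k - l)" for k l :: int
    using cinner_orb_eq_mcoeff[OF x x G_int G_int, of k l] by (simp add: \<mu>(2))
  then show ?thesis
    unfolding integral_trig_poly_mult_cnj tvec_def using x by (simp add: cinner_lincomb Fix_in)
qed

end

lemma trig_poly_dilate:
  assumes "z \<noteq> 0" shows "trig_poly (map (\<lambda>(c, l). (c, int r * l)) xs) z = trig_poly xs (z ^ r)"
  by (induction xs) (auto simp: power_int_mult)

lemma (in circle_measure) integral_power:
  fixes f :: "complex \<Rightarrow> complex"
  assumes "fourier_invariant r \<mu>" "f \<in> borel_measurable \<mu>"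
  shows "(\<integral>z. f (z ^ r) \<partial>\<mu>) = (\<integral>z. f z \<partial>\<mu>)"
proof -
  have "f \<in> borel_measurable circle_borel" using assms(2) measurable_cong_circle by blast
  from integral_distr[OF power_measurable this, of r] show ?thesis
    by (simp add: fourier_invariant_distr[OF assms(1)])
qed

section \<open>From irreducible representations to ergodic measures\<close>

context furstenberg_unitary
begin

lemma irreducible_ergodic:
  assumes irr: "irreducible_rep \<Gamma> V U" and x: "x \<in> Fix" "cinner V x x = 1"
  obtains \<mu> where "ergodic_prob p q \<mu>" "circle_measure \<mu>" "\<And>k. fourier \<mu> k = mcoeff x x (of_int k)"
proof -
  obtain \<mu> where \<mu>: "circle_measure \<mu>" "\<And>k. fourier \<mu> k = mcoeff x x (of_int k)" using herglotz_Fix[OF x(1)] by blast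
  interpret circle_measure \<mu> by (rule \<mu>)
  have xV: "x \<in> carrier V" using x by (simp add: Fix_in)
  have "measure \<mu> circle = 1"
    using \<mu>(2)[of 0] fourier_zero x(2) xV by (simp add: mcoeff_zero)
  then have "prob_space \<mu>" by (intro prob_spaceI) (simp add: emeasure_eq_measure)
  then interpret prob_space \<mu> .
  have inv: "fourier_invariant p \<mu>" "fourier_invariant q \<mu>" by (rule mcoeff_fourier_invariant[OF x(1) \<mu>(2)])+
  have "measure \<mu> E \<in> {0, 1}"
    if E: "E \<in> sets circle_borel" and Ep: "circle_preimage p E = E" and Eq: "circle_preimage q E = E" for E
  proof -
    have E' [measurable]: "E \<in> sets \<mu>" using E by (simp add: sets_eq)
    have EC: "E \<subseteq> circle" using E by (simp add: sets_circle_borel_iff)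
    have "\<forall>n. \<exists>xs. (\<integral>z. (cmod (trig_poly xs z - indicator E z))\<^sup>2 \<partial>\<mu>) < inverse (real (Suc n))"
      using indicator_approx[OF E] by (metis inverse_positive_iff_positive of_nat_0_less_iff zero_less_Suc)
    then obtain xs where xs: "\<And>n. (\<integral>z. (cmod (trig_poly (xs n) z - indicator E z))\<^sup>2 \<partial>\<mu>) < inverse (real (Suc n))"
      by metis
    have lim0: "(\<lambda>n. \<integral>z. (cmod (trig_poly (xs n) z - indicator E z))\<^sup>2 \<partial>\<mu>) \<longlonglongrightarrow> 0"
      by (rule tendsto_sandwich[OF always_eventually always_eventually tendsto_const LIMSEQ_inverse_real_of_nat])
        (use xs in \<open>auto intro: less_imp_le\<close>)
    define Y where "Y n = tvec x (xs n)" for n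
    have YV: "Y n \<in> carrier V" for n using xV by (simp add: Y_def)
    have int: "integrable \<mu> (\<lambda>z. (cmod (trig_poly ys z - indicator E z))\<^sup>2)" for ys
    proof -
      obtain B where B: "\<forall>z\<in>circle. cmod (trig_poly ys z) \<le> B" using trig_poly_bounded by blast
      show ?thesis
      proof (rule bounded_integrable[where C = "(B + 1)\<^sup>2"])
        fix z assume z: "z \<in> circle"
        have "cmod (trig_poly ys z - indicator E z) \<le> B + 1"
          using z B norm_triangle_ineq4[of "trig_poly ys z" "indicator E z"] by (force simp: indicator_def split: if_splits)
        then show "norm ((cmod (trig_poly ys z - indicator E z))\<^sup>2) \<le> (B + 1)\<^sup>2" by (auto intro: power_mono)
      qed measurable
    qed
    \<comment> \<open>The indicator is not a vector of the space; the distances between the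
      approximants are compared through it under the integral.\<close>
    have dist: "(hnorm V (Y m \<ominus>\<^bsub>V\<^esub> Y n))\<^sup>2 \<le> 2 * (\<integral>z. (cmod (trig_poly (xs m) z - indicator E z))\<^sup>2 \<partial>\<mu>) +
        2 * (\<integral>z. (cmod (trig_poly (xs n) z - indicator E z))\<^sup>2 \<partial>\<mu>)" for m n
    proof -
      have "Y m \<ominus>\<^bsub>V\<^esub> Y n = tvec x (ldiff (xs m) (xs n))"
        unfolding Y_def tvec_def using xV by (subst lincomb_ldiff) auto
      then have "cinner V (Y m \<ominus>\<^bsub>V\<^esub> Y n) (Y m \<ominus>\<^bsub>V\<^esub> Y n) =
          (\<integral>z. of_real ((cmod (trig_poly (xs m) z - trig_poly (xs n) z))\<^sup>2) \<partial>\<mu>)"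
        unfolding complex_norm_square by (simp add: cinner_tvec[OF x(1) \<mu>] trig_poly_ldiff)
      then have "(hnorm V (Y m \<ominus>\<^bsub>V\<^esub> Y n))\<^sup>2 = (\<integral>z. (cmod (trig_poly (xs m) z - trig_poly (xs n) z))\<^sup>2 \<partial>\<mu>)"
        unfolding integral_complex_of_real using YV by (simp add: hnorm_sq)
      also have "\<dots> \<le> (\<integral>z. 2 * (cmod (trig_poly (xs m) z - indicator E z))\<^sup>2 + 2 * (cmod (trig_poly (xs n) z - indicator E z))\<^sup>2 \<partial>\<mu>)"
      proof (rule integral_mono_AE')
        show "AE z in \<mu>. (cmod (trig_poly (xs m) z - trig_poly (xs n) z))\<^sup>2 \<le>
            2 * (cmod (trig_poly (xs m) z - indicator E z))\<^sup>2 + 2 * (cmod (trig_poly (xs n) z - indicator E z))\<^sup>2"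
        proof (rule AE_I2)
          fix z
          define a where "a = cmod (trig_poly (xs m) z - indicator E z)"
          define b where "b = cmod (trig_poly (xs n) z - indicator E z)"
          have "cmod (trig_poly (xs m) z - trig_poly (xs n) z) \<le> a + b"
            using norm_triangle_ineq4[of "trig_poly (xs m) z - indicator E z" "trig_poly (xs n) z - indicator E z"]
            by (simp add: a_def b_def)
          then have "(cmod (trig_poly (xs m) z - trig_poly (xs n) z))\<^sup>2 \<le> (a + b)\<^sup>2" by (rule power_mono) simp
          also have "\<dots> \<le> 2 * a\<^sup>2 + 2 * b\<^sup>2"
            using sum_squares_bound[of a b] by (simp add: power2_sum)
          finally show "(cmod (trig_poly (xs m) z - trig_poly (xs n) z))\<^sup>2 \<le>
            2 * (cmod (trig_poly (xs m) z - indicator E z))\<^sup>2 + 2 * (cmod (trig_poly (xs n) z - indicator E z))\<^sup>2"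
            by (simp add: a_def b_def)
        qed
      qed (use int in auto)
      also have "\<dots> = 2 * (\<integral>z. (cmod (trig_poly (xs m) z - indicator E z))\<^sup>2 \<partial>\<mu>) +
        2 * (\<integral>z. (cmod (trig_poly (xs n) z - indicator E z))\<^sup>2 \<partial>\<mu>)" using int by simp
      finally show ?thesis .
    qed
    have "hcauchy Y"
      unfolding hcauchy_def
    proof (intro conjI allI impI YV)
      fix e :: real assume e: "e > 0"
      then have "e\<^sup>2 / 4 > 0" by simp
      then obtain M where M: "inverse (real (Suc M)) < e\<^sup>2 / 4" using reals_Archimedean by blast
      show "\<exists>M. \<forall>m\<ge>M. \<forall>n\<ge>M. hnorm V (Y m \<ominus>\<^bsub>V\<^esub> Y n) < e"
      proof (intro exI allI impI)
        fix m n assume mn: "M \<le> m" "M \<le> n"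
        have "inverse (real (Suc m)) \<le> inverse (real (Suc M))" "inverse (real (Suc n)) \<le> inverse (real (Suc M))"
          using mn by (auto intro!: le_imp_inverse_le)
        then have "(hnorm V (Y m \<ominus>\<^bsub>V\<^esub> Y n))\<^sup>2 < e\<^sup>2"
          using dist[of m n] xs[of m] xs[of n] M by linarith
        then show "hnorm V (Y m \<ominus>\<^bsub>V\<^esub> Y n) < e" using e by (auto intro: power2_less_imp_less)
      qed
    qed
    \<comment> \<open>The vector \<open>y\<close> plays the role of \<open>1\<^sub>E x\<close>.\<close>
    then obtain y where y: "hconv Y y" by (rule hcauchy_convergent)
    have yV: "y \<in> carrier V" using y by (rule hconv_in)
    note lim = trig_poly_L1_tendsto[OF E _ _ lim0]
    have y_tvec: "cinner V y (tvec x ys) = (\<integral>z. cnj (trig_poly ys z) * indicator E z \<partial>\<mu>)" for ys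
    proof -
      obtain B where B: "\<forall>z\<in>circle. cmod (trig_poly ys z) \<le> B" using trig_poly_bounded by blast
      have 1: "(\<lambda>n. \<integral>z. cnj (trig_poly ys z) * trig_poly (xs n) z \<partial>\<mu>) \<longlonglongrightarrow> (\<integral>z. cnj (trig_poly ys z) * indicator E z \<partial>\<mu>)"
      proof (rule lim[where C = B])
        show "(\<lambda>z. cnj (trig_poly ys z)) \<in> borel_measurable \<mu>"
          by (rule borel_measurable_continuous_on[OF _ trig_poly_measurable]) (intro continuous_intros)
      qed (use B in auto)
      have "cinner V (Y n) (tvec x ys) = (\<integral>z. cnj (trig_poly ys z) * trig_poly (xs n) z \<partial>\<mu>)" for n
        by (simp add: Y_def cinner_tvec[OF x(1) \<mu>] mult.commute)
      then have "(\<lambda>n. \<integral>z. cnj (trig_poly ys z) * trig_poly (xs n) z \<partial>\<mu>) \<longlonglongrightarrow> cinner V y (tvec x ys)"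
        using hconv_cinner[OF y hconv_const[OF tvec_in[OF xV, of ys]]] by simp
      then show ?thesis using 1 by (rule LIMSEQ_unique)
    qed
    \<comment> \<open>The second \<open>y\<close> is approximated by \<open>Y n\<close>, to which
      \<open>y_tvec\<close> applies. In the limit the indicator occurs twice, and its square is the
      indicator itself.\<close>
    have y_orb: "cinner V y (orb y (of_int k)) = cnj (\<integral>z. z powi k * indicator E z \<partial>\<mu>)" for k
    proof (rule LIMSEQ_unique)
      have g: "zpow (of_int k) \<in> carrier \<Gamma>" by simp
      have o: "orb y (of_int k) = U (zpow (of_int k)) y" by (simp add: orb_def)
      show "(\<lambda>n. cinner V y (U (zpow (of_int k)) (Y n))) \<longlonglongrightarrow> cinner V y (orb y (of_int k))"
        unfolding o by (rule hconv_cinner[OF hconv_const[OF yV] U_hconv[OF g y]])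
      have eq: "cinner V y (U (zpow (of_int k)) (Y n)) = cnj (\<integral>z. (z powi k * indicator E z) * trig_poly (xs n) z \<partial>\<mu>)" for n
      proof -
        have "cinner V y (U (zpow (of_int k)) (Y n)) =
            (\<integral>z. cnj (trig_poly (map (\<lambda>(c, l). (1 * c, k + l)) (xs n)) z) * indicator E z \<partial>\<mu>)"
          unfolding Y_def U_tvec_zpow[OF x(1)] by (rule y_tvec)
        also have "\<dots> = (\<integral>z. cnj ((z powi k * indicator E z) * trig_poly (xs n) z) \<partial>\<mu>)"
        proof (rule Bochner_Integration.integral_cong[OF refl])
          fix z assume "z \<in> space \<mu>"
          then show "cnj (trig_poly (map (\<lambda>(c, l). (1 * c, k + l)) (xs n)) z) * indicator E z =
              cnj ((z powi k * indicator E z) * trig_poly (xs n) z)"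
            using trig_poly_shift[of z 1 k "xs n"] by (simp add: indicator_def)
        qed
        finally show ?thesis by (simp only: Bochner_Integration.integral_cnj)
      qed
      have "(\<lambda>n. \<integral>z. (z powi k * indicator E z) * trig_poly (xs n) z \<partial>\<mu>) \<longlonglongrightarrow> (\<integral>z. (z powi k * indicator E z) * indicator E z \<partial>\<mu>)"
        by (rule lim[where C = 1]) (auto simp: indicator_def)
      also have "(\<integral>z. (z powi k * indicator E z) * indicator E z \<partial>\<mu>) = (\<integral>z. z powi k * indicator E z \<partial>\<mu>)"
        by (intro Bochner_Integration.integral_cong) (auto simp: indicator_def)
      finally show "(\<lambda>n. cinner V y (U (zpow (of_int k)) (Y n))) \<longlonglongrightarrow> cnj (\<integral>z. z powi k * indicator E z \<partial>\<mu>)"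
        unfolding eq by (intro tendsto_intros)
    qed
    have indE: "(\<integral>z. (indicator E z :: complex) \<partial>\<mu>) = of_real (measure \<mu> E)"
    proof -
      have "(\<integral>z. (indicator E z :: complex) \<partial>\<mu>) = (\<integral>z. of_real (indicator E z) \<partial>\<mu>)"
        by (intro Bochner_Integration.integral_cong) (auto simp: indicator_def)
      also have "\<dots> = of_real (\<integral>z. indicator E z \<partial>\<mu>)" by (rule integral_complex_of_real)
      also have "(\<integral>z. indicator E z \<partial>\<mu>) = measure \<mu> E" using EC by (simp add: Int_absorb2)
      finally show ?thesis .
    qed
    have yy: "cinner V y y = of_real (measure \<mu> E)"
      using y_orb[of 0] yV by (simp add: orb_zero indE)
    \<comment> \<open>The inner product of \<open>y\<close> with its image equals both squared
      norms, so the two vectors coincide. The substitution of z^r for z uses the invariance of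
      \<open>E\<close> and that of \<mu>.\<close>
    have U_y: "U (0, h) y = y"
      if h: "\<And>k. Z2_action p q h (of_int k) = of_int (int r * k)" and r: "fourier_invariant r \<mu>" "circle_preimage r E = E" for h r
    proof -
      have g: "(0, h) \<in> carrier \<Gamma>" by simp
      have UyV: "U (0, h) y \<in> carrier V" using g yV by (rule U_in)
      have "cinner V y (U (0, h) y) = of_real (measure \<mu> E)"
      proof (rule LIMSEQ_unique)
        show "(\<lambda>n. cinner V y (U (0, h) (Y n))) \<longlonglongrightarrow> cinner V y (U (0, h) y)"
          by (rule hconv_cinner[OF hconv_const[OF yV] U_hconv[OF g y]])
        have eq: "cinner V y (U (0, h) (Y n)) = cnj (\<integral>z. indicator E z * trig_poly (xs n) z \<partial>\<mu>)" for n
        proof -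
          have "cinner V y (U (0, h) (Y n)) = (\<integral>z. cnj (trig_poly (map (\<lambda>(c, l). (c, int r * l)) (xs n)) z) * indicator E z \<partial>\<mu>)"
            unfolding Y_def U_tvec_Z2[OF x(1) h] by (rule y_tvec)
          also have "\<dots> = (\<integral>z. cnj (indicator E (z ^ r) * trig_poly (xs n) (z ^ r)) \<partial>\<mu>)"
          proof (rule Bochner_Integration.integral_cong[OF refl])
            fix z assume z: "z \<in> space \<mu>"
            then have "z \<in> E \<longleftrightarrow> z ^ r \<in> E" using r(2) by (auto simp: circle_preimage_def)
            then show "cnj (trig_poly (map (\<lambda>(c, l). (c, int r * l)) (xs n)) z) * indicator E z =
                cnj (indicator E (z ^ r) * trig_poly (xs n) (z ^ r))"
              using trig_poly_dilate[of z r "xs n"] z by (simp add: indicator_def)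
          qed
          also have "\<dots> = cnj (\<integral>z. indicator E (z ^ r) * trig_poly (xs n) (z ^ r) \<partial>\<mu>)"
            by (rule Bochner_Integration.integral_cnj)
          also have "(\<integral>z. indicator E (z ^ r) * trig_poly (xs n) (z ^ r) \<partial>\<mu>) = (\<integral>z. indicator E z * trig_poly (xs n) z \<partial>\<mu>)"
            by (rule integral_power[OF r(1)]) measurable
          finally show ?thesis .
        qed
        have "(\<lambda>n. \<integral>z. indicator E z * trig_poly (xs n) z \<partial>\<mu>) \<longlonglongrightarrow> (\<integral>z. indicator E z * indicator E z \<partial>\<mu>)"
          by (rule lim[where C = 1]) (auto simp: indicator_def)
        also have "(\<integral>z. indicator E z * indicator E z \<partial>\<mu>) = complex_of_real (measure \<mu> E)"
          unfolding indE[symmetric] by (intro Bochner_Integration.integral_cong) (auto simp: indicator_def)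
        finally have "(\<lambda>n. cnj (\<integral>z. indicator E z * trig_poly (xs n) z \<partial>\<mu>)) \<longlonglongrightarrow> cnj (complex_of_real (measure \<mu> E))"
          by (intro tendsto_intros)
        then show "(\<lambda>n. cinner V y (U (0, h) (Y n))) \<longlonglongrightarrow> of_real (measure \<mu> E)" unfolding eq by simp
      qed
      moreover have "cinner V (U (0, h) y) (U (0, h) y) = of_real (measure \<mu> E)"
        using U_cinner[OF g yV yV] yy by simp
      ultimately have "cinner V (U (0, h) y \<ominus>\<^bsub>V\<^esub> y) (U (0, h) y \<ominus>\<^bsub>V\<^esub> y) = 0"
        using yV UyV yy cinner_commute[OF yV UyV] by (simp add: cinner_diff_left cinner_diff_right)
      then show ?thesis using yV UyV by (simp add: cinner_self_eq_zero diff_eq_zero_iff)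
    qed
    have yF: "y \<in> Fix"
      by (rule FixI_generators[OF yV U_y[of _ p] U_y[of _ q]])
        (simp_all add: Z2_action_def inv Ep Eq mult.commute)
    \<comment> \<open>The inner products of \<open>orb y k\<close> with \<open>x\<close> and with
      \<open>y\<close> are both the integral of z^k over \<open>E\<close>.\<close>
    have orth_int: "mcoeff y (x \<ominus>\<^bsub>V\<^esub> y) (of_int k) = 0" for k
    proof -
      have orb_tvec: "orb x (of_int j) = tvec x [(1, j)]" for j
        using orb_in[OF xV] by (simp add: tvec_def)
      have "cinner V y (orb x (of_int (- k))) = (\<integral>z. cnj (z powi (- k)) * indicator E z \<partial>\<mu>)"
        unfolding orb_tvec y_tvec by simp
      also have "\<dots> = (\<integral>z. z powi k * indicator E z \<partial>\<mu>)"
        by (intro Bochner_Integration.integral_cong refl) (simp add: cnj_powi_circle)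
      finally have "cinner V (orb y (of_int k)) x = (\<integral>z. z powi k * indicator E z \<partial>\<mu>)"
        using cinner_orb_eq_mcoeff[OF yF x(1) G_int G_zero, of k] cinner_orb_eq_mcoeff[OF yF x(1) G_zero G_int, of "- k"] xV yV
        by (simp add: orb_zero)
      moreover have "cinner V (orb y (of_int k)) y = (\<integral>z. z powi k * indicator E z \<partial>\<mu>)"
        using cinner_commute[OF yV orb_in[OF yV], of "of_int k"] y_orb[of k] by simp
      ultimately show ?thesis using xV yV by (simp add: mcoeff_linear) (simp add: mcoeff_def)
    qed
    have xyF: "x \<ominus>\<^bsub>V\<^esub> y \<in> Fix" by (rule Fix_diff[OF x(1) yF])
    have "cinner V (x \<ominus>\<^bsub>V\<^esub> y) (orb y k) = 0" for k
    proof (cases "k \<in> G")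
      case True
      obtain N a where a: "k * of_nat (p * q) ^ N = of_int a" using G_clear_denominator[OF True] by blast
      have "mcoeff y (x \<ominus>\<^bsub>V\<^esub> y) k = 0" using mcoeff_eq_int[OF yF xyF a] orth_int by simp
      then show ?thesis
        using cinner_commute[OF orb_in[OF yV] Fix_in[OF xyF], of k] by (simp add: mcoeff_def)
    next
      case False
      then show ?thesis using Fix_in[OF xyF] by (simp add: orb_def cinner_zero_right)
    qed
    from irreducible_orthogonal[OF irr yF Fix_in[OF xyF] this]
    have "x = y \<or> y = \<zero>\<^bsub>V\<^esub>" using xV yV by (simp add: diff_eq_zero_iff)
    \<comment> \<open>The squared norm of \<open>y\<close> is the measure of \<open>E\<close>, while
      \<open>x\<close> is a unit vector.\<close>
    then have "complex_of_real (measure \<mu> E) = 1 \<or> complex_of_real (measure \<mu> E) = 0"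
      using yy x(2) by (auto simp: cinner_zero_left)
    then show ?thesis by auto
  qed
  then have "ergodic_prob p q \<mu>"
    unfolding ergodic_prob_def using invariant_probI[OF \<mu>(1) prob_space_axioms inv] by blast
  then show ?thesis using \<mu> by (rule that)
qed

end

text \<open>Clearing denominators makes the Gram matrices of both orbits equal. The resulting
  unitary map intertwines because both actions permute their orbit through the same
  \<open>act\<close>.\<close>

lemma equivalent_of_mcoeff_eq:
  assumes R: "furstenberg_unitary p q V U" and R': "furstenberg_unitary p q V' U'"
    and x: "x \<in> Z2_fixed V U" and x': "x' \<in> Z2_fixed V' U'"
    and tot: "pre_hilbert_space.total V (furstenberg_unitary.orb p q V U x)"
    and tot': "pre_hilbert_space.total V' (furstenberg_unitary.orb p q V' U' x')"
    and mcoeff: "\<And>k::int. furstenberg_unitary.mcoeff p q V U x x (of_int k) = furstenberg_unitary.mcoeff p q V' U' x' x' (of_int k)"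
  shows "unitarily_equivalent (furstenberg_group p q) V U V' U'"
proof -
  interpret R: furstenberg_unitary p q V U by fact
  interpret R': furstenberg_unitary p q V' U' by fact
  have cfG: "R.mcoeff x x k = R'.mcoeff x' x' k" if k: "k \<in> R.G" for k
  proof -
    obtain N a where a: "k * of_nat (p * q) ^ N = of_int a" using R.G_clear_denominator[OF k] by blast
    show ?thesis using R.mcoeff_eq_int[OF x x a] R'.mcoeff_eq_int[OF x' x' a] mcoeff by simp
  qed
  interpret T: two_hilbert V V' "R.orb x" "R'.orb x'"
    by unfold_locales
      (simp_all add: tot tot' R.cinner_orb_orb[OF x x] R'.cinner_orb_orb[OF x' x'] cfG R.G_diff)
  obtain f where f: "unitary_map V V' f"
    "\<And>v k. v \<in> carrier V \<Longrightarrow> cinner V' (f v) (R'.orb x' k) = cinner V v (R.orb x k)"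
    using T.unitary_exists by metis
  have fV: "f v \<in> carrier V'" if "v \<in> carrier V" for v
    using f(1) that by (auto simp: unitary_map_def bij_betw_def)
  have "f (U g v) = U' g (f v)" if g: "g \<in> carrier R.\<Gamma>" and v: "v \<in> carrier V" for g v
  proof -
    have c: "f (U g v) \<in> carrier V'" "U' g (f v) \<in> carrier V'" using g v fV R.U_in R'.U_in by auto
    have "cinner V' (f (U g v) \<ominus>\<^bsub>V'\<^esub> U' g (f v)) (R'.orb x' k) = 0" for k
    proof -
      obtain l where l: "k = R.act g l" using R.act_surj[of g k] by metis
      have "cinner V' (f (U g v)) (R'.orb x' k) = cinner V (U g v) (U g (R.orb x l))"
        using f(2)[OF R.U_in[OF g v]] by (simp add: l R.U_orb[OF x g])
      also have "\<dots> = cinner V' (f v) (R'.orb x' l)"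
        using R.U_cinner[OF g v R.orb_in[OF R.Fix_in[OF x]]] f(2)[OF v] by simp
      also have "\<dots> = cinner V' (U' g (f v)) (U' g (R'.orb x' l))"
        using R'.U_cinner[OF g fV[OF v] R'.orb_in[OF R'.Fix_in[OF x']]] by simp
      also have "\<dots> = cinner V' (U' g (f v)) (R'.orb x' k)" by (simp add: l R'.U_orb[OF x' g])
      finally show ?thesis using c R'.orb_in[OF R'.Fix_in[OF x']] by (simp add: R'.cinner_diff_left)
    qed
    then have "f (U g v) \<ominus>\<^bsub>V'\<^esub> U' g (f v) = \<zero>\<^bsub>V'\<^esub>"
      using tot' c R'.diff_in unfolding R'.total_def by blast
    then show ?thesis using c by (simp add: R'.diff_eq_zero_iff)
  qed
  then show ?thesis using f(1) unfolding unitarily_equivalent_def by blast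
qed

lemma furstenberg_rep_unit_vector:
  fixes V :: "'h inner_space"
  assumes "p > 1" "q > 1" and F: "furstenberg_rep p q V U"
  obtains x where "furstenberg_unitary p q V U" "x \<in> Z2_fixed V U" "cinner V x x = 1"
    "irreducible_rep (furstenberg_group p q) V U"
    "pre_hilbert_space.total V (furstenberg_unitary.orb p q V U x)"
    "\<And>k::int. k \<noteq> 0 \<Longrightarrow> furstenberg_unitary.mcoeff p q V U x x (of_int k) \<noteq> 1"
proof -
  have irr: "irreducible_rep (furstenberg_group p q) V U" using F by (simp add: furstenberg_rep_def)
  then have "unitary_rep (furstenberg_group p q) V U" by (simp add: irreducible_rep_def)
  then interpret furstenberg_unitary p q V U by unfold_locales (use assms in auto)
  have "\<zero>\<^bsub>V\<^esub> \<in> Fix" by (rule FixI) (auto simp: U_zero)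
  then obtain y where y: "y \<in> Fix" "y \<noteq> \<zero>\<^bsub>V\<^esub>" using F by (auto simp: furstenberg_rep_def)
  have yV: "y \<in> carrier V" using y by (simp add: Fix_in)
  have n: "hnorm V y \<noteq> 0" using y yV by (simp add: hnorm_eq_zero)
  define x where "x = of_real (1 / hnorm V y) \<odot>\<^bsub>V\<^esub> y"
  have x: "x \<in> Fix" unfolding x_def by (rule Fix_smult[OF y(1)])
  have xV: "x \<in> carrier V" using x by (rule Fix_in)
  have "hnorm V x = 1" unfolding x_def using n yV by (simp add: hnorm_smult norm_divide)
  then have xx: "cinner V x x = 1" using cinner_self_hnorm[OF xV] by simp
  then have x0: "x \<noteq> \<zero>\<^bsub>V\<^esub>" using cinner_zero_left[of "\<zero>\<^bsub>V\<^esub>"] by auto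
  have "mcoeff x x (of_int k) \<noteq> 1" if "k \<noteq> 0" for k :: int
  proof
    \<comment> \<open>The equality case of Cauchy-Schwarz: two unit vectors with inner product 1
      coincide.\<close>
    assume 1: "mcoeff x x (of_int k) = 1"
    define w where "w = orb x (of_int k)"
    have wV: "w \<in> carrier V" unfolding w_def by (rule orb_in[OF xV])
    have "cinner V w w = 1"
      unfolding w_def using cinner_orb_eq_mcoeff[OF x x G_int G_int, of k k] xV xx by (simp add: mcoeff_zero)
    moreover have "cinner V w x = 1" using 1 by (simp add: w_def mcoeff_def)
    moreover from this have "cinner V x w = 1" using cinner_commute[OF wV xV] by simp
    ultimately have "cinner V (w \<ominus>\<^bsub>V\<^esub> x) (w \<ominus>\<^bsub>V\<^esub> x) = 0"
      using wV xV xx by (simp add: cinner_diff_left cinner_diff_right)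
    then have "w = x" using wV xV by (simp add: cinner_self_eq_zero diff_eq_zero_iff)
    moreover have "U (zpow (of_int k)) x \<noteq> x" using F x x0 that by (auto simp: furstenberg_rep_def)
    ultimately show False by (simp add: w_def orb_def)
  qed
  then show ?thesis
    using that[OF furstenberg_unitary_axioms x xx irr irreducible_total[OF irr x x0]] by blast
qed

theorem corollary4p3:
  fixes p q :: nat
  assumes "p > 1" and "q > 1"
    and "ln (real p) / ln (real q) \<notin> \<rat>"
    and universe: "(UNIV :: real set) \<lesssim> (UNIV :: 'h set)"
  shows
    "(\<forall>\<mu>. ergodic_prob p q \<mu> \<longrightarrow> finitely_supported \<mu> \<or> \<mu> = circle_lebesgue)
     \<longleftrightarrow>
     (\<exists>(V :: 'h inner_space) U. furstenberg_rep p q V U) \<and>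
     (\<forall>(V :: 'h inner_space) U (V' :: 'h inner_space) U'.
        furstenberg_rep p q V U \<and> furstenberg_rep p q V' U' \<longrightarrow>
        unitarily_equivalent (furstenberg_group p q) V U V' U')"
proof -
  interpret pq p q by unfold_locales (use assms in auto)
  interpret leb: pq_measure p q circle_lebesgue
    using pq_axioms circle_measure_lebesgue pq_pos
    by (simp add: pq_measure_def pq_measure_axioms_def fourier_invariant_def fourier_lebesgue)
  obtain V0 :: "'h inner_space" and U0 e0 where R0: "furstenberg_unitary p q V0 U0"
    and e0: "e0 \<in> Z2_fixed V0 U0" and tot0: "pre_hilbert_space.total V0 (furstenberg_unitary.orb p q V0 U0 e0)"
    and cf0: "\<And>k. furstenberg_unitary.mcoeff p q V0 U0 e0 e0 (of_int k) = fourier circle_lebesgue k"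
    using leb.cyclic_rep_exists[OF universe] by blast
  interpret R0: furstenberg_unitary p q V0 U0 by (rule R0)
  have delta0: "R0.mcoeff e0 e0 (of_int k) = (if k = 0 then 1 else 0)" for k
    by (simp add: cf0 fourier_lebesgue)
  \<comment> \<open>Serves for existence in (b) and as the representation with which any other is
    compared in the converse.\<close>
  have F0: "furstenberg_rep p q V0 U0" by (rule R0.furstenberg_rep_delta[OF e0 delta0 tot0])
  show ?thesis
  proof (intro iffI conjI allI impI)
    show "\<exists>(V :: 'h inner_space) U. furstenberg_rep p q V U" using F0 by blast
  next
    fix V V' :: "'h inner_space" and U U'
    assume a: "\<forall>\<mu>. ergodic_prob p q \<mu> \<longrightarrow> finitely_supported \<mu> \<or> \<mu> = circle_lebesgue"
      and F: "furstenberg_rep p q V U \<and> furstenberg_rep p q V' U'"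
    \<comment> \<open>Each representation as in (b) contains a fixed vector with a total orbit and
      the coefficients of Lebesgue measure; two such representations are then equivalent by
      \<open>equivalent_of_mcoeff_eq\<close>.\<close>
    have delta: "\<exists>x. furstenberg_unitary p q V U \<and> x \<in> Z2_fixed V U \<and>
        pre_hilbert_space.total V (furstenberg_unitary.orb p q V U x) \<and>
        (\<forall>k. furstenberg_unitary.mcoeff p q V U x x (of_int k) = fourier circle_lebesgue k)"
      if FVU: "furstenberg_rep p q V U" for V :: "'h inner_space" and U
    proof -
      obtain x where R: "furstenberg_unitary p q V U" and x: "x \<in> Z2_fixed V U" "cinner V x x = 1"
        and irr: "irreducible_rep (furstenberg_group p q) V U"
        and tot: "pre_hilbert_space.total V (furstenberg_unitary.orb p q V U x)"
        and moved: "\<And>k::int. k \<noteq> 0 \<Longrightarrow> furstenberg_unitary.mcoeff p q V U x x (of_int k) \<noteq> 1"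
        using furstenberg_rep_unit_vector[OF assms(1,2) FVU] by blast
      interpret R: furstenberg_unitary p q V U by (rule R)
      obtain \<mu> where \<mu>: "ergodic_prob p q \<mu>" "\<And>k. fourier \<mu> k = R.mcoeff x x (of_int k)"
        using R.irreducible_ergodic[OF irr x] by blast
      have inv: "invariant_prob p q \<mu>" using \<mu>(1) by (simp add: ergodic_prob_def)
      have "\<not> finitely_supported \<mu>"
        using finitely_supported_imp_fourier_one[OF inv assms(1)] moved \<mu>(2) by metis
      then have "\<mu> = circle_lebesgue" using a \<mu>(1) by blast
      then show ?thesis using R x(1) tot \<mu>(2) by metis
    qed
    obtain x where x: "furstenberg_unitary p q V U" "x \<in> Z2_fixed V U"
        "pre_hilbert_space.total V (furstenberg_unitary.orb p q V U x)"
        "\<And>k. furstenberg_unitary.mcoeff p q V U x x (of_int k) = fourier circle_lebesgue k"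
      using delta F by blast
    obtain x' where x': "furstenberg_unitary p q V' U'" "x' \<in> Z2_fixed V' U'"
        "pre_hilbert_space.total V' (furstenberg_unitary.orb p q V' U' x')"
        "\<And>k. furstenberg_unitary.mcoeff p q V' U' x' x' (of_int k) = fourier circle_lebesgue k"
      using delta F by blast
    show "unitarily_equivalent (furstenberg_group p q) V U V' U'"
      by (rule equivalent_of_mcoeff_eq[OF x(1) x'(1) x(2) x'(2) x(3) x'(3)]) (simp add: x(4) x'(4))
  next
    fix \<mu>
    assume b: "(\<exists>(V :: 'h inner_space) U. furstenberg_rep p q V U) \<and>
     (\<forall>(V :: 'h inner_space) U (V' :: 'h inner_space) U'.
        furstenberg_rep p q V U \<and> furstenberg_rep p q V' U' \<longrightarrow>
        unitarily_equivalent (furstenberg_group p q) V U V' U')"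
      and \<mu>: "ergodic_prob p q \<mu>"
    show "finitely_supported \<mu> \<or> \<mu> = circle_lebesgue"
    proof (cases "finitely_supported \<mu>")
      case inf: False
      have inv: "invariant_prob p q \<mu>" using \<mu> by (simp add: ergodic_prob_def)
      note cm = circle_measure_invariant[OF inv]
      interpret m: pq_measure p q \<mu>
        using pq_axioms cm by (simp add: pq_measure_def pq_measure_axioms_def)
      obtain V :: "'h inner_space" and U e where R: "furstenberg_unitary p q V U"
        and e: "e \<in> Z2_fixed V U" and tot: "pre_hilbert_space.total V (furstenberg_unitary.orb p q V U e)"
        and mcoeff: "\<And>k. furstenberg_unitary.mcoeff p q V U e e (of_int k) = fourier \<mu> k"
        using m.cyclic_rep_exists[OF universe] by blast
      interpret R: furstenberg_unitary p q V U by (rule R)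
      have "furstenberg_rep p q V U" by (rule R.furstenberg_rep_ergodic[OF \<mu> inf e tot mcoeff])
      then have "unitarily_equivalent (furstenberg_group p q) V U V0 U0" using b F0 by blast
      then obtain f where f: "unitary_map V V0 f"
        and fU: "\<And>g x. g \<in> carrier \<Gamma> \<Longrightarrow> x \<in> carrier V \<Longrightarrow> f (U g x) = U0 g (f x)"
        unfolding unitarily_equivalent_def by blast
      have eV: "e \<in> carrier V" using e by (rule R.Fix_in)
      define y where "y = f e"
      have yV: "y \<in> carrier V0" using f eV by (auto simp: y_def unitary_map_def bij_betw_def)
      have y: "y \<in> R0.Fix"
        by (rule R0.FixI[OF yV]) (simp add: y_def fU[symmetric] eV R.Fix_eq[OF e])
      have cfy: "R0.mcoeff y y (of_int k) = fourier \<mu> k" for k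
      proof -
        have "R0.orb y (of_int k) = f (R.orb e (of_int k))"
          by (simp add: R0.orb_def R.orb_def y_def fU eV)
        then have "R0.mcoeff y y (of_int k) = R.mcoeff e e (of_int k)"
          unfolding R0.mcoeff_def R.mcoeff_def y_def using f eV R.orb_in[OF eV] by (simp add: unitary_map_def)
        then show ?thesis by (simp add: mcoeff)
      qed
      define c where "c = cinner V0 y e0"
      have yc: "y = c \<odot>\<^bsub>V0\<^esub> e0" unfolding c_def by (rule R0.delta_fixed[OF e0 delta0 tot0 y])
      \<comment> \<open>The transported cyclic vector lies on the line of \<open>e0\<close>, so its
        coefficients are those of Lebesgue measure times the squared modulus of \<open>c\<close>;
        the coefficient at 0 shows that this factor is 1.\<close>
      have fourier_c: "fourier \<mu> k = c * cnj c * fourier circle_lebesgue k" for k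
        unfolding cfy[symmetric] cf0[symmetric] yc using e0 by (simp add: R0.mcoeff_linear R0.Fix_in)
      interpret prob_space \<mu> by (rule cm(2))
      have "fourier \<mu> 0 = 1" using prob_space by (simp add: m.fourier_zero)
      then have "c * cnj c = 1" using fourier_c[of 0] by (simp add: fourier_lebesgue)
      then have "fourier \<mu> k = fourier circle_lebesgue k" for k using fourier_c by simp
      then have "\<mu> = circle_lebesgue" by (rule circle_measure_eqI_fourier[OF cm(1) circle_measure_lebesgue])
      then show ?thesis by blast
    qed simp
  qed
qed

end
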